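(* Let $(T,\mathfrak n)$ be a regular local ring with $\ell=\dim T\ge3$, $\mathfrak a\subsetneq T$ an ideal with $\mathfrak a\subseteq\mathfrak n^2$, and $n\ge2$ an integer. Suppose that $R=T/\mathfrak a$ is a Cohen-Macaulay local ring with $\dim R=1$ which is not Gorenstein, let $K$ be a fractional canonical ideal of $R$, and set $\mathfrak c=R:R[K]$ and $r=\mathrm r(R)$. Let $X_1,X_2,\ldots,X_\ell\in\mathfrak n$ be a regular system of parameters of $T$ and set $J_i=(X_1^i,X_2,\ldots,X_\ell)$ for $1\le i\le n$. Let $\ell_n>0$, $\ell_i\ge0$ ($1\le i<n$) be integers with $\sum_{i=1}^n\ell_i=r-1$, and let $f_{ij}\in K$ ($1\le i\le n$, $1\le j\le\ell_i$) be such that $K=R+\sum_{i=1}^n\sum_{j=1}^{\ell_i}Rf_{ij}$. Suppose that the $T$-module $K$ has a minimal free presentation $F_1\overset{\mathbb M}{\longrightarrow}F_0\overset{\mathbb N}{\longrightarrow}K\to0$ in which $$\mathbb N=\big[-1\ \ f_{n1}\cdots f_{n\ell_n}\ \ f_{n-1,1}\cdots f_{n-1,\ell_{n-1}}\ \cdots\ f_{11}\cdots f_{1\ell_1}\big]$$ and $\mathbb M$ has the following form: its rows are indexed by a first row followed by rows $(k,i)$ with $1\le k\le n$, $1\le i\le\ell_k$ (ordered as the entries $f_{ki}$ in $\mathbb N$); its columns consist, for each $(k,i)$ in the same order, of a block of $\ell$ columns whose first-row entries are $a_{i1}^{(k)},a_{i2}^{(k)},\ldots,a_{i\ell}^{(k)}$,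 whose entries in row $(k,i)$ are $X_1^k,X_2,\ldots,X_\ell$, and whose other entries are $0$; followed by $q\ge0$ further columns whose first-row entries are $c_1,\ldots,c_q\in\mathfrak n$ and whose other entries are $0$. Suppose moreover that $a_{ij}^{(n)}\in J_n$ ($1\le i\le\ell_n$, $1\le j\le\ell$), $a_{ij}^{(k)}\in J_n$ ($1\le k<n$, $1\le i\le\ell_k$, $2\le j\le\ell$), and $a_{i1}^{(k)}\in J_k$ ($1\le k<n$, $1\le i\le\ell_k$). Then $R$ is an $n$-Goto ring and $v(R/\mathfrak c)=1$.
   Context: $\mathrm Q(R)$ is the total ring of fractions of $R$, $\overline R$ the integral closure of $R$ in $\mathrm Q(R)$, and $X:Y=\{z\in\mathrm Q(R)\mid zY\subseteq X\}$. A fractional canonical ideal of $R$ is an $R$-submodule $K$ of $\mathrm Q(R)$ with $R\subseteq K\subseteq\overline R$ and $K\cong\mathrm K_R$, the canonical module. $K$ is a $T$-module via $T\to R$. $\mathrm r(R)$ is the Cohen-Macaulay type; $v(-)$ is the embedding dimension (minimal number of generators of the maximal ideal). For $n\ge0$, $R$ is an $n$-Goto ring if $K^2=K^3$ and $\ell_R(K^2/K)=n$ (equivalently, some, or any, canonical ideal $I\cong\mathrm K_R$, $I\neq R$, having a parameter ideal $(a)$ as a reduction satisfies $I^3=aI^2$ and $\ell_R(I^2/aI)=n$). *)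

theory Defs
  imports "HOL-Algebra.Ring_Divisibility" "HOL-Algebra.QuotRing" "HOL-Algebra.Ideal_Product"
    "HOL-Algebra.Generated_Rings" "HOL-Algebra.Module" "HOL-Library.Extended_Nat"
begin

section \<open>Noetherian local rings\<close>

definition noeth_local :: "('a, 'b) ring_scheme \<Rightarrow> bool" where
  "noeth_local R \<longleftrightarrow> cring R \<and> noetherian_ring R \<and> (\<exists>!\<mm>. maximalideal \<mm> R)"

definition max_ideal :: "('a, 'b) ring_scheme \<Rightarrow> 'a set" where
  "max_ideal R = (THE \<mm>. maximalideal \<mm> R)"

definition krull_dim :: "('a, 'b) ring_scheme \<Rightarrow> enat" where
  "krull_dim R = Sup {enat n | n. \<exists>P :: nat \<Rightarrow> 'a set.
     (\<forall>i\<le>n. primeideal (P i) R) \<and> (\<forall>i<n. P i \<subset> P (Suc i))}"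

definition num_gens :: "('a, 'b) ring_scheme \<Rightarrow> 'a set \<Rightarrow> enat" where
  "num_gens R I = Inf {enat (card S) | S. finite S \<and> S \<subseteq> carrier R \<and> genideal R S = I}"

definition emb_dim :: "('a, 'b) ring_scheme \<Rightarrow> enat" where
  "emb_dim R = num_gens R (max_ideal R)"

definition regular_local :: "('a, 'b) ring_scheme \<Rightarrow> bool" where
  "regular_local R \<longleftrightarrow> noeth_local R \<and> emb_dim R = krull_dim R"


section \<open>Modules\<close>

text \<open>An additive subgroup \<open>C\<close> of a ring \<open>S\<close>, as a module over the source of a ring
  homomorphism \<open>\<phi>\<close> into \<open>S\<close>, when \<open>C\<close> is stable under multiplication by the image of \<open>\<phi>\<close>.
  The fields \<open>mult\<close> and \<open>one\<close> of a \<^typ>\<open>('a, 'm) module\<close> play no role.\<close>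

definition restr_module :: "('s, 'x) ring_scheme \<Rightarrow> ('a \<Rightarrow> 's) \<Rightarrow> 's set \<Rightarrow> ('a, 's) module" where
  "restr_module S \<phi> C = \<lparr>carrier = C, mult = mult S, one = one S, zero = zero S, add = add S,
     smult = (\<lambda>a z. \<phi> a \<otimes>\<^bsub>S\<^esub> z)\<rparr>"

definition self_module :: "('a, 'x) ring_scheme \<Rightarrow> ('a, 'a) module" where
  "self_module R = restr_module R (\<lambda>x. x) (carrier R)"

definition residue_field :: "('a, 'x) ring_scheme \<Rightarrow> ('a, 'a set) module" where
  "residue_field R = (let \<mm> = max_ideal R in
     restr_module (R Quot \<mm>) (\<lambda>x. \<mm> +>\<^bsub>R\<^esub> x) (carrier (R Quot \<mm>)))"

text \<open>\<open>M\<^sup>I\<close> for a finite index set \<open>I\<close>.\<close>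

definition pow_module :: "('a, 'm) module \<Rightarrow> 'i set \<Rightarrow> ('a, 'i \<Rightarrow> 'm) module" where
  "pow_module M I = \<lparr>carrier = (I \<rightarrow>\<^sub>E carrier M), mult = undefined, one = undefined,
     zero = (\<lambda>i\<in>I. \<zero>\<^bsub>M\<^esub>), add = (\<lambda>u v. \<lambda>i\<in>I. u i \<oplus>\<^bsub>M\<^esub> v i),
     smult = (\<lambda>a v. \<lambda>i\<in>I. a \<odot>\<^bsub>M\<^esub> v i)\<rparr>"

text \<open>The map \<open>M\<^sup>J \<rightarrow> M\<^sup>I\<close> given by an \<open>I \<times> J\<close> matrix over the base ring.\<close>

definition mat_act :: "('a, 'm) module \<Rightarrow> 'i set \<Rightarrow> 'j set \<Rightarrow> ('i \<Rightarrow> 'j \<Rightarrow> 'a)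
    \<Rightarrow> ('j \<Rightarrow> 'm) \<Rightarrow> ('i \<Rightarrow> 'm)" where
  "mat_act M I J A y = (\<lambda>i\<in>I. \<Oplus>\<^bsub>M\<^esub>j\<in>J. A i j \<odot>\<^bsub>M\<^esub> y j)"

definition lin_comb :: "('a, 'm) module \<Rightarrow> 'i set \<Rightarrow> ('i \<Rightarrow> 'm) \<Rightarrow> ('i \<Rightarrow> 'a) \<Rightarrow> 'm" where
  "lin_comb M I e v = (\<Oplus>\<^bsub>M\<^esub>i\<in>I. v i \<odot>\<^bsub>M\<^esub> e i)"

definition fin_gen :: "('a, 'x) ring_scheme \<Rightarrow> ('a, 'm) module \<Rightarrow> bool" where
  "fin_gen R M \<longleftrightarrow> (\<exists>(n::nat) e. e \<in> {..<n} \<rightarrow> carrier M \<and>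
     carrier M = lin_comb M {..<n} e ` ({..<n} \<rightarrow>\<^sub>E carrier R))"

text \<open>The length of \<open>A/B\<close> for submodules \<open>B \<subseteq> A\<close> of \<open>M\<close>: submodules of \<open>A/B\<close> are identified
  with the submodules of \<open>M\<close> lying between \<open>B\<close> and \<open>A\<close>.\<close>

definition quot_length :: "('a, 'x) ring_scheme \<Rightarrow> ('a, 'm) module \<Rightarrow> 'm set \<Rightarrow> 'm set \<Rightarrow> enat" where
  "quot_length R M A B = Sup {enat n | n. \<exists>N :: nat \<Rightarrow> 'm set. N 0 = B \<and> N n = A \<and>
     (\<forall>i\<le>n. submodule (N i) R M) \<and> (\<forall>i<n. N i \<subset> N (Suc i))}"

text \<open>\<open>(x\<^sub>0, \<dots>, x\<^sub>n\<^sub>-\<^sub>1)M\<close>\<close>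

definition seq_mult :: "('a, 'm) module \<Rightarrow> (nat \<Rightarrow> 'a) \<Rightarrow> nat \<Rightarrow> 'm set" where
  "seq_mult M x n = {\<Oplus>\<^bsub>M\<^esub>i\<in>{..<n}. x i \<odot>\<^bsub>M\<^esub> y i | y. y \<in> {..<n} \<rightarrow> carrier M}"

definition regular_seq :: "('a, 'm) module \<Rightarrow> (nat \<Rightarrow> 'a) \<Rightarrow> nat \<Rightarrow> bool" where
  "regular_seq M x n \<longleftrightarrow> seq_mult M x n \<noteq> carrier M \<and>
     (\<forall>i<n. \<forall>y\<in>carrier M. x i \<odot>\<^bsub>M\<^esub> y \<in> seq_mult M x i \<longrightarrow> y \<in> seq_mult M x i)"

definition depth :: "('a, 'x) ring_scheme \<Rightarrow> ('a, 'm) module \<Rightarrow> enat" where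
  "depth R M = Sup {enat n | n. \<exists>x. x \<in> {..<n} \<rightarrow> max_ideal R \<and> regular_seq M x n}"

definition cohen_macaulay_local :: "('a, 'x) ring_scheme \<Rightarrow> bool" where
  "cohen_macaulay_local R \<longleftrightarrow> noeth_local R \<and> depth R (self_module R) = krull_dim R"


section \<open>Free resolutions and Ext\<close>

text \<open>Complexes \<open>\<cdots> \<rightarrow> R\<^bsup>b 2\<^esup> \<rightarrow> R\<^bsup>b 1\<^esup> \<rightarrow> R\<^bsup>b 0\<^esup>\<close> of finitely generated free modules; the map
  \<open>R\<^bsup>b (i + 1)\<^esup> \<rightarrow> R\<^bsup>b i\<^esup>\<close> is the \<open>b i \<times> b (i + 1)\<close> matrix \<open>d i\<close>.  Exactness is required
  in all positive degrees, so such a complex is a free resolution of the cokernel of \<open>d 0\<close>.\<close>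

definition acyclic_complex :: "('a, 'x) ring_scheme \<Rightarrow> (nat \<Rightarrow> nat)
    \<Rightarrow> (nat \<Rightarrow> nat \<Rightarrow> nat \<Rightarrow> 'a) \<Rightarrow> bool" where
  "acyclic_complex R b d \<longleftrightarrow>
     (\<forall>i. \<forall>k<b i. \<forall>j<b (Suc i). d i k j \<in> carrier R) \<and>
     (\<forall>i. {v \<in> {..<b (Suc i)} \<rightarrow>\<^sub>E carrier R.
            mat_act (self_module R) {..<b i} {..<b (Suc i)} (d i) v = (\<lambda>k\<in>{..<b i}. \<zero>\<^bsub>R\<^esub>)}
          = mat_act (self_module R) {..<b (Suc i)} {..<b (Suc (Suc i))} (d (Suc i))
              ` ({..<b (Suc (Suc i))} \<rightarrow>\<^sub>E carrier R))"

text \<open>\<open>e\<close> lists the images in \<open>N\<close> of the standard basis vectors of \<open>R\<^bsup>b 0\<^esup>\<close>.\<close>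

definition free_resolution :: "('a, 'x) ring_scheme \<Rightarrow> ('a, 'm) module \<Rightarrow> (nat \<Rightarrow> 'm)
    \<Rightarrow> (nat \<Rightarrow> nat) \<Rightarrow> (nat \<Rightarrow> nat \<Rightarrow> nat \<Rightarrow> 'a) \<Rightarrow> bool" where
  "free_resolution R N e b d \<longleftrightarrow> acyclic_complex R b d \<and> e \<in> {..<b 0} \<rightarrow> carrier N \<and>
     lin_comb N {..<b 0} e ` ({..<b 0} \<rightarrow>\<^sub>E carrier R) = carrier N \<and>
     {v \<in> {..<b 0} \<rightarrow>\<^sub>E carrier R. lin_comb N {..<b 0} e v = \<zero>\<^bsub>N\<^esub>}
       = mat_act (self_module R) {..<b 0} {..<b 1} (d 0) ` ({..<b 1} \<rightarrow>\<^sub>E carrier R)"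

text \<open>Applying \<open>Hom(-, M)\<close> to the complex gives \<open>M\<^bsup>b 0\<^esup> \<rightarrow> M\<^bsup>b 1\<^esup> \<rightarrow> \<cdots>\<close> with the transposed matrices.\<close>

definition coboundary_map :: "('a, 'm) module \<Rightarrow> (nat \<Rightarrow> nat) \<Rightarrow> (nat \<Rightarrow> nat \<Rightarrow> nat \<Rightarrow> 'a)
    \<Rightarrow> nat \<Rightarrow> (nat \<Rightarrow> 'm) \<Rightarrow> (nat \<Rightarrow> 'm)" where
  "coboundary_map M b d i = mat_act M {..<b (Suc i)} {..<b i} (\<lambda>j k. d i k j)"

definition cocycles :: "('a, 'm) module \<Rightarrow> (nat \<Rightarrow> nat) \<Rightarrow> (nat \<Rightarrow> nat \<Rightarrow> nat \<Rightarrow> 'a)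
    \<Rightarrow> nat \<Rightarrow> (nat \<Rightarrow> 'm) set" where
  "cocycles M b d i = {y \<in> {..<b i} \<rightarrow>\<^sub>E carrier M.
     coboundary_map M b d i y = (\<lambda>j\<in>{..<b (Suc i)}. \<zero>\<^bsub>M\<^esub>)}"

definition coboundaries :: "('a, 'm) module \<Rightarrow> (nat \<Rightarrow> nat) \<Rightarrow> (nat \<Rightarrow> nat \<Rightarrow> nat \<Rightarrow> 'a)
    \<Rightarrow> nat \<Rightarrow> (nat \<Rightarrow> 'm) set" where
  "coboundaries M b d i = (case i of
     0 \<Rightarrow> {\<lambda>j\<in>{..<b 0}. \<zero>\<^bsub>M\<^esub>}
   | Suc i' \<Rightarrow> coboundary_map M b d i' ` ({..<b i'} \<rightarrow>\<^sub>E carrier M))"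

text \<open>\<open>Ext\<^sup>i(N, M)\<close> is the quotient of the cocycles by the coboundaries, for any resolution of \<open>N\<close>.
  Its length does not depend on the resolution, and over a Noetherian ring every finitely
  generated \<open>N\<close> has a resolution of the above kind; hence the universal quantifier.\<close>

definition ext_length_is :: "('a, 'x) ring_scheme \<Rightarrow> ('a, 'n) module \<Rightarrow> ('a, 'm) module
    \<Rightarrow> nat \<Rightarrow> enat \<Rightarrow> bool" where
  "ext_length_is R N M i s \<longleftrightarrow> (\<forall>e b d. free_resolution R N e b d \<longrightarrow>
     quot_length R (pow_module M {..<b i}) (cocycles M b d i) (coboundaries M b d i) = s)"

text \<open>\<open>r(M) = dim\<^sub>k Ext\<^sup>t(k, M)\<close> with \<open>t = depth M\<close> and \<open>k\<close> the residue field.  The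
  module \<open>Ext\<^sup>t(k, M)\<close> is killed by the maximal ideal, so its dimension is its length.\<close>

definition has_type :: "('a, 'x) ring_scheme \<Rightarrow> ('a, 'm) module \<Rightarrow> nat \<Rightarrow> bool" where
  "has_type R M r \<longleftrightarrow> (\<exists>t. depth R M = enat t \<and> ext_length_is R (residue_field R) M t (enat r))"

text \<open>\<open>Ext\<^sup>i(N, M) = 0\<close> for all finitely generated \<open>N\<close> and all \<open>i > n\<close>, for some \<open>n\<close>; here
  \<open>N\<close> is the cokernel of \<open>d 0\<close>.  By Baer's criterion this says that \<open>M\<close> has an injective
  resolution of finite length.\<close>

definition finite_inj_dim :: "('a, 'x) ring_scheme \<Rightarrow> ('a, 'm) module \<Rightarrow> bool" where
  "finite_inj_dim R M \<longleftrightarrow> (\<exists>n. \<forall>b d. acyclic_complex R b d \<longrightarrow>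
     (\<forall>i>n. cocycles M b d i = coboundaries M b d i))"

definition gorenstein_local :: "('a, 'x) ring_scheme \<Rightarrow> bool" where
  "gorenstein_local R \<longleftrightarrow> noeth_local R \<and> finite_inj_dim R (self_module R)"

text \<open>A canonical module of a Cohen-Macaulay local ring is a maximal Cohen-Macaulay module of type 1
  and of finite injective dimension (Bruns and Herzog, Definition 3.3.1); it is unique up to
  isomorphism, so being isomorphic to the canonical module means having this property.\<close>

definition canonical_module :: "('a, 'x) ring_scheme \<Rightarrow> ('a, 'm) module \<Rightarrow> bool" where
  "canonical_module R C \<longleftrightarrow> cohen_macaulay_local R \<and> module R C \<and> fin_gen R C \<and>
     carrier C \<noteq> {\<zero>\<^bsub>C\<^esub>} \<and> depth R C = krull_dim R \<and> has_type R C 1 \<and> finite_inj_dim R C"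

text \<open>\<open>R\<^sup>J \<rightarrow> R\<^sup>I \<rightarrow> M \<rightarrow> 0\<close>, the first map being the matrix \<open>A\<close> and the second the row \<open>e\<close>.
  It is minimal if the kernels of \<open>R\<^sup>I \<rightarrow> M\<close> and of \<open>R\<^sup>J \<rightarrow> R\<^sup>I\<close> lie in \<open>\<mm>R\<^sup>I\<close> and \<open>\<mm>R\<^sup>J\<close>.\<close>

definition minimal_free_presentation :: "('a, 'x) ring_scheme \<Rightarrow> ('a, 'm) module
    \<Rightarrow> 'i set \<Rightarrow> 'j set \<Rightarrow> ('i \<Rightarrow> 'j \<Rightarrow> 'a) \<Rightarrow> ('i \<Rightarrow> 'm) \<Rightarrow> bool" where
  "minimal_free_presentation R M I J A e \<longleftrightarrow> finite I \<and> finite J \<and>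
     (\<forall>i\<in>I. \<forall>j\<in>J. A i j \<in> carrier R) \<and> e \<in> I \<rightarrow> carrier M \<and>
     lin_comb M I e ` (I \<rightarrow>\<^sub>E carrier R) = carrier M \<and>
     {v \<in> I \<rightarrow>\<^sub>E carrier R. lin_comb M I e v = \<zero>\<^bsub>M\<^esub>}
       = mat_act (self_module R) I J A ` (J \<rightarrow>\<^sub>E carrier R) \<and>
     {v \<in> I \<rightarrow>\<^sub>E carrier R. lin_comb M I e v = \<zero>\<^bsub>M\<^esub>} \<subseteq> (I \<rightarrow>\<^sub>E max_ideal R) \<and>
     {w \<in> J \<rightarrow>\<^sub>E carrier R. mat_act (self_module R) I J A w = (\<lambda>i\<in>I. \<zero>\<^bsub>R\<^esub>)}
       \<subseteq> (J \<rightarrow>\<^sub>E max_ideal R)"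


section \<open>Total rings of fractions and fractional ideals\<close>

text \<open>\<open>Q\<close>, together with \<open>\<iota>\<close>, is a model of the total ring of fractions of \<open>R\<close>; it is determined up
  to unique isomorphism over \<open>R\<close>.\<close>

definition total_fraction_ring :: "('a, 'x) ring_scheme \<Rightarrow> ('q, 'y) ring_scheme \<Rightarrow> ('a \<Rightarrow> 'q) \<Rightarrow> bool" where
  "total_fraction_ring R Q \<iota> \<longleftrightarrow> cring R \<and> cring Q \<and> \<iota> \<in> ring_hom R Q \<and> inj_on \<iota> (carrier R) \<and>
     (let W = {s \<in> carrier R. \<forall>x\<in>carrier R. s \<otimes>\<^bsub>R\<^esub> x = \<zero>\<^bsub>R\<^esub> \<longrightarrow> x = \<zero>\<^bsub>R\<^esub>} in
       (\<forall>s\<in>W. \<iota> s \<in> Units Q) \<and>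
       (\<forall>z\<in>carrier Q. \<exists>x\<in>carrier R. \<exists>s\<in>W. z = \<iota> x \<otimes>\<^bsub>Q\<^esub> inv\<^bsub>Q\<^esub> \<iota> s))"

definition integral_closure :: "('a, 'x) ring_scheme \<Rightarrow> ('q, 'y) ring_scheme \<Rightarrow> ('a \<Rightarrow> 'q) \<Rightarrow> 'q set" where
  "integral_closure R Q \<iota> = {z \<in> carrier Q. \<exists>(n::nat) c. c \<in> {..<n} \<rightarrow> carrier R \<and>
     z [^]\<^bsub>Q\<^esub> n \<oplus>\<^bsub>Q\<^esub> (\<Oplus>\<^bsub>Q\<^esub>i\<in>{..<n}. \<iota> (c i) \<otimes>\<^bsub>Q\<^esub> z [^]\<^bsub>Q\<^esub> i) = \<zero>\<^bsub>Q\<^esub>}"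

definition colon :: "('q, 'y) ring_scheme \<Rightarrow> 'q set \<Rightarrow> 'q set \<Rightarrow> 'q set" where
  "colon Q X Y = {z \<in> carrier Q. \<forall>y\<in>Y. z \<otimes>\<^bsub>Q\<^esub> y \<in> X}"

definition fractional_canonical_ideal :: "('a, 'x) ring_scheme \<Rightarrow> ('q, 'y) ring_scheme \<Rightarrow> ('a \<Rightarrow> 'q)
    \<Rightarrow> 'q set \<Rightarrow> bool" where
  "fractional_canonical_ideal R Q \<iota> K \<longleftrightarrow>
     submodule K R (restr_module Q \<iota> (carrier Q)) \<and>
     \<iota> ` carrier R \<subseteq> K \<and> K \<subseteq> integral_closure R Q \<iota> \<and>
     canonical_module R (restr_module Q \<iota> K)"

text \<open>The set \<^term>\<open>ideal_prod Q X Y\<close> consists of the finite sums of products of elements of \<open>X\<close> and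
  \<open>Y\<close>, which is the product of two fractional ideals.\<close>

definition n_goto_ring :: "('a, 'x) ring_scheme \<Rightarrow> ('q, 'y) ring_scheme \<Rightarrow> ('a \<Rightarrow> 'q) \<Rightarrow> nat \<Rightarrow> bool" where
  "n_goto_ring R Q \<iota> n \<longleftrightarrow> cohen_macaulay_local R \<and> krull_dim R = 1 \<and> total_fraction_ring R Q \<iota> \<and>
     (\<exists>K. fractional_canonical_ideal R Q \<iota> K \<and>
        ideal_prod Q K K = ideal_prod Q (ideal_prod Q K K) K \<and>
        quot_length R (restr_module Q \<iota> (carrier Q)) (ideal_prod Q K K) K = enat n)"


section \<open>The presentation matrix\<close>

text \<open>Rows: \<^term>\<open>None\<close> is the first row and \<^term>\<open>Some (k, i)\<close> is the row \<open>(k, i)\<close>.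
  Columns: \<^term>\<open>Inl ((k, i), j)\<close> is the \<open>j\<close>-th column of the block \<open>(k, i)\<close> and \<^term>\<open>Inr s\<close> is the
  \<open>s\<close>-th of the further columns.  All indices start at 1.\<close>

definition pairs :: "nat \<Rightarrow> (nat \<Rightarrow> nat) \<Rightarrow> (nat \<times> nat) set" where
  "pairs n len = (SIGMA k:{1..n}. {1..len k})"

definition pres_rows :: "nat \<Rightarrow> (nat \<Rightarrow> nat) \<Rightarrow> (nat \<times> nat) option set" where
  "pres_rows n len = insert None (Some ` pairs n len)"

definition pres_cols :: "nat \<Rightarrow> (nat \<Rightarrow> nat) \<Rightarrow> nat \<Rightarrow> nat \<Rightarrow> ((nat \<times> nat) \<times> nat + nat) set" where
  "pres_cols n len l q = (pairs n len \<times> {1..l}) <+> {1..q}"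

fun pres_mat :: "('a, 'x) ring_scheme \<Rightarrow> (nat \<Rightarrow> 'a) \<Rightarrow> (nat \<Rightarrow> nat \<Rightarrow> nat \<Rightarrow> 'a) \<Rightarrow> (nat \<Rightarrow> 'a)
    \<Rightarrow> (nat \<times> nat) option \<Rightarrow> ((nat \<times> nat) \<times> nat + nat) \<Rightarrow> 'a" where
  "pres_mat T X a c None (Inl ((k, i), j)) = a k i j"
| "pres_mat T X a c None (Inr s) = c s"
| "pres_mat T X a c (Some p) (Inl ((k, i), j)) =
     (if p = (k, i) then (if j = 1 then X 1 [^]\<^bsub>T\<^esub> k else X j) else \<zero>\<^bsub>T\<^esub>)"
| "pres_mat T X a c (Some p) (Inr s) = \<zero>\<^bsub>T\<^esub>"

fun pres_row :: "('q, 'y) ring_scheme \<Rightarrow> (nat \<Rightarrow> nat \<Rightarrow> 'q) \<Rightarrow> (nat \<times> nat) option \<Rightarrow> 'q" where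
  "pres_row Q f None = \<ominus>\<^bsub>Q\<^esub> \<one>\<^bsub>Q\<^esub>"
| "pres_row Q f (Some (k, i)) = f k i"

end

theory Submission
  imports Defs
begin

text \<open>Write \<open>x = X\<^sub>1\<close>, \<open>Y = (X\<^sub>2, \<dots>, X\<^sub>l)\<close> and \<open>J\<^sub>i = Y + (x\<^sup>i)\<close>; everything inside \<open>Q\<close> is a \<open>T\<close>-module
  through \<open>T \<rightarrow> R \<rightarrow> Q\<close>.

  The conductor.  A column of the presentation matrix is a relation \<open>x\<^sup>k f\<^sub>k\<^sub>i = a\<^sub>i\<^sub>1\<close> or
  \<open>X\<^sub>j f\<^sub>k\<^sub>i = a\<^sub>i\<^sub>j\<close>, and by the hypotheses on the entries \<open>J\<^sub>n\<close> multiplies every generator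
  of \<open>K\<close>, hence \<open>K\<close> and \<open>R[K]\<close>, into \<open>J\<^sub>nR\<close>.  Conversely all relations come from the columns, so
  \<open>t f\<^sub>k\<^sub>i \<in> R\<close> implies \<open>t \<in> J\<^sub>k\<close>.  Applied to \<open>f\<^sub>n\<^sub>1\<close> this gives \<open>\<cc> = J\<^sub>nR\<close>, and \<open>R/\<cc> = T/J\<^sub>n\<close> has maximal
  ideal generated by \<open>x\<close>.  Krull's height theorem shows \<open>x\<^sup>n\<^sup>-\<^sup>1 \<notin> J\<^sub>n\<close>; in particular \<open>v(R/\<cc>) = 1\<close>,
  and \<open>x\<^sup>n\<^sup>-\<^sup>1\<close> does not multiply \<open>K\<close> into \<open>R\<close>.

  The length of \<open>K\<^sup>2/K\<close>.  Two properties of the canonical ideal matter: \<open>(K : \<mm>)/K\<close> is generated by each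
  of its nonzero elements (type one, \<open>type_one_socle\<close>), and \<open>K : K = R\<close> (\<open>endomorphisms_trivial\<close>).  By
  the second one \<open>x\<^sup>n\<^sup>-\<^sup>1K\<^sup>2\<close> is not contained in \<open>K\<close>; choose \<open>z = fg\<close> with \<open>f, g \<in> K\<close> and
  \<open>x\<^sup>n\<^sup>-\<^sup>1z \<notin> K\<close>.  Since \<open>\<mm>x\<^sup>i \<subseteq> J\<^sub>i\<^sub>+\<^sub>1\<close>, the first one yields \<open>K : J\<^sub>i = K + Rx\<^sup>n\<^sup>-\<^sup>iz\<close> by induction on \<open>i\<close>
  (\<open>colon_generated\<close>).  Now \<open>J\<^sub>n\<close> multiplies all powers of \<open>K\<close> into \<open>K\<close>, so
  \<open>K + Rz \<subseteq> K\<^sup>2 \<subseteq> K\<^sup>3 \<subseteq> K : J\<^sub>n = K + Rz\<close>, and the submodules between \<open>K\<close> and \<open>K + Rz\<close> are the \<open>n + 1\<close> modules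
  \<open>K + Rx\<^sup>n\<^sup>-\<^sup>iz\<close>.

  What remains is commutative algebra of Noetherian rings.  Krull's theorem (\<open>krull_principal_ideal\<close>,
  \<open>height_le_card\<close>) is proved by Kaplansky's comparison of lengths.  For \<open>K : K = R\<close> there is an argument that
  avoids Matlis duality: an ideal \<open>I\<close> is called reflexive if \<open>K : (K : I) = I\<close>; the ideal \<open>sK\<close>, for a
  regular element \<open>s\<close> with \<open>sK \<subseteq> R\<close>, is reflexive, and reflexivity survives the addition of a socle
  element because \<open>K\<close> has type one.  The type is defined by \<open>Ext\<close>, so a free resolution of the residue
  field is constructed in order to extract the statement about \<open>(K : \<mm>)/K\<close>.\<close>

section \<open>Ideals and primes of Noetherian rings\<close>

locale noetherian_cring = noetherian_ring R + cring R for R (structure)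

lemma (in cring) idealI_comm:
  assumes "I \<subseteq> carrier R" "\<zero> \<in> I" "\<And>a b. a \<in> I \<Longrightarrow> b \<in> I \<Longrightarrow> a \<oplus> b \<in> I"
    "\<And>a r. a \<in> I \<Longrightarrow> r \<in> carrier R \<Longrightarrow> r \<otimes> a \<in> I"
  shows "ideal I R"
proof (rule idealI)
  have "\<ominus> a \<in> I" if "a \<in> I" for a
    using assms(4)[OF that, of "\<ominus> \<one>"] that assms(1) by (auto simp: l_minus)
  then show "subgroup I (add_monoid R)"
    using assms by (intro subgroup.intro) (auto simp: a_inv_def)
qed (use assms m_comm in \<open>auto simp: ring_axioms subset_iff\<close>)

lemma ideal_add: "ideal I R \<Longrightarrow> a \<in> I \<Longrightarrow> b \<in> I \<Longrightarrow> a \<oplus>\<^bsub>R\<^esub> b \<in> I"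
  by (simp add: additive_subgroup.a_closed ideal.axioms(1))

lemma ideal_zero: "ideal I R \<Longrightarrow> \<zero>\<^bsub>R\<^esub> \<in> I"
  by (simp add: additive_subgroup.zero_closed ideal.axioms(1))

lemma ideal_subset: "ideal I R \<Longrightarrow> I \<subseteq> carrier R"
  by (simp add: additive_subgroup.a_subset ideal.axioms(1))

lemma ideal_minus: "ideal I R \<Longrightarrow> a \<in> I \<Longrightarrow> b \<in> I \<Longrightarrow> a \<ominus>\<^bsub>R\<^esub> b \<in> I"
  by (metis a_minus_def additive_subgroup.a_closed additive_subgroup.a_inv_closed ideal.axioms
        ring.is_abelian_group abelian_group_def)

lemma (in cring) ideal_add_cancel:
  assumes "ideal I R" "a \<in> I" "a \<oplus> b \<in> I" "b \<in> carrier R"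
  shows "b \<in> I"
proof -
  have "a \<in> carrier R" using assms ideal_subset by blast
  then have "(a \<oplus> b) \<ominus> a = b" using assms(4) by algebra
  then show ?thesis using ideal_minus[OF assms(1,3,2)] by simp
qed

lemma (in cring) ideal_colon:
  assumes "ideal I R" "y \<in> carrier R"
  shows "ideal {t \<in> carrier R. t \<otimes> y \<in> I} R"
proof (rule idealI_comm)
  show "\<zero> \<in> {t \<in> carrier R. t \<otimes> y \<in> I}" using assms ideal_zero[OF assms(1)] by simp
  show "a \<oplus> b \<in> {t \<in> carrier R. t \<otimes> y \<in> I}"
    if "a \<in> {t \<in> carrier R. t \<otimes> y \<in> I}" "b \<in> {t \<in> carrier R. t \<otimes> y \<in> I}" for a b
    using that assms(2) ideal_add[OF assms(1)] by (auto simp: l_distr)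
  show "r \<otimes> a \<in> {t \<in> carrier R. t \<otimes> y \<in> I}"
    if "a \<in> {t \<in> carrier R. t \<otimes> y \<in> I}" "r \<in> carrier R" for a r
    using that assms(2) ideal.I_l_closed[OF assms(1)] by (auto simp: m_assoc)
qed blast

lemma (in cring) ideal_mult_add:
  assumes N: "ideal N R" and I: "ideal I R" and u: "u \<in> carrier R"
  shows "ideal {u \<otimes> z \<oplus> q | z q. z \<in> N \<and> q \<in> I} R" (is "ideal ?L R")
proof (rule idealI_comm)
  note Nc = ideal_subset[OF N] and Ic = ideal_subset[OF I]
  show "?L \<subseteq> carrier R" using Nc Ic u by auto
  have "\<zero> = u \<otimes> \<zero> \<oplus> \<zero>" using u by simp
  then show "\<zero> \<in> ?L" using ideal_zero[OF N] ideal_zero[OF I] by blast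
  fix d assume "d \<in> ?L"
  then obtain z q where d: "d = u \<otimes> z \<oplus> q" "z \<in> N" "q \<in> I" by blast
  then have dc: "z \<in> carrier R" "q \<in> carrier R" using Nc Ic by auto
  show "d \<oplus> e \<in> ?L" if "e \<in> ?L" for e
  proof -
    obtain z' q' where e: "e = u \<otimes> z' \<oplus> q'" "z' \<in> N" "q' \<in> I" using \<open>e \<in> ?L\<close> by blast
    then have ec: "z' \<in> carrier R" "q' \<in> carrier R" using Nc Ic by auto
    have "d \<oplus> e = u \<otimes> (z \<oplus> z') \<oplus> (q \<oplus> q')" unfolding d e using dc ec u by algebra
    then show ?thesis using d e ideal_add[OF N] ideal_add[OF I] by blast
  qed
  show "r \<otimes> d \<in> ?L" if "r \<in> carrier R" for r
  proof -
    have "r \<otimes> d = u \<otimes> (r \<otimes> z) \<oplus> r \<otimes> q" unfolding d using dc that u by algebra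
    then show ?thesis using d ideal.I_l_closed[OF N _ that] ideal.I_l_closed[OF I _ that] by blast
  qed
qed

definition adjoin :: "('a, 'b) ring_scheme \<Rightarrow> 'a set \<Rightarrow> 'a \<Rightarrow> 'a set" where
  "adjoin R I y = {i \<oplus>\<^bsub>R\<^esub> r \<otimes>\<^bsub>R\<^esub> y | i r. i \<in> I \<and> r \<in> carrier R}"

lemma (in cring) ideal_adjoin:
  assumes "ideal I R" "y \<in> carrier R"
  shows "ideal (adjoin R I y) R"
proof (rule idealI_comm)
  note I = ideal_subset[OF assms(1)]
  show "adjoin R I y \<subseteq> carrier R" using I assms(2) by (auto simp: adjoin_def)
  have "\<zero> = \<zero> \<oplus> \<zero> \<otimes> y" using assms(2) by simp
  then show "\<zero> \<in> adjoin R I y" unfolding adjoin_def using ideal_zero[OF assms(1)] by blast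
  fix a assume "a \<in> adjoin R I y"
  then obtain i r where a: "a = i \<oplus> r \<otimes> y" "i \<in> I" "r \<in> carrier R" by (auto simp: adjoin_def)
  have ic: "i \<in> carrier R" using a I by blast
  show "a \<oplus> b \<in> adjoin R I y" if "b \<in> adjoin R I y" for b
  proof -
    from that obtain i' r' where b: "b = i' \<oplus> r' \<otimes> y" "i' \<in> I" "r' \<in> carrier R" by (auto simp: adjoin_def)
    have "i' \<in> carrier R" using b I by blast
    then have "a \<oplus> b = (i \<oplus> i') \<oplus> (r \<oplus> r') \<otimes> y" unfolding a b using a b ic assms(2) by algebra
    then show ?thesis unfolding adjoin_def using a b ideal_add[OF assms(1)] by blast
  qed
  show "s \<otimes> a \<in> adjoin R I y" if "s \<in> carrier R" for s
  proof -
    have "s \<otimes> a = s \<otimes> i \<oplus> (s \<otimes> r) \<otimes> y" unfolding a using a that ic assms(2) by algebra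
    then show ?thesis unfolding adjoin_def
      using a that ideal.I_l_closed[OF assms(1)] m_closed by blast
  qed
qed

lemma (in cring) adjoin_superset: "ideal I R \<Longrightarrow> y \<in> carrier R \<Longrightarrow> I \<subseteq> adjoin R I y"
proof
  fix i assume "ideal I R" "y \<in> carrier R" "i \<in> I"
  moreover from this have "i \<in> carrier R" using ideal_subset by blast
  ultimately have "i = i \<oplus> \<zero> \<otimes> y" by simp
  then show "i \<in> adjoin R I y" unfolding adjoin_def using \<open>i \<in> I\<close> by blast
qed

lemma (in cring) adjoin_mult: "ideal I R \<Longrightarrow> y \<in> carrier R \<Longrightarrow> r \<in> carrier R \<Longrightarrow> r \<otimes> y \<in> adjoin R I y"
proof -
  assume *: "ideal I R" "y \<in> carrier R" "r \<in> carrier R"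
  have "r \<otimes> y = \<zero> \<oplus> r \<otimes> y" using *(2,3) by simp
  then show "r \<otimes> y \<in> adjoin R I y" unfolding adjoin_def using *(3) ideal_zero[OF *(1)] by blast
qed

lemma (in cring) adjoin_self: "ideal I R \<Longrightarrow> y \<in> carrier R \<Longrightarrow> y \<in> adjoin R I y"
  using adjoin_mult[of I y \<one>] by simp

lemma (in cring) adjoin_least:
  assumes "ideal L R" "I \<subseteq> L" "y \<in> L"
  shows "adjoin R I y \<subseteq> L"
proof
  fix x assume "x \<in> adjoin R I y"
  then obtain i r where "x = i \<oplus> r \<otimes> y" "i \<in> I" "r \<in> carrier R" unfolding adjoin_def by blast
  then show "x \<in> L" using ideal_add[OF assms(1), of i "r \<otimes> y"] ideal.I_l_closed[OF assms(1,3)] assms(2) by blast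
qed

lemma (in noetherian_cring) exists_maximal:
  assumes "C \<noteq> {}" "\<And>I. I \<in> C \<Longrightarrow> ideal I R"
  obtains M where "M \<in> C" "\<And>I. I \<in> C \<Longrightarrow> M \<subseteq> I \<Longrightarrow> I = M"
proof -
  have "\<exists>M\<in>C. \<forall>X\<in>C. M \<subseteq> X \<longrightarrow> X = M"
  proof (rule subset_Zorn)
    fix D assume D: "subset.chain C D"
    show "\<exists>U\<in>C. \<forall>X\<in>D. X \<subseteq> U"
    proof (cases "D = {}")
      case True then show ?thesis using assms(1) by blast
    next
      case False
      have "subset.chain {I. ideal I R} D" using D assms(2) unfolding pred_on.chain_def by auto
      then have U: "\<Union>D \<in> D" using ideal_chain_is_trivial[OF False] by simp
      moreover have "D \<subseteq> C" using D unfolding pred_on.chain_def by simp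
      ultimately show ?thesis by (intro bexI[of _ "\<Union>D"]) auto
    qed
  qed
  then show thesis using that by blast
qed

text \<open>An ideal that is maximal among those containing \<open>I\<close> and missing the multiplicative set \<open>S\<close> is
  prime: if \<open>a\<close> and \<open>b\<close> lie outside, then \<open>P + Ra\<close> and \<open>P + Rb\<close> meet \<open>S\<close>, and the product of the two
  meeting elements lies in \<open>P + Rab\<close>.\<close>

lemma (in noetherian_cring) exists_prime_avoiding:
  assumes "ideal I R" "S \<subseteq> carrier R" "\<one> \<in> S" "\<And>s t. s \<in> S \<Longrightarrow> t \<in> S \<Longrightarrow> s \<otimes> t \<in> S" "I \<inter> S = {}"
  obtains P where "primeideal P R" "I \<subseteq> P" "P \<inter> S = {}"
proof -
  obtain P where P: "P \<in> {L. ideal L R \<and> I \<subseteq> L \<and> L \<inter> S = {}}"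
    and max: "\<And>L. L \<in> {L. ideal L R \<and> I \<subseteq> L \<and> L \<inter> S = {}} \<Longrightarrow> P \<subseteq> L \<Longrightarrow> L = P"
    using exists_maximal[of "{L. ideal L R \<and> I \<subseteq> L \<and> L \<inter> S = {}}"] assms(1,5) by blast
  have id: "ideal P R" using P by simp
  note Pc = ideal_subset[OF id]
  have meet: "\<exists>s\<in>S. s \<in> adjoin R P a" if "a \<in> carrier R" "a \<notin> P" for a
  proof (rule ccontr)
    assume "\<not> ?thesis"
    then have "adjoin R P a = P"
      using max[of "adjoin R P a"] ideal_adjoin[OF id that(1)] adjoin_superset[OF id that(1)] P by auto
    then show False using adjoin_self[OF id that(1)] that(2) by simp
  qed
  have "primeideal P R"
  proof (rule primeidealI[OF id is_cring])
    show "carrier R \<noteq> P" using P assms(2,3) by auto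
    fix a b assume ab: "a \<in> carrier R" "b \<in> carrier R" "a \<otimes> b \<in> P"
    show "a \<in> P \<or> b \<in> P"
    proof (rule ccontr)
      assume "\<not> ?thesis"
      then obtain s t where st: "s \<in> S" "s \<in> adjoin R P a" "t \<in> S" "t \<in> adjoin R P b"
        using meet ab by blast
      then obtain p u p' u' where e: "s = p \<oplus> u \<otimes> a" "t = p' \<oplus> u' \<otimes> b" "p \<in> P" "p' \<in> P"
        "u \<in> carrier R" "u' \<in> carrier R" by (auto simp: adjoin_def)
      have c: "p \<in> carrier R" "p' \<in> carrier R" using e Pc by auto
      have "s \<otimes> t = t \<otimes> p \<oplus> ((u \<otimes> a) \<otimes> p' \<oplus> (u \<otimes> u') \<otimes> (a \<otimes> b))"
        unfolding e using e c ab by algebra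
      also have "\<dots> \<in> P"
      proof -
        have "t \<in> carrier R" using st assms(2) by auto
        then have "t \<otimes> p \<in> P" "(u \<otimes> a) \<otimes> p' \<in> P" "(u \<otimes> u') \<otimes> (a \<otimes> b) \<in> P"
          using e ab ideal.I_l_closed[OF id] by auto
        then show ?thesis using ideal_add[OF id] by blast
      qed
      finally show False using assms(4)[OF st(1,3)] P by blast
    qed
  qed
  then show thesis using that P by blast
qed

text \<open>Associated primes exist: among the ideals \<open>I : y\<close> with \<open>y \<notin> I\<close> a maximal one is prime, since
  \<open>I : y \<subseteq> I : by\<close>.\<close>

lemma (in noetherian_cring) exists_prime_colon:
  assumes "ideal I R" "I \<noteq> carrier R"
  obtains y where "y \<in> carrier R" "y \<notin> I" "primeideal {t \<in> carrier R. t \<otimes> y \<in> I} R"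
proof -
  define col where "col y = {t \<in> carrier R. t \<otimes> y \<in> I}" for y
  have col_id: "ideal (col y) R" if "y \<in> carrier R" for y
    unfolding col_def by (rule ideal_colon[OF assms(1) that])
  have "{col y | y. y \<in> carrier R - I} \<noteq> {}" using assms ideal_subset[OF assms(1)] by blast
  then obtain M where M: "M \<in> {col y | y. y \<in> carrier R - I}"
    "\<And>L. L \<in> {col y | y. y \<in> carrier R - I} \<Longrightarrow> M \<subseteq> L \<Longrightarrow> L = M"
    using exists_maximal[of "{col y | y. y \<in> carrier R - I}"] col_id by blast
  from M(1) obtain y where y: "y \<in> carrier R - I" "M = col y" by blast
  have max: "col z = col y" if "z \<in> carrier R - I" "col y \<subseteq> col z" for z
    using M(2)[of "col z"] that y(2) by blast
  have "primeideal (col y) R"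
  proof (rule primeidealI[OF col_id is_cring])
    show "y \<in> carrier R" using y by simp
    have "\<one> \<notin> col y" using y by (auto simp: col_def)
    then show "carrier R \<noteq> col y" by auto
    fix a b assume ab: "a \<in> carrier R" "b \<in> carrier R" "a \<otimes> b \<in> col y"
    show "a \<in> col y \<or> b \<in> col y"
    proof (cases "b \<otimes> y \<in> I")
      case True then show ?thesis using ab by (simp add: col_def)
    next
      case False
      have "col y \<subseteq> col (b \<otimes> y)"
      proof
        fix t assume t: "t \<in> col y"
        then have "t \<otimes> (b \<otimes> y) = b \<otimes> (t \<otimes> y)" using ab y by (simp add: col_def m_lcomm)
        then show "t \<in> col (b \<otimes> y)" using t ab ideal.I_l_closed[OF assms(1)] by (auto simp: col_def)
      qed
      then have "col (b \<otimes> y) = col y" using max[of "b \<otimes> y"] False ab y by simp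
      moreover have "a \<in> col (b \<otimes> y)" using ab y by (simp add: col_def m_assoc)
      ultimately show ?thesis by simp
    qed
  qed
  then show thesis using that y by (auto simp: col_def)
qed

lemma (in cring) prime_pow: "primeideal P R \<Longrightarrow> z \<in> carrier R \<Longrightarrow> z [^] (k::nat) \<in> P \<Longrightarrow> z \<in> P"
proof (induction k)
  case 0
  then have "carrier R = P" using ideal.one_imp_carrier[of P R] by (auto simp: primeideal_def)
  then show ?case using 0 by (simp add: primeideal.I_notcarr)
next
  case (Suc k) then show ?case using primeideal.I_prime[of P R "z [^] k" z] by auto
qed

text \<open>If every element of \<open>P\<close> is nilpotent modulo \<open>I\<close>, then any prime of the form \<open>I : y\<close> contains \<open>P\<close>.
  Such a \<open>y\<close> is the means by which an ideal is enlarged by one composition factor at a time, both in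
  the proof of Krull's theorem and in the proof of \<open>K : K = R\<close>.\<close>

lemma (in noetherian_cring) exists_socle_step:
  assumes "ideal I R" "I \<noteq> carrier R" "\<And>z. z \<in> P \<Longrightarrow> z \<in> carrier R \<and> (\<exists>k::nat. z [^] k \<in> I)"
  obtains y where "y \<in> carrier R" "y \<notin> I" "\<And>z. z \<in> P \<Longrightarrow> z \<otimes> y \<in> I"
proof -
  obtain y where y: "y \<in> carrier R" "y \<notin> I" and pr: "primeideal {t \<in> carrier R. t \<otimes> y \<in> I} R"
    using exists_prime_colon[OF assms(1,2)] .
  have "z \<otimes> y \<in> I" if z: "z \<in> P" for z
  proof -
    obtain k :: nat where k: "z [^] k \<in> I" "z \<in> carrier R" using assms(3)[OF z] by blast
    then have "z [^] k \<otimes> y \<in> I" using y ideal.I_r_closed[OF assms(1)] by simp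
    then have "z \<in> {t \<in> carrier R. t \<otimes> y \<in> I}" using prime_pow[OF pr k(2), of k] k by simp
    then show ?thesis by simp
  qed
  then show thesis using that y by blast
qed

section \<open>Lengths after localisation at a prime\<close>

text \<open>The preimage in \<open>R\<close> of the localised ideal \<open>I\<^sub>P\<close>.  An inclusion \<open>J\<^sub>P \<subseteq> I\<^sub>P\<close> becomes
  \<^term>\<open>J \<subseteq> sat R P I\<close>, so the ring \<open>R\<^sub>P\<close> itself never has to be constructed.\<close>

definition sat :: "('a, 'b) ring_scheme \<Rightarrow> 'a set \<Rightarrow> 'a set \<Rightarrow> 'a set" where
  "sat R P I = {z \<in> carrier R. \<exists>s\<in>carrier R - P. s \<otimes>\<^bsub>R\<^esub> z \<in> I}"

lemma satI: "s \<in> carrier R - P \<Longrightarrow> z \<in> carrier R \<Longrightarrow> s \<otimes>\<^bsub>R\<^esub> z \<in> I \<Longrightarrow> z \<in> sat R P I"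
  unfolding sat_def by blast

text \<open>A chain of ideals from \<open>I\<close> to \<open>J\<close>, of which \<open>n\<close> chosen steps remain strict in the local ring
  \<open>R\<^sub>P\<close>.  The largest possible \<open>n\<close> is the length of the \<open>R\<^sub>P\<close>-module \<open>J\<^sub>P/I\<^sub>P\<close>.\<close>

inductive climb :: "('a, 'b) ring_scheme \<Rightarrow> 'a set \<Rightarrow> 'a set \<Rightarrow> 'a set \<Rightarrow> nat \<Rightarrow> bool" for R P I where
  refl: "climb R P I I 0"
| weak: "climb R P I J n \<Longrightarrow> ideal K R \<Longrightarrow> J \<subseteq> K \<Longrightarrow> climb R P I K n"
| strict: "climb R P I J n \<Longrightarrow> ideal K R \<Longrightarrow> J \<subseteq> K \<Longrightarrow> \<not> K \<subseteq> sat R P J \<Longrightarrow> climb R P I K (Suc n)"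

lemma climb_ideal: "climb R P I J n \<Longrightarrow> ideal I R \<Longrightarrow> ideal J R"
  by (induction rule: climb.induct) auto

lemma climb_subset: "climb R P I J n \<Longrightarrow> I \<subseteq> J"
  by (induction rule: climb.induct) auto

lemma climb_trans: "climb R P J K b \<Longrightarrow> climb R P I J a \<Longrightarrow> climb R P I K (a + b)"
proof (induction rule: climb.induct)
  case refl then show ?case by simp
next
  case (weak K n L) then show ?case by (auto intro: climb.weak)
next
  case (strict K n L) then show ?case using climb.strict[of R P I K "a + n" L] by simp
qed

context cring
begin

lemma prime_mult_notin:
  "primeideal P R \<Longrightarrow> s \<in> carrier R - P \<Longrightarrow> t \<in> carrier R - P \<Longrightarrow> s \<otimes> t \<in> carrier R - P"
  using primeideal.I_prime[of P R s t] by blast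

lemma prime_one_notin: assumes "primeideal P R" shows "\<one> \<in> carrier R - P"
proof -
  have "\<one> \<notin> P"
    using ideal.one_imp_carrier[OF primeideal.axioms(1)[OF assms]] primeideal.I_notcarr[OF assms] by auto
  then show ?thesis by simp
qed

lemma sat_superset: assumes "primeideal P R" "I \<subseteq> carrier R" shows "I \<subseteq> sat R P I"
proof
  fix z assume "z \<in> I"
  moreover from this have "\<one> \<otimes> z = z" "z \<in> carrier R" using assms(2) by auto
  ultimately show "z \<in> sat R P I" unfolding sat_def using prime_one_notin[OF assms(1)] by (auto intro!: bexI[of _ \<one>])
qed

lemma sat_mono: "I \<subseteq> J \<Longrightarrow> sat R P I \<subseteq> sat R P J"
  unfolding sat_def by blast

lemma sat_idem: "primeideal P R \<Longrightarrow> sat R P (sat R P I) \<subseteq> sat R P I"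
proof
  fix z assume P: "primeideal P R" and "z \<in> sat R P (sat R P I)"
  then obtain s where s: "z \<in> carrier R" "s \<in> carrier R - P" "s \<otimes> z \<in> sat R P I"
    unfolding sat_def by blast
  then obtain t where "t \<in> carrier R - P" "t \<otimes> (s \<otimes> z) \<in> I"
    unfolding sat_def by blast
  note * = s(1,2) this
  have "t \<otimes> (s \<otimes> z) = (t \<otimes> s) \<otimes> z" using *(1-3) by (simp add: m_assoc)
  then have "(t \<otimes> s) \<otimes> z \<in> I" using *(4) by simp
  then show "z \<in> sat R P I" unfolding sat_def using *(1) prime_mult_notin[OF P *(3,2)] by blast
qed

lemma ideal_sat: assumes "primeideal P R" "ideal I R" shows "ideal (sat R P I) R"
proof (rule idealI_comm)
  note id = assms(2)
  show "sat R P I \<subseteq> carrier R" unfolding sat_def by blast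
  show "\<zero> \<in> sat R P I" using sat_superset[OF assms(1) ideal_subset[OF id]] ideal_zero[OF id] by blast
  fix a assume "a \<in> sat R P I"
  then obtain s where s: "a \<in> carrier R" "s \<in> carrier R - P" "s \<otimes> a \<in> I" unfolding sat_def by blast
  show "a \<oplus> b \<in> sat R P I" if "b \<in> sat R P I" for b
  proof -
    obtain t where t: "b \<in> carrier R" "t \<in> carrier R - P" "t \<otimes> b \<in> I"
      using \<open>b \<in> sat R P I\<close> unfolding sat_def by blast
    have c: "s \<in> carrier R" "t \<in> carrier R" using s t by auto
    have "(s \<otimes> t) \<otimes> (a \<oplus> b) = t \<otimes> (s \<otimes> a) \<oplus> s \<otimes> (t \<otimes> b)" using s(1) t(1) c by algebra
    also have "\<dots> \<in> I"
      using ideal_add[OF id] ideal.I_l_closed[OF id s(3)] ideal.I_l_closed[OF id t(3)] s t by blast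
    finally show ?thesis unfolding sat_def
      using a_closed[OF s(1) t(1)] prime_mult_notin[OF assms(1) s(2) t(2)] by blast
  qed
  show "r \<otimes> a \<in> sat R P I" if "r \<in> carrier R" for r
  proof -
    have "s \<otimes> (r \<otimes> a) = r \<otimes> (s \<otimes> a)" using s that by (simp add: m_lcomm)
    then have "s \<otimes> (r \<otimes> a) \<in> I" using ideal.I_l_closed[OF id s(3) that] by simp
    then show ?thesis using s that unfolding sat_def by blast
  qed
qed

lemma mem_set_add: "x \<in> A <+>\<^bsub>R\<^esub> B \<longleftrightarrow> (\<exists>a\<in>A. \<exists>b\<in>B. x = a \<oplus> b)"
  unfolding set_add_defs by auto

lemma set_add_absorb:
  assumes "ideal I R" "ideal J R" "I \<subseteq> J"
  shows "I <+>\<^bsub>R\<^esub> J = J" "J <+>\<^bsub>R\<^esub> I = J"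
proof -
  have *: "j = \<zero> \<oplus> j \<and> j = j \<oplus> \<zero>" if "j \<in> J" for j
    using that ideal_subset[OF assms(2)] by auto
  show "I <+>\<^bsub>R\<^esub> J = J" "J <+>\<^bsub>R\<^esub> I = J"
    unfolding set_eq_iff mem_set_add
    using * assms(3) ideal_zero[OF assms(1)] ideal_add[OF assms(2)] by (blast, blast)
qed

lemma set_add_mono: "A \<subseteq> B \<Longrightarrow> A <+>\<^bsub>R\<^esub> J \<subseteq> B <+>\<^bsub>R\<^esub> J"
  unfolding subset_iff mem_set_add by blast

text \<open>Subadditivity of length: a chain from \<open>I\<close> to \<open>K\<close> is intersected with \<open>J\<close> and added to \<open>J\<close>.  A step
  \<open>K \<subset> L\<close> that collapses in both new chains collapses in the old one: an element of \<open>L\<close> is then, up to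
  a factor outside \<open>P\<close>, the sum of an element of \<open>K\<close> and one of \<open>L \<inter> J\<close> (modular law).\<close>

lemma climb_split:
  assumes "primeideal P R" "climb R P I K n" "ideal I R" "ideal J R" "I \<subseteq> J"
  shows "\<exists>a b. climb R P I (K \<inter> J) a \<and> climb R P J (K <+>\<^bsub>R\<^esub> J) b \<and> n \<le> a + b"
  using assms(2)
proof induction
  case refl
  have "I \<inter> J = I" "I <+>\<^bsub>R\<^esub> J = J" using assms(5) set_add_absorb[OF assms(3-5)] by auto
  then show ?case using climb.refl[of R P I] climb.refl[of R P J] by (intro exI[of _ 0]) simp
next
  case (weak K n L)
  then obtain a b where ab: "climb R P I (K \<inter> J) a" "climb R P J (K <+>\<^bsub>R\<^esub> J) b" "n \<le> a + b" by blast
  have "climb R P I (L \<inter> J) a" using climb.weak[OF ab(1)] weak(2,3) i_intersect[OF weak(2) assms(4)] by blast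
  moreover have "climb R P J (L <+>\<^bsub>R\<^esub> J) b"
    using climb.weak[OF ab(2) add_ideals[OF weak(2) assms(4)]] set_add_mono[OF weak(3)] by blast
  ultimately show ?case using ab by blast
next
  case (strict K n L)
  then obtain a b where ab: "climb R P I (K \<inter> J) a" "climb R P J (K <+>\<^bsub>R\<^esub> J) b" "n \<le> a + b" by blast
  have K: "ideal K R" using climb_ideal[OF strict(1) assms(3)] .
  have LJ: "ideal (L \<inter> J) R" "K \<inter> J \<subseteq> L \<inter> J" using strict i_intersect assms(4) by auto
  have LpJ: "ideal (L <+>\<^bsub>R\<^esub> J) R" "K <+>\<^bsub>R\<^esub> J \<subseteq> L <+>\<^bsub>R\<^esub> J"
    using add_ideals[OF strict(2) assms(4)] set_add_mono[OF strict(3)] by auto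
  show ?case
  proof (cases "L \<inter> J \<subseteq> sat R P (K \<inter> J)")
    case False
    have "climb R P I (L \<inter> J) (Suc a)" using climb.strict[OF ab(1) LJ False] .
    moreover have "climb R P J (L <+>\<^bsub>R\<^esub> J) b" using climb.weak[OF ab(2) LpJ] .
    ultimately show ?thesis using ab(3) by (intro exI[of _ "Suc a"] exI[of _ b]) auto
  next
    case True
    have "\<not> L <+>\<^bsub>R\<^esub> J \<subseteq> sat R P (K <+>\<^bsub>R\<^esub> J)"
    proof
      assume *: "L <+>\<^bsub>R\<^esub> J \<subseteq> sat R P (K <+>\<^bsub>R\<^esub> J)"
      have "L \<subseteq> sat R P K"
      proof
        fix z assume z: "z \<in> L"
        then have zc: "z \<in> carrier R" using ideal_subset[OF strict(2)] by blast
        have "z = z \<oplus> \<zero>" using zc by simp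
        then have "z \<in> L <+>\<^bsub>R\<^esub> J" unfolding mem_set_add using z ideal_zero[OF assms(4)] by blast
        then obtain s where s: "s \<in> carrier R - P" "s \<otimes> z \<in> K <+>\<^bsub>R\<^esub> J" using * unfolding sat_def by blast
        then obtain w j where wj: "w \<in> K" "j \<in> J" "s \<otimes> z = w \<oplus> j" unfolding mem_set_add by blast
        have c: "w \<in> carrier R" "j \<in> carrier R"
          using wj ideal_subset[OF K] ideal_subset[OF assms(4)] by auto
        have "w \<in> L" "s \<otimes> z \<in> L" using wj(1) strict(3) s(1) ideal.I_l_closed[OF strict(2) z] by auto
        then have "j \<in> L" using ideal_add_cancel[OF strict(2) \<open>w \<in> L\<close>, of j] wj c by simp
        then have "j \<in> sat R P K" using True wj(2) unfolding sat_def by blast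
        moreover have "w \<in> sat R P K" using sat_superset[OF assms(1) ideal_subset[OF K]] wj by blast
        ultimately have "s \<otimes> z \<in> sat R P K" using wj ideal_add[OF ideal_sat[OF assms(1) K]] by simp
        then have "z \<in> sat R P (sat R P K)" using s zc unfolding sat_def by blast
        then show "z \<in> sat R P K" using sat_idem[OF assms(1)] by blast
      qed
      then show False using strict(4) by blast
    qed
    then have "climb R P J (L <+>\<^bsub>R\<^esub> J) (Suc b)" using climb.strict[OF ab(2) LpJ] by blast
    moreover have "climb R P I (L \<inter> J) a" using climb.weak[OF ab(1) LJ] .
    ultimately show ?thesis using ab(3) by (intro exI[of _ a] exI[of _ "Suc b"]) auto
  qed
qed

lemma climb_split_between:
  assumes "primeideal P R" "climb R P I K n" "ideal I R" "ideal J R" "I \<subseteq> J" "J \<subseteq> K"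
  obtains a b where "climb R P I J a" "climb R P J K b" "n \<le> a + b"
proof -
  have K: "ideal K R" using climb_ideal assms by blast
  have "K \<inter> J = J" using assms(6) by blast
  moreover have "K <+>\<^bsub>R\<^esub> J = K" using set_add_absorb[OF assms(4) K assms(6)] by simp
  ultimately show thesis using climb_split[OF assms(1-5)] that by auto
qed

text \<open>Transport of a chain along a monotone map of ideals that does not identify different members of
  the chain, such as multiplication by an element which is regular modulo the lower end.\<close>

lemma climb_map:
  assumes "climb R P I J n" "J \<subseteq> C" "ideal I R"
    and "\<And>K. ideal K R \<Longrightarrow> I \<subseteq> K \<Longrightarrow> K \<subseteq> C \<Longrightarrow> ideal (\<phi> K) R"
    and "\<And>K L. K \<subseteq> L \<Longrightarrow> \<phi> K \<subseteq> \<phi> L"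
    and "\<And>K L. ideal K R \<Longrightarrow> ideal L R \<Longrightarrow> I \<subseteq> K \<Longrightarrow> K \<subseteq> L \<Longrightarrow> L \<subseteq> C \<Longrightarrow>
           \<phi> L \<subseteq> sat R P (\<phi> K) \<Longrightarrow> L \<subseteq> sat R P K"
  shows "climb R P (\<phi> I) (\<phi> J) n"
  using assms(1,2)
proof induction
  case refl show ?case by (rule climb.refl)
next
  case (weak J n K)
  have "I \<subseteq> K" "J \<subseteq> C" using climb_subset[OF weak(1)] weak(3,5) by auto
  then show ?case
    using climb.weak[OF weak(4) assms(4)[OF weak(2) _ weak(5)] assms(5)[OF weak(3)]] by blast
next
  case (strict J n K)
  have IJ: "I \<subseteq> J" "I \<subseteq> K" "J \<subseteq> C" using climb_subset[OF strict(1)] strict(3,6) by auto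
  have "\<not> \<phi> K \<subseteq> sat R P (\<phi> J)"
    using assms(6)[OF climb_ideal[OF strict(1) assms(3)] strict(2) IJ(1) strict(3,6)] strict(4) by blast
  then show ?case
    using climb.strict[OF strict(5)[OF IJ(3)] assms(4)[OF strict(2) IJ(2) strict(6)] assms(5)[OF strict(3)]] by blast
qed

end

context cring
begin

lemma adjoin_pow:
  assumes "ideal I R" "x \<in> carrier R" "w \<in> adjoin R I x"
  shows "w [^] (m::nat) \<in> adjoin R I (x [^] m)"
proof (induction m)
  case 0
  show ?case using adjoin_self[OF assms(1), of \<one>] by simp
next
  case (Suc m)
  obtain p u where p: "w = p \<oplus> u \<otimes> x" "p \<in> I" "u \<in> carrier R" using assms(3) unfolding adjoin_def by blast
  obtain p' u' where p': "w [^] m = p' \<oplus> u' \<otimes> x [^] m" "p' \<in> I" "u' \<in> carrier R"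
    using Suc unfolding adjoin_def by blast
  have c: "p \<in> carrier R" "p' \<in> carrier R" "x [^] m \<in> carrier R"
    using p p' ideal_subset[OF assms(1)] assms(2) by auto
  define y where "y = x [^] m"
  have y: "y \<in> carrier R" using c y_def by simp
  have "w [^] Suc m = (p' \<oplus> u' \<otimes> y) \<otimes> (p \<oplus> u \<otimes> x)" using p p' y_def by simp
  also have "\<dots> = ((p \<oplus> u \<otimes> x) \<otimes> p' \<oplus> (u' \<otimes> y) \<otimes> p) \<oplus> (u' \<otimes> u) \<otimes> (y \<otimes> x)"
    using p(3) p'(3) c y assms(2) by algebra
  also have "y \<otimes> x = x [^] Suc m" using y_def by simp
  finally have "w [^] Suc m = ((p \<oplus> u \<otimes> x) \<otimes> p' \<oplus> (u' \<otimes> y) \<otimes> p) \<oplus> (u' \<otimes> u) \<otimes> x [^] Suc m" .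
  moreover have "(p \<oplus> u \<otimes> x) \<otimes> p' \<oplus> (u' \<otimes> y) \<otimes> p \<in> I"
    using ideal_add[OF assms(1)] ideal.I_l_closed[OF assms(1) p'(2)] ideal.I_l_closed[OF assms(1) p(2)]
      p(3) p'(3) c y assms(2) by auto
  ultimately show ?case unfolding adjoin_def using p(3) p'(3) m_closed by blast
qed

lemma climb_zero:
  assumes "climb R P I J n" "J \<subseteq> sat R P I"
  shows "n = 0"
  using assms
proof induction
  case (strict J n K)
  have "sat R P I \<subseteq> sat R P J" using sat_mono climb_subset[OF strict(1)] by blast
  then show ?case using strict by blast
qed auto

text \<open>Here \<open>(I + Ry)\<^sub>P / I\<^sub>P\<close> is generated by one element killed by \<open>P\<close>, so it is zero or a
  one-dimensional vector space over the residue field of \<open>R\<^sub>P\<close>.\<close>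

lemma climb_simple:
  assumes "primeideal P R" "ideal I R" "y \<in> carrier R" "\<And>z. z \<in> P \<Longrightarrow> z \<otimes> y \<in> sat R P I"
    and "climb R P I J n" "J \<subseteq> adjoin R I y"
  shows "n = 0 \<or> n = 1 \<and> adjoin R I y \<subseteq> sat R P J"
  using assms(5,6)
proof induction
  case refl then show ?case by simp
next
  case (weak J n K)
  then show ?case using sat_mono[OF weak(3), of P] by auto
next
  case (strict J n K)
  have J: "ideal J R" using climb_ideal strict(1) assms(2) by blast
  have IJ: "I \<subseteq> J" using climb_subset[OF strict(1)] .
  have n: "n = 0" using strict by blast
  obtain k where k: "k \<in> K" "k \<notin> sat R P J" using strict(4) by blast
  obtain i t where it: "k = i \<oplus> t \<otimes> y" "i \<in> I" "t \<in> carrier R"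
    using k strict(6) unfolding adjoin_def by blast
  have "t \<notin> P"
  proof
    assume "t \<in> P"
    then have "t \<otimes> y \<in> sat R P J" using assms(4) sat_mono[OF IJ] by blast
    moreover have "i \<in> sat R P J" using sat_superset[OF assms(1) ideal_subset[OF J]] it IJ by blast
    ultimately have "k \<in> sat R P J" using ideal_add[OF ideal_sat[OF assms(1) J]] it by simp
    then show False using k by blast
  qed
  moreover have "t \<otimes> y \<in> K"
  proof (rule ideal_add_cancel[OF strict(2)])
    show "i \<in> K" "i \<oplus> t \<otimes> y \<in> K" using it IJ strict(3) k by auto
    show "t \<otimes> y \<in> carrier R" using it assms(3) by simp
  qed
  ultimately have "y \<in> sat R P K" unfolding sat_def using it(3) assms(3) by blast
  moreover have "I \<subseteq> sat R P K" using sat_superset[OF assms(1) ideal_subset[OF strict(2)]] IJ strict(3) by blast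
  ultimately show ?case using adjoin_least[OF ideal_sat[OF assms(1) strict(2)]] n by simp
qed

end

context noetherian_cring
begin

text \<open>If \<open>P\<^sub>P\<close> is nilpotent modulo \<open>I\<^sub>P\<close>, element by element, then \<open>R\<^sub>P/I\<^sub>P\<close> has finite length.
  An ideal \<open>M \<supseteq> I\<close> maximal among the counterexamples can be enlarged by a socle element \<open>y\<close>, which
  contributes at most one step, while chains above \<open>M + Ry\<close> are bounded.\<close>

lemma climb_bounded:
  assumes P: "primeideal P R"
    and nil: "\<And>z. z \<in> P \<Longrightarrow> \<exists>s\<in>carrier R - P. \<exists>k::nat. s \<otimes> z [^] k \<in> I"
    and I: "ideal I R"
  shows "\<exists>b. \<forall>n. climb R P I (carrier R) n \<longrightarrow> n \<le> b"
proof (rule ccontr)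
  define C where "C = {L. ideal L R \<and> I \<subseteq> L \<and> \<not> (\<exists>b. \<forall>n. climb R P L (carrier R) n \<longrightarrow> n \<le> b)}"
  assume "\<not> ?thesis"
  then have "I \<in> C" using I by (simp add: C_def)
  then have "C \<noteq> {}" by blast
  then obtain M where M: "M \<in> C" and max: "\<And>L. L \<in> C \<Longrightarrow> M \<subseteq> L \<Longrightarrow> L = M"
    by (rule exists_maximal) (auto simp: C_def)
  have Mid: "ideal M R" and IM: "I \<subseteq> M" and bad: "\<not> (\<exists>b. \<forall>n. climb R P M (carrier R) n \<longrightarrow> n \<le> b)"
    using M by (auto simp: C_def)
  note satM = ideal_sat[OF P Mid]
  have "sat R P M \<noteq> carrier R"
    using bad climb_zero[of P M "carrier R"] by (metis order_refl)
  moreover have "\<exists>k::nat. z [^] k \<in> sat R P M" if z: "z \<in> P" for z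
  proof -
    obtain s and k :: nat where "s \<in> carrier R - P" "s \<otimes> z [^] k \<in> I" using nil[OF z] by blast
    moreover have "z \<in> carrier R" using z ideal_subset[OF primeideal.axioms(1)[OF P]] by blast
    ultimately show ?thesis unfolding sat_def using IM by blast
  qed
  moreover have "z \<in> carrier R" if "z \<in> P" for z
    using that ideal_subset[OF primeideal.axioms(1)[OF P]] by blast
  ultimately obtain y where y: "y \<in> carrier R" "y \<notin> sat R P M" "\<And>z. z \<in> P \<Longrightarrow> z \<otimes> y \<in> sat R P M"
    using exists_socle_step[OF satM, of P] by blast
  define L where "L = adjoin R M y"
  have L: "ideal L R" "M \<subseteq> L" "y \<in> L" "L \<subseteq> carrier R"
    using ideal_adjoin[OF Mid y(1)] adjoin_superset[OF Mid y(1)] adjoin_self[OF Mid y(1)] ideal_subset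
    unfolding L_def by blast+
  have "L \<noteq> M" using y(2) L(3) sat_superset[OF P ideal_subset[OF Mid]] by blast
  then have "L \<notin> C" using max L(2) by blast
  then obtain b where b: "\<And>n. climb R P L (carrier R) n \<Longrightarrow> n \<le> b" using L IM by (auto simp: C_def)
  have "n \<le> 1 + b" if "climb R P M (carrier R) n" for n
  proof -
    obtain a a' where a: "climb R P M L a" "climb R P L (carrier R) a'" "n \<le> a + a'"
      using climb_split_between[OF P \<open>climb R P M (carrier R) n\<close> Mid L(1,2,4)] by blast
    have "a \<le> 1" using climb_simple[OF P Mid y(1,3) a(1)] by (auto simp: L_def)
    then show ?thesis using a(3) b[OF a(2)] by simp
  qed
  then show False using bad by blast
qed

section \<open>Krull's height theorem\<close>

text \<open>The primes of \<open>R\<^sub>P[1/z]\<close> correspond to the primes of \<open>R\<close> inside \<open>P\<close> that do not contain \<open>z\<close>; the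
  hypothesis says that \<open>I\<close> generates a proper ideal in this ring.\<close>

lemma exists_prime_below:
  assumes "primeideal P R" "ideal I R" "z \<in> P" "\<And>s k. s \<in> carrier R - P \<Longrightarrow> s \<otimes> z [^] (k::nat) \<notin> I"
  obtains P' where "primeideal P' R" "I \<subseteq> P'" "P' \<subset> P" "z \<notin> P'"
proof -
  define S where "S = {s \<otimes> z [^] k | s (k::nat). s \<in> carrier R - P}"
  have z: "z \<in> carrier R" using assms(3) ideal_subset[OF primeideal.axioms(1)[OF assms(1)]] by blast
  have memS: "s \<otimes> z [^] k \<in> S" if "s \<in> carrier R - P" for s and k :: nat
    using that S_def by blast
  have inS: "s \<in> S" if "s \<in> carrier R - P" for s
    using memS[OF that, of 0] that by simp
  have "S \<subseteq> carrier R" using z by (auto simp: S_def)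
  moreover have "\<one> \<in> S" using inS[OF prime_one_notin[OF assms(1)]] .
  moreover have "s \<otimes> t \<in> S" if st: "s \<in> S" "t \<in> S" for s t
  proof -
    obtain a b and j k :: nat where e: "s = a \<otimes> z [^] j" "t = b \<otimes> z [^] k" "a \<in> carrier R - P" "b \<in> carrier R - P"
      using st unfolding S_def by blast
    have c: "a \<in> carrier R" "b \<in> carrier R" "z [^] j \<in> carrier R" "z [^] k \<in> carrier R" using e z by auto
    have "s \<otimes> t = (a \<otimes> b) \<otimes> (z [^] j \<otimes> z [^] k)" unfolding e using c by algebra
    also have "\<dots> = (a \<otimes> b) \<otimes> z [^] (j + k)" using z by (simp add: nat_pow_mult)
    finally show ?thesis using memS[OF prime_mult_notin[OF assms(1) e(3,4)]] by simp
  qed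
  moreover have "I \<inter> S = {}" using assms(4) by (auto simp: S_def)
  ultimately obtain P' where P': "primeideal P' R" "I \<subseteq> P'" "P' \<inter> S = {}"
    using exists_prime_avoiding[OF assms(2), of S] by blast
  have "P' \<subseteq> P" using P'(3) inS ideal_subset[OF primeideal.axioms(1)[OF P'(1)]] by blast
  moreover have "z \<notin> P'" using memS[OF prime_one_notin[OF assms(1)], of 1] z P'(3) by auto
  ultimately show thesis using that[OF P'(1,2)] assms(3) by blast
qed

text \<open>Krull's principal ideal theorem in the form that \<open>P\<close> is not minimal over \<open>Q + Rx\<close> as soon as a
  prime lies strictly between \<open>Q\<close> and \<open>P\<close>.  The proof is Kaplansky's.  Compute in the domain \<open>R/Q\<close>
  localised at \<open>P\<close>, and suppose that \<open>P\<close> is minimal over \<open>x\<close>.  Take \<open>y \<noteq> 0\<close> in the intermediate prime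
  \<open>P'\<close>, and a power \<open>u\<close> of \<open>x\<close> so high that \<open>tu\<^sup>2 \<in> (y)\<close> implies \<open>tu \<in> (y)\<close>.  In the two chains
  \<open>(u\<^sup>2) \<subseteq> (u) \<subseteq> (u, y)\<close> and \<open>(u\<^sup>2) \<subseteq> (u\<^sup>2, uy) \<subseteq> (u\<^sup>2, y) \<subseteq> (u, y)\<close> the quotient \<open>(u\<^sup>2, uy)/(u\<^sup>2)\<close> is
  isomorphic to \<open>(u, y)/(u)\<close> and \<open>(u\<^sup>2, y)/(u\<^sup>2, uy)\<close> to \<open>(u)/(u\<^sup>2)\<close>.  Since all lengths are finite,
  \<open>(u, y) = (u\<^sup>2, y)\<close>, hence \<open>u(1 - au) \<in> (y) \<subseteq> P'\<close> for some \<open>a\<close>; this puts \<open>u\<close>, and with it \<open>x\<close>, into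
  \<open>P'\<close>, which contradicts the minimality of \<open>P\<close>.\<close>

theorem krull_principal_ideal:
  assumes Q: "primeideal Q R" and P': "primeideal P' R" and P: "primeideal P R"
    and "Q \<subset> P'" "P' \<subset> P" "x \<in> P"
  obtains P'' where "primeideal P'' R" "Q \<subseteq> P''" "x \<in> P''" "P'' \<subset> P"
proof (rule ccontr)
  assume neg: "\<not> thesis"
  note witness = that
  note Qid = primeideal.axioms(1)[OF Q] and Pid = primeideal.axioms(1)[OF P] and P'id = primeideal.axioms(1)[OF P']
  note Qc = ideal_subset[OF Qid]
  have x: "x \<in> carrier R" using assms(6) ideal_subset[OF Pid] by blast
  have xP': "x \<notin> P'" using neg that[OF P' _ _ assms(5)] assms(4) by blast
  obtain y where y: "y \<in> P'" "y \<notin> Q" using assms(4) by blast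
  have yc: "y \<in> carrier R" using y ideal_subset[OF P'id] by blast
  define Y where "Y = adjoin R Q y"
  have Y: "ideal Y R" "Q \<subseteq> Y" "y \<in> Y"
    using ideal_adjoin[OF Qid yc] adjoin_superset[OF Qid yc] adjoin_self[OF Qid yc] unfolding Y_def by auto
  (* The colon ideals (Y : x^k) increase and become stationary; u is the first power of x beyond
     that point. *)
  define col where "col k = {t \<in> carrier R. t \<otimes> x [^] k \<in> Y}" for k :: nat
  have col_id: "ideal (col k) R" for k
    unfolding col_def by (rule ideal_colon[OF Y(1)]) (use x in simp)
  have col_Suc: "col k \<subseteq> col (Suc k)" for k
  proof
    fix t assume t: "t \<in> col k"
    have "t \<otimes> x [^] Suc k = x \<otimes> (t \<otimes> x [^] k)" using t x by (simp add: col_def m_comm m_lcomm)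
    then show "t \<in> col (Suc k)" using t x ideal.I_l_closed[OF Y(1), of "t \<otimes> x [^] k" x] by (simp add: col_def)
  qed
  then have col_mono: "j \<le> k \<Longrightarrow> col j \<subseteq> col k" for j k
    using lift_Suc_mono_le[of col] by blast
  have "range col \<noteq> {}" by blast
  then obtain M where M: "M \<in> range col" "\<And>L. L \<in> range col \<Longrightarrow> M \<subseteq> L \<Longrightarrow> L = M"
    by (rule exists_maximal) (use col_id in auto)
  from M(1) obtain k where Mk: "M = col k" by blast
  have k: "col j = col k" if "col k \<subseteq> col j" for j
    using M(2)[of "col j"] that by (simp add: Mk)
  define u where "u = x [^] Suc k"
  have u: "u \<in> carrier R" using x by (simp add: u_def)
  have stab: "t \<otimes> u \<in> Y" if t: "t \<in> carrier R" "t \<otimes> (u \<otimes> u) \<in> Y" for t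
  proof -
    have "u \<otimes> u = x [^] (Suc k + Suc k)" unfolding u_def using x by (rule nat_pow_mult)
    then have "t \<in> col (Suc k + Suc k)" using t by (simp add: col_def)
    also have "col (Suc k + Suc k) = col (Suc k)" using k[of "Suc k + Suc k"] k[of "Suc k"] col_mono by simp
    finally show ?thesis by (simp add: col_def u_def)
  qed
  have uP: "u \<in> P" unfolding u_def using assms(6) x ideal.I_l_closed[OF Pid] by simp
  have uP': "u \<notin> P'" unfolding u_def using prime_pow[OF P' x] xP' by blast
  have uQ: "u \<notin> Q" using uP' assms(4) by blast
  (* The ideals (u^2), (u), (u, y), (u^2, y) and (u^2, uy), each enlarged by Q. *)
  define U2 where "U2 = adjoin R Q (u \<otimes> u)"
  define U where "U = adjoin R Q u"
  define UY where "UY = adjoin R U y"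
  define U2Y where "U2Y = adjoin R U2 y"
  define V where "V = adjoin R U2 (u \<otimes> y)"
  have uu: "u \<otimes> u \<in> carrier R" and uy: "u \<otimes> y \<in> carrier R" using u yc by auto
  have U2: "ideal U2 R" "Q \<subseteq> U2" "u \<otimes> u \<in> U2" "U2 \<subseteq> carrier R"
    unfolding U2_def using ideal_adjoin[OF Qid uu] adjoin_superset[OF Qid uu] adjoin_self[OF Qid uu] ideal_subset by blast+
  have U: "ideal U R" "Q \<subseteq> U" "u \<in> U"
    unfolding U_def using ideal_adjoin[OF Qid u] adjoin_superset[OF Qid u] adjoin_self[OF Qid u] by blast+
  have UY: "ideal UY R" "U \<subseteq> UY" "y \<in> UY" "UY \<subseteq> carrier R"
    unfolding UY_def using ideal_adjoin[OF U(1) yc] adjoin_superset[OF U(1) yc] adjoin_self[OF U(1) yc] ideal_subset by blast+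
  have U2Y: "ideal U2Y R" "U2 \<subseteq> U2Y" "y \<in> U2Y"
    unfolding U2Y_def using ideal_adjoin[OF U2(1) yc] adjoin_superset[OF U2(1) yc] adjoin_self[OF U2(1) yc] by blast+
  have V: "ideal V R" "U2 \<subseteq> V" "u \<otimes> y \<in> V"
    unfolding V_def using ideal_adjoin[OF U2(1) uy] adjoin_superset[OF U2(1) uy] adjoin_self[OF U2(1) uy] by blast+
  have U2U: "U2 \<subseteq> U" unfolding U2_def using adjoin_least[OF U(1,2)] ideal.I_l_closed[OF U(1,3) u] by blast
  have U2YUY: "U2Y \<subseteq> UY" unfolding U2Y_def using adjoin_least[OF UY(1) _ UY(3)] U2U UY(2) by blast
  have VU2Y: "V \<subseteq> U2Y" unfolding V_def using adjoin_least[OF U2Y(1,2)] ideal.I_l_closed[OF U2Y(1,3) u] by blast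
  have nil: "\<exists>s\<in>carrier R - P. \<exists>j::nat. s \<otimes> z [^] j \<in> U2" if z: "z \<in> P" for z
  proof -
    have zc: "z \<in> carrier R" using z ideal_subset[OF Pid] by blast
    note Xid = ideal_adjoin[OF Qid x]
    have "\<exists>s\<in>carrier R - P. \<exists>j::nat. s \<otimes> z [^] j \<in> adjoin R Q x"
    proof (rule ccontr)
      assume "\<not> ?thesis"
      then obtain P'' where "primeideal P'' R" "adjoin R Q x \<subseteq> P''" "P'' \<subset> P"
        using exists_prime_below[OF P Xid z] by blast
      then show False
        using neg witness[of P''] adjoin_superset[OF Qid x] adjoin_self[OF Qid x] by blast
    qed
    then obtain s and j :: nat where s: "s \<in> carrier R - P" "s \<otimes> z [^] j \<in> adjoin R Q x" by blast
    define m where "m = Suc k + Suc k"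
    have "(s \<otimes> z [^] j) [^] m \<in> adjoin R Q (x [^] m)" using adjoin_pow[OF Qid x s(2)] .
    also have "x [^] m = u \<otimes> u" unfolding u_def m_def using x by (simp only: nat_pow_mult)
    also have "(s \<otimes> z [^] j) [^] m = s [^] m \<otimes> z [^] (j * m)"
      using s zc by (simp add: nat_pow_distrib nat_pow_pow)
    finally have "s [^] m \<otimes> z [^] (j * m) \<in> U2" by (simp add: U2_def)
    moreover have "s [^] m \<in> carrier R - P" using s prime_pow[OF P, of s m] by auto
    ultimately show ?thesis by blast
  qed
  obtain b where b: "\<And>n. climb R P U2 (carrier R) n \<Longrightarrow> n \<le> b"
    using climb_bounded[OF P nil U2(1)] by blast
  have bUY: "n \<le> b" if "climb R P U2 UY n" for n
    using b[OF climb.weak[OF that oneideal UY(4)]] .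
  (* The length of (u, y)/(u^2), which is split at (u) into a and a'. *)
  define n where "n = (GREATEST n. climb R P U2 UY n)"
  have ex: "climb R P U2 UY 0" using climb.weak[OF climb.refl UY(1)] U2U UY(2) by blast
  have n: "climb R P U2 UY n" unfolding n_def using GreatestI_nat[of "climb R P U2 UY", OF ex bUY] .
  have nmax: "m \<le> n" if "climb R P U2 UY m" for m
    unfolding n_def using Greatest_le_nat[of "climb R P U2 UY", OF that bUY] .
  obtain a a' where a: "climb R P U2 U a" "climb R P U UY a'" "n \<le> a + a'"
    using climb_split_between[OF P n U2(1) U(1) U2U UY(2)] by blast

  (* Multiplication by u takes a chain from (u) to (u, y) to one from (u^2) to (u^2, uy). *)
  define \<phi> where "\<phi> N = {u \<otimes> z \<oplus> q | z q. z \<in> N \<and> q \<in> Q}" for N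
  have \<phi>_id: "ideal (\<phi> N) R" if "ideal N R" for N
    unfolding \<phi>_def by (rule ideal_mult_add[OF that Qid u])
  have \<phi>_climb: "climb R P (\<phi> U) (\<phi> UY) a'"
  proof (rule climb_map[OF a(2) order_refl U(1)])
    show "ideal (\<phi> K) R" if "ideal K R" for K using \<phi>_id[OF that] .
    show "\<phi> K \<subseteq> \<phi> L" if "K \<subseteq> L" for K L using that by (auto simp: \<phi>_def)
    fix K L assume K: "ideal K R" "ideal L R" "U \<subseteq> K" "\<phi> L \<subseteq> sat R P (\<phi> K)"
    show "L \<subseteq> sat R P K"
    proof
      fix z assume z: "z \<in> L"
      then have zc: "z \<in> carrier R" using ideal_subset[OF K(2)] by blast
      have "u \<otimes> z = u \<otimes> z \<oplus> \<zero>" using u zc by simp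
      then have "u \<otimes> z \<in> \<phi> L" unfolding \<phi>_def using z ideal_zero[OF Qid] by blast
      then obtain s where s: "s \<in> carrier R - P" "s \<otimes> (u \<otimes> z) \<in> \<phi> K" using K(4) unfolding sat_def by blast
      then obtain w q where w: "s \<otimes> (u \<otimes> z) = u \<otimes> w \<oplus> q" "w \<in> K" "q \<in> Q" unfolding \<phi>_def by blast
      have c: "s \<in> carrier R" "w \<in> carrier R" "q \<in> carrier R"
        using s w ideal_subset[OF K(1)] Qc by auto
      have "u \<otimes> (s \<otimes> z \<ominus> w) = s \<otimes> (u \<otimes> z) \<ominus> u \<otimes> w" using c u zc by algebra
      also have "\<dots> = q" unfolding w(1) using c u by algebra
      finally have "u \<otimes> (s \<otimes> z \<ominus> w) \<in> Q" using w by simp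
      moreover have "s \<otimes> z \<ominus> w \<in> carrier R" using c zc by simp
      ultimately have "s \<otimes> z \<ominus> w \<in> Q" using primeideal.I_prime[OF Q u] uQ by blast
      then have "s \<otimes> z \<ominus> w \<in> K" using U(2) K(3) by blast
      then have "w \<oplus> (s \<otimes> z \<ominus> w) \<in> K" using ideal_add[OF K(1) w(2)] by blast
      moreover have "w \<oplus> (s \<otimes> z \<ominus> w) = s \<otimes> z" using c zc by algebra
      ultimately have "s \<otimes> z \<in> K" by simp
      then show "z \<in> sat R P K" unfolding sat_def using s zc by blast
    qed
  qed
  have "U2 \<subseteq> \<phi> U"
    unfolding U2_def
  proof (rule adjoin_least[OF \<phi>_id[OF U(1)]])
    show "Q \<subseteq> \<phi> U"
    proof
      fix q assume q: "q \<in> Q"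
      then have "q = u \<otimes> \<zero> \<oplus> q" using Qc u by auto
      then show "q \<in> \<phi> U" unfolding \<phi>_def using q ideal_zero[OF U(1)] by blast
    qed
    have "u \<otimes> u = u \<otimes> u \<oplus> \<zero>" using uu by simp
    then show "u \<otimes> u \<in> \<phi> U" unfolding \<phi>_def using U(3) ideal_zero[OF Qid] by blast
  qed
  moreover have "\<phi> UY \<subseteq> V"
  proof
    fix d assume "d \<in> \<phi> UY"
    then obtain z q where d: "d = u \<otimes> z \<oplus> q" "z \<in> UY" "q \<in> Q" unfolding \<phi>_def by blast
    then obtain v r where v: "z = v \<oplus> r \<otimes> y" "v \<in> U" "r \<in> carrier R" unfolding UY_def adjoin_def by blast
    then obtain q' r' where q': "v = q' \<oplus> r' \<otimes> u" "q' \<in> Q" "r' \<in> carrier R" unfolding U_def adjoin_def by blast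
    have c: "q \<in> carrier R" "q' \<in> carrier R" using d q' Qc by auto
    have "d = (u \<otimes> q' \<oplus> q) \<oplus> (r' \<otimes> (u \<otimes> u) \<oplus> r \<otimes> (u \<otimes> y))"
      unfolding d v q' using c v(3) q'(3) u yc by algebra
    moreover have "u \<otimes> q' \<oplus> q \<in> V"
      using ideal_add[OF Qid ideal.I_l_closed[OF Qid q'(2) u] d(3)] U2(2) V(2) by blast
    moreover have "r' \<otimes> (u \<otimes> u) \<oplus> r \<otimes> (u \<otimes> y) \<in> V"
      using ideal_add[OF V(1)] ideal.I_l_closed[OF V(1) _ q'(3)] ideal.I_l_closed[OF V(1,3) v(3)] U2(3) V(2) by blast
    ultimately show "d \<in> V" using ideal_add[OF V(1)] by simp
  qed
  ultimately have "climb R P U2 V (0 + a')"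
    using climb.weak[OF climb_trans[OF \<phi>_climb climb.weak[OF climb.refl \<phi>_id[OF U(1)]]] V(1)] by blast

  (* The map zu \<mapsto> zy takes a chain from (u^2) to (u) to one from (u^2, uy) to (u^2, y).  It
     is well defined on ideals only after adding V; injectivity uses that Q is prime and the choice
     of u. *)
  define \<psi> where "\<psi> N = {y \<otimes> z \<oplus> v | z v. z \<in> carrier R \<and> u \<otimes> z \<in> N \<and> v \<in> V}" for N
  have \<psi>_id: "ideal (\<psi> N) R" if N: "ideal N R" for N
  proof -
    have "z \<in> carrier R \<and> u \<otimes> z \<in> N \<and> v \<in> V \<longleftrightarrow> z \<in> {t \<in> carrier R. t \<otimes> u \<in> N} \<and> v \<in> V" for z v
      using m_comm[OF u, of z] by auto
    then show ?thesis unfolding \<psi>_def using ideal_mult_add[OF ideal_colon[OF N u] V(1) yc] by simp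
  qed
  have \<psi>_climb: "climb R P (\<psi> U2) (\<psi> U) a"
  proof (rule climb_map[OF a(1) order_refl U2(1)])
    show "ideal (\<psi> K) R" if "ideal K R" for K using \<psi>_id[OF that] .
    show "\<psi> K \<subseteq> \<psi> L" if "K \<subseteq> L" for K L using that by (auto simp: \<psi>_def)
    fix K L assume K: "ideal K R" "ideal L R" "U2 \<subseteq> K" "L \<subseteq> U" "\<psi> L \<subseteq> sat R P (\<psi> K)" "K \<subseteq> L"
    show "L \<subseteq> sat R P K"
    proof
      fix l assume l: "l \<in> L"
      then obtain q\<^sub>0 z where z: "l = q\<^sub>0 \<oplus> z \<otimes> u" "q\<^sub>0 \<in> Q" "z \<in> carrier R"
        using K(4) unfolding U_def adjoin_def by blast
      have q\<^sub>0: "q\<^sub>0 \<in> carrier R" "q\<^sub>0 \<in> K" using z Qc U2(2) K(3) by auto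
      have "q\<^sub>0 \<in> L" "q\<^sub>0 \<oplus> u \<otimes> z \<in> L" using q\<^sub>0 K(6) l z u by (auto simp: m_comm)
      then have "u \<otimes> z \<in> L" by (rule ideal_add_cancel[OF K(2)]) (use u z in simp)
      moreover have "y \<otimes> z = y \<otimes> z \<oplus> \<zero>" using yc z by simp
      ultimately have "y \<otimes> z \<in> \<psi> L" unfolding \<psi>_def using z(3) ideal_zero[OF V(1)] by blast
      then obtain s where s: "s \<in> carrier R - P" "s \<otimes> (y \<otimes> z) \<in> \<psi> K" using K(5) unfolding sat_def by blast
      then obtain w v where w: "s \<otimes> (y \<otimes> z) = y \<otimes> w \<oplus> v" "w \<in> carrier R" "u \<otimes> w \<in> K" "v \<in> V"
        unfolding \<psi>_def by blast
      obtain v\<^sub>2 \<beta> where v\<^sub>2: "v = v\<^sub>2 \<oplus> \<beta> \<otimes> (u \<otimes> y)" "v\<^sub>2 \<in> U2" "\<beta> \<in> carrier R"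
        using w(4) unfolding V_def adjoin_def by blast
      obtain q \<alpha> where q: "v\<^sub>2 = q \<oplus> \<alpha> \<otimes> (u \<otimes> u)" "q \<in> Q" "\<alpha> \<in> carrier R"
        using v\<^sub>2(2) unfolding U2_def adjoin_def by blast
      have c: "s \<in> carrier R" "q \<in> carrier R" using s q Qc by auto
      define g where "g = s \<otimes> z \<ominus> w \<ominus> \<beta> \<otimes> u"
      have g: "g \<in> carrier R" using c w(2) v\<^sub>2(3) z(3) u by (simp add: g_def)
      have "y \<otimes> g = s \<otimes> (y \<otimes> z) \<ominus> y \<otimes> w \<ominus> \<beta> \<otimes> (u \<otimes> y)"
        unfolding g_def using c w(2) v\<^sub>2(3) z(3) u yc by algebra
      also have "\<dots> = q \<oplus> \<alpha> \<otimes> (u \<otimes> u)"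
        unfolding w(1) v\<^sub>2(1) q(1) using c q(3) w(2) v\<^sub>2(3) z(3) u yc by algebra
      finally have yg: "y \<otimes> g = q \<oplus> \<alpha> \<otimes> (u \<otimes> u)" .
      have "q \<oplus> \<alpha> \<otimes> (u \<otimes> u) \<in> Y" unfolding yg[symmetric] using ideal.I_r_closed[OF Y(1,3) g] .
      then have "\<alpha> \<otimes> (u \<otimes> u) \<in> Y"
        by (rule ideal_add_cancel[OF Y(1) subsetD[OF Y(2) q(2)]]) (use q(3) u in simp)
      then have "\<alpha> \<otimes> u \<in> Y" using stab q by blast
      then obtain q' \<gamma> where q': "\<alpha> \<otimes> u = q' \<oplus> \<gamma> \<otimes> y" "q' \<in> Q" "\<gamma> \<in> carrier R" unfolding Y_def adjoin_def by blast
      have q'c: "q' \<in> carrier R" using q' Qc by auto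
      define e where "e = g \<ominus> \<gamma> \<otimes> u"
      have e: "e \<in> carrier R" using g q'(3) u by (simp add: e_def)
      have "y \<otimes> e = y \<otimes> g \<ominus> (\<gamma> \<otimes> y) \<otimes> u" unfolding e_def using g q'(3) u yc by algebra
      also have "\<dots> = q \<oplus> (\<alpha> \<otimes> u) \<otimes> u \<ominus> (\<gamma> \<otimes> y) \<otimes> u" unfolding yg using q(3) u by (simp add: m_assoc)
      also have "\<dots> = q \<oplus> u \<otimes> q'" unfolding q'(1) using c q'(3) q'c yc u by algebra
      finally have "y \<otimes> e \<in> Q" using ideal_add[OF Qid q(2) ideal.I_l_closed[OF Qid q'(2) u]] by simp
      then have eQ: "e \<in> Q" using primeideal.I_prime[OF Q yc e] y(2) by blast
      have "u \<otimes> (s \<otimes> z) = (u \<otimes> w \<oplus> (\<beta> \<oplus> \<gamma>) \<otimes> (u \<otimes> u)) \<oplus> u \<otimes> e"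
        unfolding e_def g_def using c w(2) v\<^sub>2(3) q'(3) z(3) u by algebra
      also have "\<dots> \<in> K"
      proof -
        have "(\<beta> \<oplus> \<gamma>) \<otimes> (u \<otimes> u) \<in> K"
          using ideal.I_l_closed[OF K(1)] U2(3) K(3) v\<^sub>2(3) q'(3) by blast
        moreover have "u \<otimes> e \<in> K" using ideal.I_l_closed[OF Qid eQ u] U2(2) K(3) by blast
        ultimately show ?thesis using ideal_add[OF K(1)] w(3) by blast
      qed
      finally have "s \<otimes> q\<^sub>0 \<oplus> u \<otimes> (s \<otimes> z) \<in> K" using ideal_add[OF K(1)] ideal.I_l_closed[OF K(1) q\<^sub>0(2) c(1)] by blast
      also have "s \<otimes> q\<^sub>0 \<oplus> u \<otimes> (s \<otimes> z) = s \<otimes> l" unfolding z(1) using c q\<^sub>0(1) z(3) u by algebra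
      finally show "l \<in> sat R P K" using satI[OF s(1)] l ideal_subset[OF K(2)] by blast
    qed
  qed
  have "V \<subseteq> \<psi> U2"
  proof
    fix v assume v: "v \<in> V"
    then have "v = y \<otimes> \<zero> \<oplus> v" "u \<otimes> \<zero> = \<zero>" using ideal_subset[OF V(1)] yc u by auto
    moreover from this have "u \<otimes> \<zero> \<in> U2" using ideal_zero[OF U2(1)] by simp
    ultimately show "v \<in> \<psi> U2" unfolding \<psi>_def using v zero_closed by blast
  qed
  moreover have "\<psi> U \<subseteq> U2Y"
    unfolding \<psi>_def using ideal_add[OF U2Y(1) ideal.I_r_closed[OF U2Y(1,3)]] VU2Y by blast
  ultimately have "climb R P V U2Y (0 + a)"
    using climb.weak[OF climb_trans[OF \<psi>_climb climb.weak[OF climb.refl \<psi>_id[OF U2(1)]]] U2Y(1)] by blast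
  then have c2: "climb R P U2 U2Y (a' + a)"
    using climb_trans[of R P V U2Y a U2 a'] \<open>climb R P U2 V (0 + a')\<close> by simp
  (* A further strict step would exceed the length n \<le> a + a' of (u, y)/(u^2). *)
  have "UY \<subseteq> sat R P U2Y"
    using nmax[OF climb.strict[OF c2 UY(1) U2YUY]] a(3) by linarith
  then obtain s where s: "s \<in> carrier R - P" "s \<otimes> u \<in> U2Y" using U(3) UY(2) unfolding sat_def by blast
  then obtain v\<^sub>2 \<beta> where v\<^sub>2: "s \<otimes> u = v\<^sub>2 \<oplus> \<beta> \<otimes> y" "v\<^sub>2 \<in> U2" "\<beta> \<in> carrier R"
    unfolding U2Y_def adjoin_def by blast
  obtain q \<alpha> where q: "v\<^sub>2 = q \<oplus> \<alpha> \<otimes> (u \<otimes> u)" "q \<in> Q" "\<alpha> \<in> carrier R"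
    using v\<^sub>2(2) unfolding U2_def adjoin_def by blast
  have c: "s \<in> carrier R" "q \<in> carrier R" using s q Qc by auto
  have "u \<otimes> (s \<ominus> \<alpha> \<otimes> u) = s \<otimes> u \<ominus> \<alpha> \<otimes> (u \<otimes> u)" using c u q(3) by algebra
  also have "\<dots> = q \<oplus> \<beta> \<otimes> y" unfolding v\<^sub>2(1) q(1) using c v\<^sub>2(3) q(3) u yc by algebra
  also have "\<dots> \<in> P'"
    using ideal_add[OF P'id] q(2) assms(4) ideal.I_l_closed[OF P'id y(1) v\<^sub>2(3)] by blast
  finally have "u \<otimes> (s \<ominus> \<alpha> \<otimes> u) \<in> P'" .
  moreover have "s \<ominus> \<alpha> \<otimes> u \<in> carrier R" using c q(3) u by simp
  ultimately have "s \<ominus> \<alpha> \<otimes> u \<in> P'" using primeideal.I_prime[OF P' u] uP' by blast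
  then have "\<alpha> \<otimes> u \<oplus> (s \<ominus> \<alpha> \<otimes> u) \<in> P"
    using ideal_add[OF Pid] ideal.I_l_closed[OF Pid uP q(3)] assms(5) by blast
  moreover have "\<alpha> \<otimes> u \<oplus> (s \<ominus> \<alpha> \<otimes> u) = s" using c q(3) u by algebra
  ultimately show False using s by simp
qed

text \<open>Krull's height theorem, by induction on the number of generators.  Let \<open>P\<close> be the top of the chain
  and \<open>M\<close> a prime directly below \<open>P\<close>.  Some \<open>y \<in> Y\<close> is not in \<open>M\<close>, and \<open>P\<close> is minimal over
  \<open>M + Ry\<close>; so, after localising at \<open>P\<close>, a power of each \<open>w \<in> Y\<close> is congruent modulo \<open>y\<close> to an
  element \<open>z w\<close> of \<open>M\<close>.  By the principal ideal theorem \<open>M\<close> is minimal over the fewer elements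
  \<open>z w\<close>.\<close>

theorem height_le_card:
  assumes "finite Y" "Y \<subseteq> carrier R"
    and "\<And>i. i \<le> e \<Longrightarrow> primeideal (C i) R" "\<And>i. i < e \<Longrightarrow> C i \<subset> C (Suc i)"
    and "Y \<subseteq> C e" "\<And>P. primeideal P R \<Longrightarrow> Y \<subseteq> P \<Longrightarrow> P \<subseteq> C e \<Longrightarrow> P = C e"
  shows "e \<le> card Y"
  using assms
proof (induction "card Y" arbitrary: Y e C rule: less_induct)
  case less
  note prime = less.prems(3) and chain = less.prems(4) and YC = less.prems(5) and minimal = less.prems(6)
  show ?case
  proof (cases e)
    case 0 then show ?thesis by simp
  next
    case (Suc d)
    define P where "P = C e"
    have P: "primeideal P R" using prime[of e] by (simp add: P_def)
    note Pid = primeideal.axioms(1)[OF P]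
    (* M is chosen maximal in D, so no prime lies strictly between M and P. *)
    define D where "D = {M. primeideal M R \<and> C d \<subseteq> M \<and> M \<subset> P}"
    have "C d \<in> D" using prime[of d] chain[of d] Suc by (simp add: D_def P_def)
    moreover have "ideal L R" if "L \<in> D" for L using that primeideal.axioms(1) by (auto simp: D_def)
    moreover from calculation(1) have "D \<noteq> {}" by blast
    ultimately obtain M where M: "M \<in> D" and max: "\<And>L. L \<in> D \<Longrightarrow> M \<subseteq> L \<Longrightarrow> L = M"
      using exists_maximal[of D] by metis
    have Mp: "primeideal M R" "C d \<subseteq> M" "M \<subset> P" using M by (auto simp: D_def)
    note Mid = primeideal.axioms(1)[OF Mp(1)]
    have "\<not> Y \<subseteq> M" using minimal[OF Mp(1)] Mp(3) by (auto simp: P_def)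
    then obtain y where y: "y \<in> Y" "y \<notin> M" by blast
    have yc: "y \<in> carrier R" using y less.prems(2) by blast
    note Aid = ideal_adjoin[OF Mid yc]
    have "\<exists>s z. s \<in> carrier R - P \<and> (\<exists>k::nat. \<exists>r\<in>carrier R. s \<otimes> w [^] k = z \<oplus> r \<otimes> y) \<and> z \<in> M" if w: "w \<in> Y" for w
    proof -
      have wP: "w \<in> P" using w YC by (auto simp: P_def)
      have "\<exists>s\<in>carrier R - P. \<exists>k::nat. s \<otimes> w [^] k \<in> adjoin R M y"
      proof (rule ccontr)
        assume "\<not> ?thesis"
        then obtain P' where P': "primeideal P' R" "adjoin R M y \<subseteq> P'" "P' \<subset> P"
          using exists_prime_below[OF P Aid wP] by blast
        have "M \<subseteq> P'" "y \<in> P'" using P'(2) adjoin_superset[OF Mid yc] adjoin_self[OF Mid yc] by auto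
        then show False using max[of P'] P' Mp(2) y(2) by (auto simp: D_def)
      qed
      then show ?thesis unfolding adjoin_def by blast
    qed
    then obtain s z where sz: "\<And>w. w \<in> Y \<Longrightarrow> s w \<in> carrier R - P \<and> (\<exists>k::nat. \<exists>r\<in>carrier R. s w \<otimes> w [^] k = z w \<oplus> r \<otimes> y) \<and> z w \<in> M"
      by metis
    define Z where "Z = z ` (Y - {y})"
    have cardZ: "card Z \<le> card Y - 1"
      unfolding Z_def using card_image_le[of "Y - {y}" z] less.prems(1) y(1) by simp
    have cardY: "card Y > 0" using y(1) less.prems(1) card_gt_0_iff by blast
    (* The chain for the induction hypothesis: the top is dropped and C d is enlarged to M. *)
    define C' where "C' = C(d := M)"
    have "d \<le> card Z"
    proof (rule less.hyps[of Z d C'])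
      show "card Z < card Y" using cardZ cardY by simp
      show "finite Z" using less.prems(1) by (simp add: Z_def)
      show "Z \<subseteq> C' d" using sz by (auto simp: Z_def C'_def)
      then show "Z \<subseteq> carrier R" using ideal_subset[OF Mid] by (auto simp: C'_def)
      show "primeideal (C' i) R" if "i \<le> d" for i using that prime[of i] Mp(1) Suc by (auto simp: C'_def)
      show "C' i \<subset> C' (Suc i)" if "i < d" for i
        using that chain[of i] Mp(2) Suc by (cases "Suc i = d") (auto simp: C'_def)
      fix L assume L: "primeideal L R" "Z \<subseteq> L" "L \<subseteq> C' d"
      show "L = C' d"
      proof (rule ccontr)
        assume "L \<noteq> C' d"
        then have "L \<subset> M" using L(3) by (auto simp: C'_def)
        then obtain P' where P': "primeideal P' R" "L \<subseteq> P'" "y \<in> P'" "P' \<subset> P"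
          using krull_principal_ideal[OF L(1) Mp(1) P _ Mp(3)] y(1) YC unfolding P_def by blast
        note P'id = primeideal.axioms(1)[OF P'(1)]
        have "w \<in> P'" if w: "w \<in> Y" for w
        proof (cases "w = y")
          case False
          obtain k :: nat and r where r: "s w \<in> carrier R - P" "r \<in> carrier R" "s w \<otimes> w [^] k = z w \<oplus> r \<otimes> y"
            using sz[OF w] by blast
          have wc: "w \<in> carrier R" using w less.prems(2) by blast
          have "z w \<in> P'" using w False L(2) P'(2) by (auto simp: Z_def)
          then have "s w \<otimes> w [^] k \<in> P'"
            unfolding r(3) using ideal_add[OF P'id] ideal.I_l_closed[OF P'id P'(3) r(2)] by blast
          then have "w [^] k \<in> P'" using primeideal.I_prime[OF P'(1), of "s w" "w [^] k"] r(1) wc P'(4) by auto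
          then show ?thesis using prime_pow[OF P'(1) wc] by blast
        qed (use P' in simp)
        then show False using minimal[OF P'(1)] P'(4) by (auto simp: P_def)
      qed
    qed
    then show ?thesis using Suc cardZ cardY by linarith
  qed
qed

end

section \<open>Local rings, their quotients and their parameters\<close>

lemma noeth_local_cring: "noeth_local R \<Longrightarrow> noetherian_cring R"
  by (simp add: noeth_local_def noetherian_cring_def)

lemma maximalideal_max_ideal: "noeth_local R \<Longrightarrow> maximalideal (max_ideal R) R"
  unfolding noeth_local_def max_ideal_def by (metis theI')

lemma ideal_max_ideal: "noeth_local R \<Longrightarrow> ideal (max_ideal R) R"
  using maximalideal_max_ideal maximalideal.axioms(1) by blast

lemma proper_subset_max_ideal:
  fixes R (structure)
  assumes "noeth_local R" "ideal I R" "I \<noteq> carrier R"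
  shows "I \<subseteq> max_ideal R"
proof -
  interpret noetherian_cring R using noeth_local_cring[OF assms(1)] .
  define C where "C = {L. ideal L R \<and> I \<subseteq> L \<and> L \<noteq> carrier R}"
  have "C \<noteq> {}" using assms by (auto simp: C_def)
  then obtain M where M: "M \<in> C" and max: "\<And>L. L \<in> C \<Longrightarrow> M \<subseteq> L \<Longrightarrow> L = M"
    by (rule exists_maximal) (auto simp: C_def)
  have "maximalideal M R"
  proof (rule maximalidealI)
    show "ideal M R" "carrier R \<noteq> M" using M by (auto simp: C_def)
    fix J assume J: "ideal J R" "M \<subseteq> J" "J \<subseteq> carrier R"
    then show "J = M \<or> J = carrier R" using max[of J] M by (auto simp: C_def)
  qed
  moreover have "\<exists>!\<mm>. maximalideal \<mm> R" using assms(1) by (simp add: noeth_local_def)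
  ultimately have "M = max_ideal R" using maximalideal_max_ideal[OF assms(1)] by blast
  then show ?thesis using M by (auto simp: C_def)
qed

lemma (in cring) proper_ideal_nonunit:
  assumes "ideal I R" "I \<noteq> carrier R" "u \<in> I"
  shows "u \<notin> Units R"
proof
  assume u: "u \<in> Units R"
  then have "inv u \<otimes> u \<in> I" using ideal.I_l_closed[OF assms(1,3) Units_inv_closed] by blast
  then have "\<one> \<in> I" using u by simp
  then show False using ideal.one_imp_carrier[OF assms(1)] assms(2) by blast
qed

lemma (in cring) nonunit_cgenideal:
  assumes "u \<in> carrier R" "u \<notin> Units R"
  shows "PIdl u \<noteq> carrier R"
proof
  assume "PIdl u = carrier R"
  then have "\<one> \<in> PIdl u" by simp
  then obtain v where "v \<in> carrier R" "\<one> = v \<otimes> u" unfolding cgenideal_def by blast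
  then show False using assms m_comm[of u v] unfolding Units_def by force
qed

lemma notin_max_ideal_unit:
  fixes R (structure)
  assumes "noeth_local R" "u \<in> carrier R" "u \<notin> max_ideal R"
  shows "u \<in> Units R"
proof (rule ccontr)
  interpret noetherian_cring R using noeth_local_cring[OF assms(1)] .
  assume "u \<notin> Units R"
  then show False
    using proper_subset_max_ideal[OF assms(1) cgenideal_ideal[OF assms(2)] nonunit_cgenideal[OF assms(2)]]
      cgenideal_self[OF assms(2)] assms(3) by blast
qed

lemma (in cring) max_ideal_eqI:
  assumes "ideal M R" "M \<noteq> carrier R" "\<And>u. u \<in> carrier R \<Longrightarrow> u \<notin> M \<Longrightarrow> u \<in> Units R"
  shows "max_ideal R = M"
  unfolding max_ideal_def
proof (rule the_equality)
  have small: "J \<subseteq> M" if "ideal J R" "J \<noteq> carrier R" for J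
    using proper_ideal_nonunit[OF that] assms(3) ideal_subset[OF that(1)] by blast
  show "maximalideal M R"
  proof (rule maximalidealI[OF assms(1)])
    show "carrier R \<noteq> M" using assms(2) by simp
    show "J = M \<or> J = carrier R" if "ideal J R" "M \<subseteq> J" for J using small[OF that(1)] that(2) by blast
  qed
  fix L assume L: "maximalideal L R"
  have "L \<subseteq> M" using small[of L] maximalideal.axioms(1)[OF L] maximalideal.I_notcarr[OF L] by simp
  then show "L = M" using maximalideal.I_maximal[OF L assms(1) _ ideal_subset[OF assms(1)]] assms(2) by blast
qed

lemma (in ideal) rcos_eq_iff:
  assumes "a \<in> carrier R" "b \<in> carrier R"
  shows "I +> a = I +> b \<longleftrightarrow> a \<ominus> b \<in> I"
  using quotient_eq_iff_same_a_r_cos[OF ideal_axioms assms] by auto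

lemma (in cring) rcos_mem_image_iff:
  assumes "ideal I R" "ideal M R" "I \<subseteq> M" "t \<in> carrier R"
  shows "I +> t \<in> (+>) I ` M \<longleftrightarrow> t \<in> M"
proof
  assume "I +> t \<in> (+>) I ` M"
  then obtain m where m: "m \<in> M" "I +> t = I +> m" by blast
  have mc: "m \<in> carrier R" using m ideal_subset[OF assms(2)] by blast
  have "t \<ominus> m \<in> M" using ideal.rcos_eq_iff[OF assms(1,4) mc] m assms(3) by blast
  then have "m \<oplus> (t \<ominus> m) \<in> M" using ideal_add[OF assms(2) m(1)] by blast
  moreover have "m \<oplus> (t \<ominus> m) = t" using mc assms(4) by algebra
  ultimately show "t \<in> M" by simp
qed auto

lemma carrier_Quot: "carrier (R Quot I) = (+>\<^bsub>R\<^esub>) I ` carrier R"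
  unfolding FactRing_def A_RCOSETS_def' by (simp add: image_def) blast

lemma max_ideal_Quot:
  fixes R (structure)
  assumes "noeth_local R" "ideal I R" "I \<noteq> carrier R"
  shows "max_ideal (R Quot I) = (+>\<^bsub>R\<^esub>) I ` max_ideal R"
proof -
  interpret noetherian_cring R using noeth_local_cring[OF assms(1)] .
  interpret I: ideal I R by fact
  interpret B: cring "R Quot I" using I.quotient_is_cring[OF is_cring] .
  interpret h: ring_hom_ring R "R Quot I" "(+>) I" using I.rcos_ring_hom_ring .
  have m: "ideal (max_ideal R) R" using ideal_max_ideal[OF assms(1)] .
  have Im: "I \<subseteq> max_ideal R" using proper_subset_max_ideal[OF assms] .
  note surj = carrier_Quot[of R I]
  show ?thesis
  proof (rule B.max_ideal_eqI)
    show "ideal ((+>) I ` max_ideal R) (R Quot I)" by (rule ring_ideal_imp_quot_ideal[OF assms(2) m])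
    have "\<one> \<notin> max_ideal R"
      using ideal.one_imp_carrier[OF m] maximalideal.I_notcarr[OF maximalideal_max_ideal[OF assms(1)]] by auto
    then have "I +> \<one> \<notin> (+>) I ` max_ideal R" using rcos_mem_image_iff[OF assms(2) m Im one_closed] by blast
    moreover have "I +> \<one> \<in> carrier (R Quot I)" using surj by blast
    ultimately show "(+>) I ` max_ideal R \<noteq> carrier (R Quot I)" by metis
    fix u assume u: "u \<in> carrier (R Quot I)" "u \<notin> (+>) I ` max_ideal R"
    then obtain t where t: "t \<in> carrier R" "u = I +> t" using surj by blast
    then have "t \<in> Units R" using notin_max_ideal_unit[OF assms(1)] u(2) by blast
    then have v: "inv t \<in> carrier R" "inv t \<otimes> t = \<one>" by auto
    have "(I +> inv t) \<otimes>\<^bsub>R Quot I\<^esub> u = \<one>\<^bsub>R Quot I\<^esub>"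
      using h.hom_mult[OF v(1) t(1)] v(2) h.hom_one t(2) by simp
    moreover have "I +> inv t \<in> carrier (R Quot I)" using surj v(1) by blast
    ultimately show "u \<in> Units (R Quot I)" using u(1) B.m_comm unfolding Units_def by fastforce
  qed
qed

text \<open>Otherwise every prime containing the other \<open>l - 1\<close> parameters would contain all of them, and the
  maximal ideal would have height at most \<open>l - 1\<close>.\<close>

lemma power_notin_rest_of_parameters:
  fixes R (structure)
  assumes "noeth_local R" "krull_dim R = enat l" "l \<ge> 1"
    and "X \<in> {1..l} \<rightarrow> max_ideal R" "genideal R (X ` {1..l}) = max_ideal R"
  shows "X 1 [^]\<^bsub>R\<^esub> (N::nat) \<notin> genideal R (X ` {2..l})"
proof
  interpret noetherian_cring R using noeth_local_cring[OF assms(1)] .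
  define Y where "Y = X ` {2..l}"
  assume N: "X 1 [^] N \<in> Idl (X ` {2..l})"
  have m: "ideal (max_ideal R) R" using ideal_max_ideal[OF assms(1)] .
  have mp: "primeideal (max_ideal R) R" using maximalideal_prime[OF maximalideal_max_ideal[OF assms(1)]] .
  have Xm: "X i \<in> max_ideal R" if "1 \<le> i" "i \<le> l" for i using assms(4) that by auto
  have Xc: "X i \<in> carrier R" if "1 \<le> i" "i \<le> l" for i using Xm[OF that] ideal_subset[OF m] by blast
  have "\<exists>n P. n \<ge> l \<and> (\<forall>i\<le>n. primeideal (P i) R) \<and> (\<forall>i<n. P i \<subset> P (Suc i))"
  proof (rule ccontr)
    assume *: "\<not> ?thesis"
    have "krull_dim R \<le> enat (l - 1)"
      unfolding krull_dim_def
    proof (rule Sup_least)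
      fix x assume "x \<in> {enat n |n. \<exists>P. (\<forall>i\<le>n. primeideal (P i) R) \<and> (\<forall>i<n. P i \<subset> P (Suc i))}"
      then obtain n where n: "x = enat n" "\<exists>P. (\<forall>i\<le>n. primeideal (P i) R) \<and> (\<forall>i<n. P i \<subset> P (Suc i))" by blast
      then have "n < l" using * by (meson not_le)
      then show "x \<le> enat (l - 1)" using n(1) by simp
    qed
    then show False using assms(2,3) by simp
  qed
  then obtain n P where n: "n \<ge> l" and P: "\<And>i. i \<le> n \<Longrightarrow> primeideal (P i) R" "\<And>i. i < n \<Longrightarrow> P i \<subset> P (Suc i)"
    by blast
  have sub: "I \<subseteq> max_ideal R" if "primeideal I R" for I
    using proper_subset_max_ideal[OF assms(1) primeideal.axioms(1)[OF that]] primeideal.I_notcarr[OF that] by blast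
  define C where "C i = (if i < l then P i else max_ideal R)" for i
  have "l \<le> card Y"
  proof (rule height_le_card[of Y l C])
    show "finite Y" by (simp add: Y_def)
    show "Y \<subseteq> carrier R" using Xc by (auto simp: Y_def)
    show "primeideal (C i) R" if "i \<le> l" for i using P(1)[of i] mp n that by (auto simp: C_def)
    show "C i \<subset> C (Suc i)" if "i < l" for i
      using P(2)[of i] sub[OF P(1)[of "Suc i"]] n that by (auto simp: C_def)
    show "Y \<subseteq> C l" using Xm by (auto simp: Y_def C_def)
    fix I assume I: "primeideal I R" "Y \<subseteq> I" "I \<subseteq> C l"
    have "X 1 [^] N \<in> I" using N genideal_minimal[OF primeideal.axioms(1)[OF I(1)] I(2)] by (auto simp: Y_def)
    then have "X 1 \<in> I" using prime_pow[OF I(1) Xc] assms(3) by simp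
    have "X ` {1..l} \<subseteq> I"
    proof
      fix x assume "x \<in> X ` {1..l}"
      then obtain i where "x = X i" "i = 1 \<or> i \<in> {2..l}" by fastforce
      then show "x \<in> I" using \<open>X 1 \<in> I\<close> I(2) by (auto simp: Y_def)
    qed
    then have "max_ideal R \<subseteq> I" unfolding assms(5)[symmetric] by (rule genideal_minimal[OF primeideal.axioms(1)[OF I(1)]])
    then show "I = C l" using I(3) by (auto simp: C_def)
  qed
  moreover have "card Y \<le> l - 1" unfolding Y_def using card_image_le[of "{2..l}" X] by simp
  ultimately show False using assms(3) by simp
qed

section \<open>Submodules of finite free modules\<close>

lemma (in ring) finsum_restr_module:
  assumes "C \<subseteq> carrier R" "\<zero> \<in> C" "\<And>x y. x \<in> C \<Longrightarrow> y \<in> C \<Longrightarrow> x \<oplus> y \<in> C"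
    and "finite A" "g \<in> A \<rightarrow> C"
  shows "finsum (restr_module R \<phi> C) g A = finsum R g A"
proof -
  interpret M: abelian_monoid "restr_module R \<phi> C"
  proof (rule abelian_monoidI)
    fix x y z assume "x \<in> carrier (restr_module R \<phi> C)" "y \<in> carrier (restr_module R \<phi> C)" "z \<in> carrier (restr_module R \<phi> C)"
    then have "x \<in> carrier R" "y \<in> carrier R" "z \<in> carrier R" using assms(1) by (auto simp: restr_module_def)
    then show "x \<oplus>\<^bsub>restr_module R \<phi> C\<^esub> y \<oplus>\<^bsub>restr_module R \<phi> C\<^esub> z
      = x \<oplus>\<^bsub>restr_module R \<phi> C\<^esub> (y \<oplus>\<^bsub>restr_module R \<phi> C\<^esub> z)"
      by (simp add: restr_module_def a_assoc)
  qed (use assms(1-3) in \<open>auto simp: restr_module_def a_comm subset_iff\<close>)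
  show ?thesis
    using assms(4,5)
  proof (induction A)
    case empty show ?case unfolding M.finsum_empty finsum_empty by (simp add: restr_module_def)
  next
    case (insert a A)
    have g: "g \<in> A \<rightarrow> carrier (restr_module R \<phi> C)" "g a \<in> carrier (restr_module R \<phi> C)"
      "g \<in> A \<rightarrow> carrier R" "g a \<in> carrier R"
      using insert(4) assms(1) by (auto simp: restr_module_def)
    have "finsum (restr_module R \<phi> C) g (insert a A) = g a \<oplus>\<^bsub>restr_module R \<phi> C\<^esub> finsum (restr_module R \<phi> C) g A"
      by (rule M.finsum_insert[OF insert(1,2) g(1,2)])
    also have "\<dots> = g a \<oplus> finsum R g A" using insert by (simp add: restr_module_def)
    also have "\<dots> = finsum R g (insert a A)" by (rule finsum_insert[OF insert(1,2) g(3,4), symmetric])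
    finally show ?case .
  qed
qed

lemma (in ring) mat_act_self_module:
  assumes "finite J" "\<And>i j. i \<in> I \<Longrightarrow> j \<in> J \<Longrightarrow> A i j \<in> carrier R" "y \<in> J \<rightarrow> carrier R"
  shows "mat_act (self_module R) I J A y = (\<lambda>i\<in>I. \<Oplus>j\<in>J. A i j \<otimes> y j)"
  unfolding mat_act_def
proof (rule restrict_ext)
  fix i assume i: "i \<in> I"
  have "(\<Oplus>\<^bsub>self_module R\<^esub>j\<in>J. A i j \<odot>\<^bsub>self_module R\<^esub> y j) = (\<Oplus>\<^bsub>self_module R\<^esub>j\<in>J. A i j \<otimes> y j)"
    by (simp add: self_module_def restr_module_def)
  also have "\<dots> = (\<Oplus>j\<in>J. A i j \<otimes> y j)"
    unfolding self_module_def by (rule finsum_restr_module) (use assms i in auto)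
  finally show "(\<Oplus>\<^bsub>self_module R\<^esub>j\<in>J. A i j \<odot>\<^bsub>self_module R\<^esub> y j) = (\<Oplus>j\<in>J. A i j \<otimes> y j)" .
qed

lemma (in ring) finsum_unit_vector:
  assumes "finite J" "k \<in> J" "\<And>j. j \<in> J \<Longrightarrow> g j \<in> carrier R"
  shows "(\<Oplus>j\<in>J. g j \<otimes> (if j = k then \<one> else \<zero>)) = g k"
proof -
  have "(\<Oplus>j\<in>J. g j \<otimes> (if j = k then \<one> else \<zero>)) = (\<Oplus>j\<in>J. if k = j then g j else \<zero>)"
    by (rule finsum_cong') (use assms in auto)
  also have "\<dots> = g k" by (rule finsum_singleton) (use assms in auto)
  finally show ?thesis .
qed

lemma (in ring) mat_act_unit_vector:
  assumes "finite J" "k \<in> J" "\<And>i j. i \<in> I \<Longrightarrow> j \<in> J \<Longrightarrow> A i j \<in> carrier R"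
  shows "mat_act (self_module R) I J A (\<lambda>j\<in>J. if j = k then \<one> else \<zero>) = (\<lambda>i\<in>I. A i k)"
proof -
  have "mat_act (self_module R) I J A (\<lambda>j\<in>J. if j = k then \<one> else \<zero>)
      = (\<lambda>i\<in>I. \<Oplus>j\<in>J. A i j \<otimes> (\<lambda>j\<in>J. if j = k then \<one> else \<zero>) j)"
    by (rule mat_act_self_module) (use assms in auto)
  also have "\<dots> = (\<lambda>i\<in>I. A i k)"
  proof (rule restrict_ext)
    fix i assume i: "i \<in> I"
    have "(\<Oplus>j\<in>J. A i j \<otimes> (\<lambda>j\<in>J. if j = k then \<one> else \<zero>) j) = (\<Oplus>j\<in>J. A i j \<otimes> (if j = k then \<one> else \<zero>))"
      by (rule finsum_cong') (use assms i in auto)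
    then show "(\<Oplus>j\<in>J. A i j \<otimes> (\<lambda>j\<in>J. if j = k then \<one> else \<zero>) j) = A i k"
      using finsum_unit_vector[OF assms(1,2), of "A i"] assms(3) i by simp
  qed
  finally show ?thesis .
qed

text \<open>Submodules of \<open>R\<^sup>q\<close>, with the vectors as extensional functions, which is what matrices act on.\<close>

definition free_submodule :: "('a, 'b) ring_scheme \<Rightarrow> nat \<Rightarrow> (nat \<Rightarrow> 'a) set \<Rightarrow> bool" where
  "free_submodule R q V \<longleftrightarrow> V \<subseteq> {..<q} \<rightarrow>\<^sub>E carrier R \<and> (\<lambda>i\<in>{..<q}. \<zero>\<^bsub>R\<^esub>) \<in> V \<and>
     (\<forall>\<alpha>\<in>carrier R. \<forall>\<beta>\<in>carrier R. \<forall>v\<in>V. \<forall>w\<in>V.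
        (\<lambda>i\<in>{..<q}. \<alpha> \<otimes>\<^bsub>R\<^esub> v i \<oplus>\<^bsub>R\<^esub> \<beta> \<otimes>\<^bsub>R\<^esub> w i) \<in> V)"

lemma free_submoduleD:
  assumes "free_submodule R q V"
  shows "v \<in> V \<Longrightarrow> v \<in> {..<q} \<rightarrow>\<^sub>E carrier R" "v \<in> V \<Longrightarrow> i < q \<Longrightarrow> v i \<in> carrier R"
    "(\<lambda>i\<in>{..<q}. \<zero>\<^bsub>R\<^esub>) \<in> V"
    "\<alpha> \<in> carrier R \<Longrightarrow> \<beta> \<in> carrier R \<Longrightarrow> v \<in> V \<Longrightarrow> w \<in> V \<Longrightarrow>
        (\<lambda>i\<in>{..<q}. \<alpha> \<otimes>\<^bsub>R\<^esub> v i \<oplus>\<^bsub>R\<^esub> \<beta> \<otimes>\<^bsub>R\<^esub> w i) \<in> V"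
  using assms unfolding free_submodule_def by (auto dest: PiE_mem)

lemma (in cring) ideal_of_coordinates:
  assumes "free_submodule R q V" "p < q"
  shows "ideal {v p | v. v \<in> V} R"
proof (rule idealI_comm)
  note D = free_submoduleD[OF assms(1)]
  show "{v p | v. v \<in> V} \<subseteq> carrier R" using D(2) assms(2) by blast
  show "\<zero> \<in> {v p | v. v \<in> V}"
  proof -
    have "\<zero> = (\<lambda>i\<in>{..<q}. \<zero>) p" using assms(2) by simp
    then show ?thesis using D(3) by blast
  qed
  fix a assume "a \<in> {v p | v. v \<in> V}"
  then obtain v where v: "a = v p" "v \<in> V" by blast
  show "a \<oplus> b \<in> {v p | v. v \<in> V}" if "b \<in> {v p | v. v \<in> V}" for b
  proof -
    obtain w where w: "b = w p" "w \<in> V" using \<open>b \<in> {v p | v. v \<in> V}\<close> by blast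
    define x where "x = (\<lambda>i\<in>{..<q}. \<one> \<otimes> v i \<oplus> \<one> \<otimes> w i)"
    have "x \<in> V" unfolding x_def by (rule D(4)[OF _ _ v(2) w(2)]) auto
    moreover have "a \<oplus> b = x p" using D(2)[OF v(2) assms(2)] D(2)[OF w(2) assms(2)] assms(2) v w by (simp add: x_def)
    ultimately show ?thesis by blast
  qed
  show "r \<otimes> a \<in> {v p | v. v \<in> V}" if "r \<in> carrier R" for r
  proof -
    define x where "x = (\<lambda>i\<in>{..<q}. r \<otimes> v i \<oplus> \<zero> \<otimes> v i)"
    have "x \<in> V" unfolding x_def by (rule D(4)[OF that _ v(2) v(2)]) auto
    moreover have "r \<otimes> a = x p" using D(2)[OF v(2) assms(2)] assms(2) v that by (simp add: x_def)
    ultimately show ?thesis by blast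
  qed
qed

lemma free_submodule_Int:
  "free_submodule R q V \<Longrightarrow> free_submodule R q W \<Longrightarrow> free_submodule R q (V \<inter> W)"
  unfolding free_submodule_def by blast

text \<open>Submodules of \<open>R\<^sup>q\<close> are finitely generated.  The induction is on the number \<open>p\<close> of coordinates
  that may be nonzero: the last of these coordinates runs through an ideal of \<open>R\<close>, and lifts of the
  generators of this ideal reduce the claim to the vectors for which it vanishes.  That \<open>G\<close>
  generates is expressed without linear combinations, by quantifying over the submodules
  containing \<open>G\<close>.\<close>

lemma (in noetherian_cring) free_submodule_finitely_generated:
  assumes "free_submodule R q V" "\<And>v i. v \<in> V \<Longrightarrow> p \<le> i \<Longrightarrow> i < q \<Longrightarrow> v i = \<zero>"
  shows "\<exists>G\<subseteq>V. finite G \<and> (\<forall>W. free_submodule R q W \<longrightarrow> G \<subseteq> W \<longrightarrow> V \<subseteq> W)"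
  using assms
proof (induction p arbitrary: V)
  case 0
  have "V \<subseteq> W" if W: "free_submodule R q W" for W
  proof
    fix v assume v: "v \<in> V"
    have "v = (\<lambda>i\<in>{..<q}. \<zero>)"
    proof (rule extensionalityI)
      show "v \<in> extensional {..<q}" using free_submoduleD(1)[OF 0(1) v] by (auto simp: PiE_def)
      show "v i = (\<lambda>i\<in>{..<q}. \<zero>) i" if "i \<in> {..<q}" for i using that 0(2)[OF v, of i] by simp
    qed auto
    then show "v \<in> W" using free_submoduleD(3)[OF W] by simp
  qed
  then show ?case by (intro exI[of _ "{}"]) simp
next
  case (Suc p)
  show ?case
  proof (cases "p < q")
    case False
    then show ?thesis using Suc.IH[OF Suc.prems(1)] by simp
  next
    case True
    note D = free_submoduleD[OF Suc.prems(1)]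
    have I: "ideal {v p | v. v \<in> V} R" by (rule ideal_of_coordinates[OF Suc.prems(1) True])
    obtain A where A: "A \<subseteq> carrier R" "finite A" "{v p | v. v \<in> V} = Idl A"
      using finetely_gen[OF I] by blast
    have "\<forall>a\<in>A. \<exists>v\<in>V. v p = a"
    proof
      fix a assume "a \<in> A"
      then have "a \<in> {v p | v. v \<in> V}" using genideal_self[OF A(1)] A(3) by blast
      then show "\<exists>v\<in>V. v p = a" by blast
    qed
    then obtain lift where lift: "\<And>a. a \<in> A \<Longrightarrow> lift a \<in> V \<and> lift a p = a" by metis
    define V0 where "V0 = {v \<in> V. v p = \<zero>}"
    have V0: "free_submodule R q V0"
      unfolding free_submodule_def
    proof (intro conjI ballI)
      show "V0 \<subseteq> {..<q} \<rightarrow>\<^sub>E carrier R" using D(1) by (auto simp: V0_def)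
      show "(\<lambda>i\<in>{..<q}. \<zero>) \<in> V0" using D(3) True by (simp add: V0_def)
      fix \<alpha> \<beta> v w assume *: "\<alpha> \<in> carrier R" "\<beta> \<in> carrier R" "v \<in> V0" "w \<in> V0"
      then have "(\<lambda>i\<in>{..<q}. \<alpha> \<otimes> v i \<oplus> \<beta> \<otimes> w i) \<in> V" using D(4) by (auto simp: V0_def)
      then show "(\<lambda>i\<in>{..<q}. \<alpha> \<otimes> v i \<oplus> \<beta> \<otimes> w i) \<in> V0" using * True by (simp add: V0_def)
    qed
    have "v i = \<zero>" if "v \<in> V0" "p \<le> i" "i < q" for v i
      using that Suc.prems(2)[of v i] by (cases "i = p") (auto simp: V0_def)
    then obtain G where G: "G \<subseteq> V0" "finite G" "\<And>W. free_submodule R q W \<Longrightarrow> G \<subseteq> W \<Longrightarrow> V0 \<subseteq> W"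
      using Suc.IH[OF V0] by auto
    have "V \<subseteq> W" if W: "free_submodule R q W" "G \<union> lift ` A \<subseteq> W" for W
    proof
      note E = free_submoduleD[OF W(1)]
      fix v assume v: "v \<in> V"
      have J: "ideal {v p | v. v \<in> V \<inter> W} R"
        by (rule ideal_of_coordinates[OF free_submodule_Int[OF Suc.prems(1) W(1)] True])
      have "A \<subseteq> {v p | v. v \<in> V \<inter> W}"
      proof
        fix a assume a: "a \<in> A"
        then have "lift a \<in> V \<inter> W" "a = lift a p" using lift[OF a] W(2) by auto
        then show "a \<in> {v p | v. v \<in> V \<inter> W}" by blast
      qed
      then have "{v p | v. v \<in> V} \<subseteq> {v p | v. v \<in> V \<inter> W}" unfolding A(3) by (rule genideal_minimal[OF J])
      then have "v p \<in> {v p | v. v \<in> V \<inter> W}" using v by blast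
      then obtain w where w: "w \<in> V" "w \<in> W" "v p = w p" by blast
      define d where "d = (\<lambda>i\<in>{..<q}. \<one> \<otimes> v i \<oplus> \<ominus> \<one> \<otimes> w i)"
      have "d \<in> V" unfolding d_def by (rule D(4)[OF _ _ v w(1)]) auto
      moreover have "d p = \<zero>" using w(3) D(2)[OF w(1) True] True by (simp add: d_def l_minus r_neg)
      ultimately have "d \<in> W" using G(3)[OF W(1)] W(2) by (auto simp: V0_def)
      then have "(\<lambda>i\<in>{..<q}. \<one> \<otimes> d i \<oplus> \<one> \<otimes> w i) \<in> W" by (intro E(4) w(2)) auto
      moreover have "(\<lambda>i\<in>{..<q}. \<one> \<otimes> d i \<oplus> \<one> \<otimes> w i) = v"
      proof (rule extensionalityI)
        show "v \<in> extensional {..<q}" using D(1)[OF v] by (auto simp: PiE_def)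
        fix i assume "i \<in> {..<q}"
        then have i: "i < q" by simp
        have c: "v i \<in> carrier R" "w i \<in> carrier R" using D(2)[OF v i] D(2)[OF w(1) i] by auto
        have "\<one> \<otimes> (\<one> \<otimes> v i \<oplus> \<ominus> \<one> \<otimes> w i) \<oplus> \<one> \<otimes> w i = v i" using c by algebra
        then show "(\<lambda>i\<in>{..<q}. \<one> \<otimes> d i \<oplus> \<one> \<otimes> w i) i = v i" using i by (simp add: d_def)
      qed auto
      ultimately show "v \<in> W" by simp
    qed
    moreover have "G \<union> lift ` A \<subseteq> V" using G(1) lift by (auto simp: V0_def)
    ultimately show ?thesis using G(2) A(2) by (intro exI[of _ "G \<union> lift ` A"]) simp
  qed
qed

lemma (in cring) free_submodule_sum:
  fixes p k :: nat
  assumes "free_submodule R q V" "\<And>j. j < p \<Longrightarrow> g j \<in> V" "\<And>j. j < p \<Longrightarrow> y j \<in> carrier R" "k \<le> p"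
  shows "(\<lambda>i\<in>{..<q}. \<Oplus>j\<in>{..<k}. g j i \<otimes> y j) \<in> V"
  using assms(4)
proof (induction k)
  case 0
  have "(\<lambda>i\<in>{..<q}. \<Oplus>j\<in>{..<0}. g j i \<otimes> y j) = (\<lambda>i\<in>{..<q}. \<zero>)" by (rule restrict_ext) simp
  then show ?case using free_submoduleD(3)[OF assms(1)] by (simp only:)
next
  case (Suc k)
  note D = free_submoduleD[OF assms(1)]
  have k: "k < p" using Suc by simp
  define x where "x = (\<lambda>i\<in>{..<q}. \<Oplus>j\<in>{..<k}. g j i \<otimes> y j)"
  have "x \<in> V" unfolding x_def by (rule Suc.IH) (use k in simp)
  then have "(\<lambda>i\<in>{..<q}. y k \<otimes> g k i \<oplus> \<one> \<otimes> x i) \<in> V"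
    by (rule D(4)[OF assms(3)[OF k] one_closed assms(2)[OF k]])
  moreover have "(\<lambda>i\<in>{..<q}. y k \<otimes> g k i \<oplus> \<one> \<otimes> x i) = (\<lambda>i\<in>{..<q}. \<Oplus>j\<in>{..<Suc k}. g j i \<otimes> y j)"
  proof (rule restrict_ext)
    fix i assume i: "i \<in> {..<q}"
    have gc: "g j i \<in> carrier R" if "j < p" for j using D(2)[OF assms(2)[OF that]] i by simp
    have "(\<Oplus>j\<in>{..<Suc k}. g j i \<otimes> y j) = g k i \<otimes> y k \<oplus> (\<Oplus>j\<in>{..<k}. g j i \<otimes> y j)"
      unfolding lessThan_Suc by (rule finsum_insert) (use gc assms(3) k in auto)
    moreover have "(\<Oplus>j\<in>{..<k}. g j i \<otimes> y j) \<in> carrier R" by (rule finsum_closed) (use gc assms(3) k in auto)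
    ultimately show "y k \<otimes> g k i \<oplus> \<one> \<otimes> x i = (\<Oplus>j\<in>{..<Suc k}. g j i \<otimes> y j)"
      using i gc[OF k] assms(3)[OF k] by (simp add: x_def m_comm)
  qed
  ultimately show ?case by (simp only:)
qed

lemma (in cring) finsum_lin:
  assumes "finite J" "\<And>j. j \<in> J \<Longrightarrow> g j \<in> carrier R" "\<And>j. j \<in> J \<Longrightarrow> y j \<in> carrier R" "\<And>j. j \<in> J \<Longrightarrow> z j \<in> carrier R"
    and "\<alpha> \<in> carrier R" "\<beta> \<in> carrier R"
  shows "(\<Oplus>j\<in>J. g j \<otimes> (\<alpha> \<otimes> y j \<oplus> \<beta> \<otimes> z j)) = \<alpha> \<otimes> (\<Oplus>j\<in>J. g j \<otimes> y j) \<oplus> \<beta> \<otimes> (\<Oplus>j\<in>J. g j \<otimes> z j)"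
  using assms(1-4)
proof (induction J)
  case empty then show ?case using assms by simp
next
  case (insert k J)
  have s: "(\<Oplus>j\<in>J. g j \<otimes> y j) \<in> carrier R" "(\<Oplus>j\<in>J. g j \<otimes> z j) \<in> carrier R"
    using insert by (auto intro!: finsum_closed)
  have c: "g k \<in> carrier R" "y k \<in> carrier R" "z k \<in> carrier R" using insert by auto
  have regroup: "u \<otimes> (\<alpha> \<otimes> v \<oplus> \<beta> \<otimes> w) \<oplus> (\<alpha> \<otimes> A \<oplus> \<beta> \<otimes> B)
      = \<alpha> \<otimes> (u \<otimes> v \<oplus> A) \<oplus> \<beta> \<otimes> (u \<otimes> w \<oplus> B)"
    if "u \<in> carrier R" "v \<in> carrier R" "w \<in> carrier R" "A \<in> carrier R" "B \<in> carrier R" for u v w A B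
    using that assms(5,6) by algebra
  have e1: "(\<Oplus>j\<in>insert k J. g j \<otimes> y j) = g k \<otimes> y k \<oplus> (\<Oplus>j\<in>J. g j \<otimes> y j)"
    by (rule finsum_insert) (use insert in auto)
  have e2: "(\<Oplus>j\<in>insert k J. g j \<otimes> z j) = g k \<otimes> z k \<oplus> (\<Oplus>j\<in>J. g j \<otimes> z j)"
    by (rule finsum_insert) (use insert in auto)
  have "(\<Oplus>j\<in>insert k J. g j \<otimes> (\<alpha> \<otimes> y j \<oplus> \<beta> \<otimes> z j))
    = g k \<otimes> (\<alpha> \<otimes> y k \<oplus> \<beta> \<otimes> z k) \<oplus> (\<Oplus>j\<in>J. g j \<otimes> (\<alpha> \<otimes> y j \<oplus> \<beta> \<otimes> z j))"
    by (rule finsum_insert) (use insert assms(5,6) in auto)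
  also have "(\<Oplus>j\<in>J. g j \<otimes> (\<alpha> \<otimes> y j \<oplus> \<beta> \<otimes> z j)) = \<alpha> \<otimes> (\<Oplus>j\<in>J. g j \<otimes> y j) \<oplus> \<beta> \<otimes> (\<Oplus>j\<in>J. g j \<otimes> z j)"
    using insert by simp
  also have "g k \<otimes> (\<alpha> \<otimes> y k \<oplus> \<beta> \<otimes> z k) \<oplus> (\<alpha> \<otimes> (\<Oplus>j\<in>J. g j \<otimes> y j) \<oplus> \<beta> \<otimes> (\<Oplus>j\<in>J. g j \<otimes> z j))
     = \<alpha> \<otimes> (g k \<otimes> y k \<oplus> (\<Oplus>j\<in>J. g j \<otimes> y j)) \<oplus> \<beta> \<otimes> (g k \<otimes> z k \<oplus> (\<Oplus>j\<in>J. g j \<otimes> z j))"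
    by (rule regroup[OF c s])
  finally show ?case using e1 e2 by simp
qed

lemma (in noetherian_cring) free_submodule_image:
  assumes "free_submodule R q V"
  shows "\<exists>(p::nat) D. (\<forall>i<q. \<forall>j<p. D i j \<in> carrier R) \<and>
     mat_act (self_module R) {..<q} {..<p} D ` ({..<p} \<rightarrow>\<^sub>E carrier R) = V"
proof -
  note DV = free_submoduleD[OF assms]
  obtain G where G: "G \<subseteq> V" "finite G" "\<And>W. free_submodule R q W \<Longrightarrow> G \<subseteq> W \<Longrightarrow> V \<subseteq> W"
    using free_submodule_finitely_generated[OF assms, of q] by auto
  define p where "p = card G"
  obtain g where "bij_betw g {0..<card G} G" using ex_bij_betw_nat_finite[OF G(2)] by blast
  then have gG: "g ` {..<p} = G" by (simp add: bij_betw_def p_def atLeast0LessThan)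
  have gV: "g j \<in> V" if "j < p" for j using gG G(1) that by blast
  define D where "D i j = g j i" for i j
  have Dc: "D i j \<in> carrier R" if "i < q" "j < p" for i j using DV(2)[OF gV] that by (simp add: D_def)
  define W where "W = mat_act (self_module R) {..<q} {..<p} D ` ({..<p} \<rightarrow>\<^sub>E carrier R)"
  have act: "mat_act (self_module R) {..<q} {..<p} D y = (\<lambda>i\<in>{..<q}. \<Oplus>j\<in>{..<p}. D i j \<otimes> y j)"
    if "y \<in> {..<p} \<rightarrow>\<^sub>E carrier R" for y
    by (rule mat_act_self_module) (use Dc that in auto)
  have WI: "mat_act (self_module R) {..<q} {..<p} D y \<in> W" if "y \<in> {..<p} \<rightarrow>\<^sub>E carrier R" for y
    unfolding W_def using that by (rule imageI)
  have "W \<subseteq> V"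
  proof
    fix v assume "v \<in> W"
    then obtain y where y: "y \<in> {..<p} \<rightarrow>\<^sub>E carrier R" "v = (\<lambda>i\<in>{..<q}. \<Oplus>j\<in>{..<p}. D i j \<otimes> y j)"
      using act unfolding W_def by auto
    show "v \<in> V" unfolding y(2) D_def
      by (rule free_submodule_sum[OF assms gV]) (use y in auto)
  qed
  moreover have "V \<subseteq> W"
  proof (rule G(3))
    show "free_submodule R q W"
      unfolding free_submodule_def
    proof (intro conjI ballI)
      show "W \<subseteq> {..<q} \<rightarrow>\<^sub>E carrier R" using \<open>W \<subseteq> V\<close> DV(1) by blast
      have z: "(\<lambda>j\<in>{..<p}. \<zero>) \<in> {..<p} \<rightarrow>\<^sub>E carrier R" by auto
      have "mat_act (self_module R) {..<q} {..<p} D (\<lambda>j\<in>{..<p}. \<zero>) = (\<lambda>i\<in>{..<q}. \<zero>)"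
        unfolding act[OF z]
      proof (rule restrict_ext)
        fix i assume "i \<in> {..<q}"
        then have "(\<Oplus>j\<in>{..<p}. D i j \<otimes> (\<lambda>j\<in>{..<p}. \<zero>) j) = (\<Oplus>j\<in>{..<p}. \<zero>)"
          by (intro finsum_cong') (use Dc in auto)
        then show "(\<Oplus>j\<in>{..<p}. D i j \<otimes> (\<lambda>j\<in>{..<p}. \<zero>) j) = \<zero>" by simp
      qed
      then show "(\<lambda>i\<in>{..<q}. \<zero>) \<in> W" using WI[OF z] by (simp only:)
      fix \<alpha> \<beta> v w assume *: "\<alpha> \<in> carrier R" "\<beta> \<in> carrier R" "v \<in> W" "w \<in> W"
      obtain y where y: "y \<in> {..<p} \<rightarrow>\<^sub>E carrier R" "v = (\<lambda>i\<in>{..<q}. \<Oplus>j\<in>{..<p}. D i j \<otimes> y j)"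
        using *(3) act unfolding W_def by auto
      obtain z where z: "z \<in> {..<p} \<rightarrow>\<^sub>E carrier R" "w = (\<lambda>i\<in>{..<q}. \<Oplus>j\<in>{..<p}. D i j \<otimes> z j)"
        using *(4) act unfolding W_def by auto
      define x where "x = (\<lambda>j\<in>{..<p}. \<alpha> \<otimes> y j \<oplus> \<beta> \<otimes> z j)"
      have yz: "y j \<in> carrier R" "z j \<in> carrier R" if "j < p" for j using y z that by auto
      have x: "x \<in> {..<p} \<rightarrow>\<^sub>E carrier R" using yz * by (auto simp: x_def)
      have "(\<lambda>i\<in>{..<q}. \<alpha> \<otimes> v i \<oplus> \<beta> \<otimes> w i) = mat_act (self_module R) {..<q} {..<p} D x"
        unfolding act[OF x]
      proof (rule restrict_ext)
        fix i assume i: "i \<in> {..<q}"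
        have "(\<Oplus>j\<in>{..<p}. D i j \<otimes> x j) = (\<Oplus>j\<in>{..<p}. D i j \<otimes> (\<alpha> \<otimes> y j \<oplus> \<beta> \<otimes> z j))"
          by (rule finsum_cong') (use yz Dc i * in \<open>auto simp: x_def\<close>)
        also have "\<dots> = \<alpha> \<otimes> (\<Oplus>j\<in>{..<p}. D i j \<otimes> y j) \<oplus> \<beta> \<otimes> (\<Oplus>j\<in>{..<p}. D i j \<otimes> z j)"
          by (rule finsum_lin) (use yz Dc i * in auto)
        finally show "\<alpha> \<otimes> v i \<oplus> \<beta> \<otimes> w i = (\<Oplus>j\<in>{..<p}. D i j \<otimes> x j)" using i y(2) z(2) by simp
      qed
      then show "(\<lambda>i\<in>{..<q}. \<alpha> \<otimes> v i \<oplus> \<beta> \<otimes> w i) \<in> W" using WI[OF x] by (simp only:)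
    qed
    show "G \<subseteq> W"
    proof
      fix v assume v: "v \<in> G"
      then obtain k where k: "k < p" "v = g k" using gG by blast
      have "mat_act (self_module R) {..<q} {..<p} D (\<lambda>j\<in>{..<p}. if j = k then \<one> else \<zero>) = (\<lambda>i\<in>{..<q}. D i k)"
        by (rule mat_act_unit_vector) (use k Dc in auto)
      also have "\<dots> = v"
      proof (rule extensionalityI)
        show "v \<in> extensional {..<q}" using DV(1) v G(1) by (auto simp: PiE_def)
      qed (auto simp: D_def k)
      finally have e: "mat_act (self_module R) {..<q} {..<p} D (\<lambda>j\<in>{..<p}. if j = k then \<one> else \<zero>) = v" .
      have "(\<lambda>j\<in>{..<p}. if j = k then \<one> else \<zero>) \<in> {..<p} \<rightarrow>\<^sub>E carrier R" by auto
      from WI[OF this] show "v \<in> W" unfolding e .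
    qed
  qed
  ultimately have "W = V" by (rule subset_antisym)
  show ?thesis
  proof (intro exI[of _ p] exI[of _ D] conjI)
    show "\<forall>i<q. \<forall>j<p. D i j \<in> carrier R" using Dc by simp
    show "mat_act (self_module R) {..<q} {..<p} D ` ({..<p} \<rightarrow>\<^sub>E carrier R) = V"
      using \<open>W = V\<close> by (simp only: W_def)
  qed
qed

section \<open>Free resolutions\<close>

lemma (in cring) free_submodule_kernel:
  assumes "\<And>i j. i < q \<Longrightarrow> j < p \<Longrightarrow> D i j \<in> carrier R"
  shows "free_submodule R p {v \<in> {..<p} \<rightarrow>\<^sub>E carrier R. mat_act (self_module R) {..<q} {..<p} D v = (\<lambda>k\<in>{..<q}. \<zero>)}"
    (is "free_submodule R p ?V")
proof -
  have act: "mat_act (self_module R) {..<q} {..<p} D y = (\<lambda>i\<in>{..<q}. \<Oplus>j\<in>{..<p}. D i j \<otimes> y j)"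
    if "y \<in> {..<p} \<rightarrow>\<^sub>E carrier R" for y
    by (rule mat_act_self_module) (use assms that in auto)
  have mem: "y \<in> ?V \<longleftrightarrow> y \<in> {..<p} \<rightarrow>\<^sub>E carrier R \<and> (\<forall>i<q. (\<Oplus>j\<in>{..<p}. D i j \<otimes> y j) = \<zero>)" for y
  proof (cases "y \<in> {..<p} \<rightarrow>\<^sub>E carrier R")
    case True
    have "(\<lambda>i\<in>{..<q}. \<Oplus>j\<in>{..<p}. D i j \<otimes> y j) = (\<lambda>k\<in>{..<q}. \<zero>)
      \<longleftrightarrow> (\<forall>i<q. (\<Oplus>j\<in>{..<p}. D i j \<otimes> y j) = \<zero>)"
      unfolding restrict_def fun_eq_iff by auto
    then show ?thesis using True act[OF True] by simp
  qed simp
  show ?thesis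
    unfolding free_submodule_def
  proof (intro conjI ballI)
    show "?V \<subseteq> {..<p} \<rightarrow>\<^sub>E carrier R" by blast
    have "(\<Oplus>j\<in>{..<p}. D i j \<otimes> (\<lambda>i\<in>{..<p}. \<zero>) j) = \<zero>" if "i < q" for i
    proof -
      have "(\<Oplus>j\<in>{..<p}. D i j \<otimes> (\<lambda>i\<in>{..<p}. \<zero>) j) = (\<Oplus>j\<in>{..<p}. \<zero>)"
        by (rule finsum_cong') (use assms that in auto)
      then show ?thesis by simp
    qed
    then show "(\<lambda>i\<in>{..<p}. \<zero>) \<in> ?V" unfolding mem by auto
    fix \<alpha> \<beta> y z assume *: "\<alpha> \<in> carrier R" "\<beta> \<in> carrier R" "y \<in> ?V" "z \<in> ?V"
    have y: "y \<in> {..<p} \<rightarrow>\<^sub>E carrier R" "\<And>i. i < q \<Longrightarrow> (\<Oplus>j\<in>{..<p}. D i j \<otimes> y j) = \<zero>" using *(3) unfolding mem by auto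
    have z: "z \<in> {..<p} \<rightarrow>\<^sub>E carrier R" "\<And>i. i < q \<Longrightarrow> (\<Oplus>j\<in>{..<p}. D i j \<otimes> z j) = \<zero>" using *(4) unfolding mem by auto
    have yz: "y j \<in> carrier R" "z j \<in> carrier R" if "j < p" for j using y(1) z(1) that by auto
    define x where "x = (\<lambda>j\<in>{..<p}. \<alpha> \<otimes> y j \<oplus> \<beta> \<otimes> z j)"
    have "(\<Oplus>j\<in>{..<p}. D i j \<otimes> x j) = \<zero>" if i: "i < q" for i
    proof -
      have "(\<Oplus>j\<in>{..<p}. D i j \<otimes> x j) = (\<Oplus>j\<in>{..<p}. D i j \<otimes> (\<alpha> \<otimes> y j \<oplus> \<beta> \<otimes> z j))"
        by (rule finsum_cong') (use yz assms i *(1,2) in \<open>auto simp: x_def\<close>)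
      also have "\<dots> = \<alpha> \<otimes> (\<Oplus>j\<in>{..<p}. D i j \<otimes> y j) \<oplus> \<beta> \<otimes> (\<Oplus>j\<in>{..<p}. D i j \<otimes> z j)"
        by (rule finsum_lin) (use yz assms i *(1,2) in auto)
      also have "\<dots> = \<zero>" unfolding y(2)[OF i] z(2)[OF i] using *(1,2) by simp
      finally show ?thesis .
    qed
    moreover have "x \<in> {..<p} \<rightarrow>\<^sub>E carrier R" using yz *(1,2) by (auto simp: x_def)
    ultimately show "(\<lambda>j\<in>{..<p}. \<alpha> \<otimes> y j \<oplus> \<beta> \<otimes> z j) \<in> ?V" unfolding mem x_def[symmetric] by blast
  qed
qed

text \<open>Any matrix is the beginning of an acyclic complex, as each kernel is the image of a matrix.\<close>

lemma (in noetherian_cring) exists_acyclic_complex: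
  assumes "\<And>i j. i < q\<^sub>0 \<Longrightarrow> j < p\<^sub>0 \<Longrightarrow> D\<^sub>0 i j \<in> carrier R"
  obtains b d where "acyclic_complex R b d" "b 0 = q\<^sub>0" "b (Suc 0) = p\<^sub>0" "d 0 = D\<^sub>0"
proof -
  (* A state (q, p, D) is a q by p matrix D; the next state is a matrix onto the kernel of D. *)
  define ok where "ok n x = ((n = (0::nat) \<longrightarrow> x = (q\<^sub>0, p\<^sub>0, D\<^sub>0)) \<and>
    (\<forall>i<fst x. \<forall>j<fst (snd x). snd (snd x) i j \<in> carrier R))" for n and x :: "nat \<times> nat \<times> (nat \<Rightarrow> nat \<Rightarrow> 'a)"
  define next_ok where "next_ok x y = (fst y = fst (snd x) \<and>
    {v \<in> {..<fst (snd x)} \<rightarrow>\<^sub>E carrier R.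
       mat_act (self_module R) {..<fst x} {..<fst (snd x)} (snd (snd x)) v = (\<lambda>k\<in>{..<fst x}. \<zero>)}
    = mat_act (self_module R) {..<fst y} {..<fst (snd y)} (snd (snd y)) ` ({..<fst (snd y)} \<rightarrow>\<^sub>E carrier R))"
    for x y :: "nat \<times> nat \<times> (nat \<Rightarrow> nat \<Rightarrow> 'a)"
  have "\<exists>F. \<forall>n. ok n (F n) \<and> next_ok (F n) (F (Suc n))"
  proof (rule dependent_nat_choice)
    show "\<exists>x. ok 0 x" using assms by (intro exI[of _ "(q\<^sub>0, p\<^sub>0, D\<^sub>0)"]) (simp add: ok_def)
    fix x :: "nat \<times> nat \<times> (nat \<Rightarrow> nat \<Rightarrow> 'a)" and n assume x: "ok n x"
    obtain q p D where xe: "x = (q, p, D)" by (cases x) auto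
    have "free_submodule R p {v \<in> {..<p} \<rightarrow>\<^sub>E carrier R. mat_act (self_module R) {..<q} {..<p} D v = (\<lambda>k\<in>{..<q}. \<zero>)}"
      by (rule free_submodule_kernel) (use x xe in \<open>auto simp: ok_def\<close>)
    from free_submodule_image[OF this] obtain r :: nat and E where "\<forall>i<p. \<forall>j<r. E i j \<in> carrier R"
      "mat_act (self_module R) {..<p} {..<r} E ` ({..<r} \<rightarrow>\<^sub>E carrier R)
        = {v \<in> {..<p} \<rightarrow>\<^sub>E carrier R. mat_act (self_module R) {..<q} {..<p} D v = (\<lambda>k\<in>{..<q}. \<zero>)}"
      by blast
    then show "\<exists>y. ok (Suc n) y \<and> next_ok x y"
      by (intro exI[of _ "(p, r, E)"]) (simp add: ok_def next_ok_def xe)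
  qed
  then obtain F where F: "\<And>n. ok n (F n)" "\<And>n. next_ok (F n) (F (Suc n))" by blast
  define b where "b n = fst (F n)" for n
  define d where "d n = snd (snd (F n))" for n
  have bS: "b (Suc n) = fst (snd (F n))" for n using F(2)[of n] by (simp add: b_def next_ok_def)
  have F0: "F 0 = (q\<^sub>0, p\<^sub>0, D\<^sub>0)" using F(1)[of 0] by (simp add: ok_def)
  have "acyclic_complex R b d"
    unfolding acyclic_complex_def
  proof (intro conjI allI impI)
    fix i k j assume "k < b i" "j < b (Suc i)"
    then show "d i k j \<in> carrier R" using F(1)[of i] unfolding bS by (simp add: ok_def d_def b_def)
  next
    fix i
    show "{v \<in> {..<b (Suc i)} \<rightarrow>\<^sub>E carrier R.
            mat_act (self_module R) {..<b i} {..<b (Suc i)} (d i) v = (\<lambda>k\<in>{..<b i}. \<zero>)}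
          = mat_act (self_module R) {..<b (Suc i)} {..<b (Suc (Suc i))} (d (Suc i))
              ` ({..<b (Suc (Suc i))} \<rightarrow>\<^sub>E carrier R)"
      using F(2)[of i] unfolding next_ok_def bS d_def b_def[of i] by simp
  qed
  then show thesis by (rule that) (use F0 bS[of 0] in \<open>auto simp: b_def d_def\<close>)
qed

text \<open>The first matrix of the resolution is a row of generators of the maximal ideal.\<close>

lemma exists_residue_field_resolution:
  fixes R (structure)
  assumes "noeth_local R"
  obtains e b d where "free_resolution R (residue_field R) e b d" "b 0 = 1"
    "\<And>t. t \<in> max_ideal R \<Longrightarrow> \<exists>y\<in>{..<b 1} \<rightarrow> carrier R. t = (\<Oplus>j\<in>{..<b 1}. d 0 0 j \<otimes> y j)"
    "\<And>j. j < b 1 \<Longrightarrow> d 0 0 j \<in> max_ideal R"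
proof -
  interpret noetherian_cring R using noeth_local_cring[OF assms] .
  define \<mm> where "\<mm> = max_ideal R"
  have m: "ideal \<mm> R" using ideal_max_ideal[OF assms] by (simp add: \<mm>_def)
  interpret I: ideal \<mm> R by fact
  interpret B: cring "R Quot \<mm>" using I.quotient_is_cring[OF is_cring] .
  note mc = ideal_subset[OF m]
  (* The maximal ideal as a submodule of R^1. *)
  define V where "V = {v \<in> {..<1} \<rightarrow>\<^sub>E carrier R. v (0::nat) \<in> \<mm>}"
  have "free_submodule R 1 V"
    unfolding free_submodule_def
  proof (intro conjI ballI)
    show "V \<subseteq> {..<1} \<rightarrow>\<^sub>E carrier R" by (auto simp: V_def)
    show "(\<lambda>i\<in>{..<1}. \<zero>) \<in> V" using ideal_zero[OF m] by (auto simp: V_def)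
    fix \<alpha> \<beta> v w assume *: "\<alpha> \<in> carrier R" "\<beta> \<in> carrier R" "v \<in> V" "w \<in> V"
    then have "\<alpha> \<otimes> v 0 \<oplus> \<beta> \<otimes> w 0 \<in> \<mm>" using ideal_add[OF m] ideal.I_l_closed[OF m] by (auto simp: V_def)
    then show "(\<lambda>i\<in>{..<1}. \<alpha> \<otimes> v i \<oplus> \<beta> \<otimes> w i) \<in> V" using mc by (auto simp: V_def)
  qed
  from free_submodule_image[OF this] obtain p :: nat and D where D': "\<forall>i<1. \<forall>j<p. D i j \<in> carrier R"
    and D2: "mat_act (self_module R) {..<1} {..<p} D ` ({..<p} \<rightarrow>\<^sub>E carrier R) = V"
    by blast
  have D: "\<And>i j. i < 1 \<Longrightarrow> j < p \<Longrightarrow> D i j \<in> carrier R" using D' by simp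
  obtain b d where bd: "acyclic_complex R b d" "b 0 = 1" "b (Suc 0) = p" "d 0 = D"
    by (rule exists_acyclic_complex[of 1 p D, OF D])
  have b1: "b 1 = p" using bd(3) by simp
  have act: "mat_act (self_module R) {..<1} {..<p} D y = (\<lambda>i\<in>{..<1}. \<Oplus>j\<in>{..<p}. D i j \<otimes> y j)"
    if "y \<in> {..<p} \<rightarrow>\<^sub>E carrier R" for y
    by (rule mat_act_self_module) (use D that in auto)
  define e where "e i = \<mm> +> \<one>" for i :: nat
  let ?N = "residue_field R"
  have N: "?N = restr_module (R Quot \<mm>) ((+>) \<mm>) (carrier (R Quot \<mm>))"
    by (simp add: residue_field_def \<mm>_def Let_def)
  have cN: "carrier ?N = carrier (R Quot \<mm>)" by (simp add: N restr_module_def)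
  have hom: "(+>) \<mm> \<in> ring_hom R (R Quot \<mm>)" by (rule I.rcos_ring_hom)
  have cl: "\<mm> +> t \<in> carrier (R Quot \<mm>)" if "t \<in> carrier R" for t using ring_hom_closed[OF hom that] .
  have lin: "lin_comb ?N {..<1} e v = \<mm> +> v 0" if v: "v \<in> {..<1} \<rightarrow>\<^sub>E carrier R" for v :: "nat \<Rightarrow> 'a"
  proof -
    have v0: "v 0 \<in> carrier R" using v by auto
    have set1: "{..<1::nat} = {0}" by auto
    have "lin_comb ?N {..<1} e v = (\<Oplus>\<^bsub>?N\<^esub>i\<in>{..<1}. (\<mm> +> v i) \<otimes>\<^bsub>R Quot \<mm>\<^esub> (\<mm> +> \<one>))"
      unfolding lin_comb_def e_def N by (simp only: restr_module_def module.simps)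
    also have "\<dots> = (\<Oplus>\<^bsub>R Quot \<mm>\<^esub>i\<in>{..<1}. (\<mm> +> v i) \<otimes>\<^bsub>R Quot \<mm>\<^esub> (\<mm> +> \<one>))"
      unfolding N
    proof (rule B.finsum_restr_module)
      show "(\<lambda>i. (\<mm> +> v i) \<otimes>\<^bsub>R Quot \<mm>\<^esub> (\<mm> +> \<one>)) \<in> {..<1} \<rightarrow> carrier (R Quot \<mm>)"
        by (intro Pi_I B.m_closed cl one_closed) (use v in auto)
    qed (rule order_refl B.zero_closed B.a_closed finite_lessThan | assumption)+
    also have "\<dots> = (\<mm> +> v 0) \<otimes>\<^bsub>R Quot \<mm>\<^esub> (\<mm> +> \<one>)"
    proof -
      have c: "(\<mm> +> v 0) \<otimes>\<^bsub>R Quot \<mm>\<^esub> (\<mm> +> \<one>) \<in> carrier (R Quot \<mm>)"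
        by (intro B.m_closed cl one_closed v0)
      have "(\<Oplus>\<^bsub>R Quot \<mm>\<^esub>i\<in>{0}. (\<mm> +> v i) \<otimes>\<^bsub>R Quot \<mm>\<^esub> (\<mm> +> \<one>))
        = (\<mm> +> v 0) \<otimes>\<^bsub>R Quot \<mm>\<^esub> (\<mm> +> \<one>) \<oplus>\<^bsub>R Quot \<mm>\<^esub>
          (\<Oplus>\<^bsub>R Quot \<mm>\<^esub>i\<in>{}. (\<mm> +> v i) \<otimes>\<^bsub>R Quot \<mm>\<^esub> (\<mm> +> \<one>))"
        by (rule B.finsum_insert) (use c in simp_all)
      then show ?thesis unfolding set1 B.finsum_empty B.r_zero[OF c] .
    qed
    also have "\<dots> = \<mm> +> v 0" using ring_hom_mult[OF hom v0 one_closed] v0 by simp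
    finally show ?thesis .
  qed
  have zN: "\<zero>\<^bsub>?N\<^esub> = \<mm>" by (simp add: N restr_module_def FactRing_def)
  have "free_resolution R ?N e b d"
    unfolding free_resolution_def
  proof (intro conjI)
    show "acyclic_complex R b d" by fact
    show "e \<in> {..<b 0} \<rightarrow> carrier ?N" using cl[OF one_closed] by (simp add: e_def cN)
    show "lin_comb ?N {..<b 0} e ` ({..<b 0} \<rightarrow>\<^sub>E carrier R) = carrier ?N"
      unfolding bd(2)
    proof
      show "lin_comb ?N {..<1} e ` ({..<1} \<rightarrow>\<^sub>E carrier R) \<subseteq> carrier ?N"
      proof
        fix x assume "x \<in> lin_comb ?N {..<1} e ` ({..<1} \<rightarrow>\<^sub>E carrier R)"
        then obtain v where v: "v \<in> {..<1} \<rightarrow>\<^sub>E carrier R" "x = lin_comb ?N {..<1} e v" by blast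
        then have "x = \<mm> +> v 0" "v 0 \<in> carrier R" using lin by auto
        then show "x \<in> carrier ?N" using cl cN by simp
      qed
      show "carrier ?N \<subseteq> lin_comb ?N {..<1} e ` ({..<1} \<rightarrow>\<^sub>E carrier R)"
      proof
        fix x assume "x \<in> carrier ?N"
        then obtain t where t: "t \<in> carrier R" "x = \<mm> +> t" unfolding cN carrier_Quot by blast
        define v where "v = (\<lambda>i\<in>{..<1::nat}. t)"
        have v: "v \<in> {..<1} \<rightarrow>\<^sub>E carrier R" using t by (auto simp: v_def)
        have "x = lin_comb ?N {..<1} e v" using lin[OF v] t(2) by (simp add: v_def)
        then show "x \<in> lin_comb ?N {..<1} e ` ({..<1} \<rightarrow>\<^sub>E carrier R)" using v by blast
      qed
    qed
    have "{v \<in> {..<1} \<rightarrow>\<^sub>E carrier R. lin_comb ?N {..<1} e v = \<mm>} = V"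
    proof -
      have "\<mm> +> t = \<mm> \<longleftrightarrow> t \<in> \<mm>" if t: "t \<in> carrier R" for t
        using I.rcos_eq_iff[OF t zero_closed] a_rcos_zero[OF m ideal_zero[OF m]] t by (simp add: a_minus_def)
      then have "lin_comb ?N {..<1} e v = \<mm> \<longleftrightarrow> v 0 \<in> \<mm>" if "v \<in> {..<1} \<rightarrow>\<^sub>E carrier R" for v :: "nat \<Rightarrow> 'a"
        using lin[OF that] that by auto
      then show ?thesis by (auto simp: V_def)
    qed
    then show "{v \<in> {..<b 0} \<rightarrow>\<^sub>E carrier R. lin_comb ?N {..<b 0} e v = \<zero>\<^bsub>?N\<^esub>}
       = mat_act (self_module R) {..<b 0} {..<b 1} (d 0) ` ({..<b 1} \<rightarrow>\<^sub>E carrier R)"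
      unfolding zN bd(2) b1 bd(4) D2 .
  qed
  moreover have "\<exists>y\<in>{..<b 1} \<rightarrow> carrier R. t = (\<Oplus>j\<in>{..<b 1}. d 0 0 j \<otimes> y j)" if t: "t \<in> max_ideal R" for t
  proof -
    have "(\<lambda>i\<in>{..<1}. t) \<in> V" using t mc by (auto simp: V_def \<mm>_def)
    then obtain y where y: "y \<in> {..<p} \<rightarrow>\<^sub>E carrier R" "(\<lambda>i\<in>{..<1}. t) = mat_act (self_module R) {..<1} {..<p} D y"
      using D2 by blast
    have "t = (\<lambda>i\<in>{..<1::nat}. t) 0" by simp
    also have "\<dots> = (\<Oplus>j\<in>{..<p}. D 0 j \<otimes> y j)" unfolding y(2) act[OF y(1)] by simp
    finally have "t = (\<Oplus>j\<in>{..<p}. D 0 j \<otimes> y j)" .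
    then show ?thesis unfolding b1 bd(4) using y(1) by (intro bexI[of _ y]) auto
  qed
  moreover have "d 0 0 j \<in> max_ideal R" if j: "j < b 1" for j
  proof -
    have jp: "j \<in> {..<p}" using j b1 by simp
    have "mat_act (self_module R) {..<1} {..<p} D (\<lambda>k\<in>{..<p}. if k = j then \<one> else \<zero>) = (\<lambda>i\<in>{..<1}. D i j)"
      by (rule mat_act_unit_vector) (use jp D in auto)
    moreover have "(\<lambda>k\<in>{..<p}. if k = j then \<one> else \<zero>) \<in> {..<p} \<rightarrow>\<^sub>E carrier R" by auto
    then have "mat_act (self_module R) {..<1} {..<p} D (\<lambda>k\<in>{..<p}. if k = j then \<one> else \<zero>) \<in> V"
      unfolding D2[symmetric] by (rule imageI)
    ultimately have "(\<lambda>i\<in>{..<1}. D i j) \<in> V" by (simp only:)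
    then show ?thesis by (simp add: V_def bd(4) \<mm>_def)
  qed
  ultimately show thesis using that bd(2) by blast
qed

section \<open>Modules inside a ring and powers of modules\<close>

lemma module_restr_module:
  fixes R (structure) and S (structure)
  assumes "cring R" "cring S" "\<phi> \<in> ring_hom R S"
    and C: "C \<subseteq> carrier S" "\<zero>\<^bsub>S\<^esub> \<in> C" "\<And>x y. x \<in> C \<Longrightarrow> y \<in> C \<Longrightarrow> x \<oplus>\<^bsub>S\<^esub> y \<in> C"
    "\<And>r x. r \<in> carrier R \<Longrightarrow> x \<in> C \<Longrightarrow> \<phi> r \<otimes>\<^bsub>S\<^esub> x \<in> C"
  shows "module R (restr_module S \<phi> C)"
proof -
  interpret R: cring R by fact
  interpret S: cring S by fact
  interpret h: ring_hom_cring R S \<phi> using assms(1-3) by (simp add: ring_hom_cring_def ring_hom_cring_axioms_def)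
  have c: "x \<in> carrier S" if "x \<in> C" for x using C(1) that by blast
  have neg: "\<ominus>\<^bsub>S\<^esub> x \<in> C" if x: "x \<in> C" for x
  proof -
    have "\<phi> (\<ominus>\<^bsub>R\<^esub> \<one>\<^bsub>R\<^esub>) \<otimes>\<^bsub>S\<^esub> x = \<ominus>\<^bsub>S\<^esub> x" using c[OF x] by (simp add: S.l_minus)
    then show ?thesis using C(4)[of "\<ominus>\<^bsub>R\<^esub> \<one>\<^bsub>R\<^esub>" x] x by simp
  qed
  show ?thesis
  proof (rule moduleI)
    show "abelian_group (restr_module S \<phi> C)"
    proof (rule abelian_groupI)
      fix x assume "x \<in> carrier (restr_module S \<phi> C)"
      then have "\<ominus>\<^bsub>S\<^esub> x \<in> C" "\<ominus>\<^bsub>S\<^esub> x \<oplus>\<^bsub>S\<^esub> x = \<zero>\<^bsub>S\<^esub>"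
        using neg c by (auto simp: restr_module_def S.l_neg)
      then show "\<exists>y\<in>carrier (restr_module S \<phi> C). y \<oplus>\<^bsub>restr_module S \<phi> C\<^esub> x = \<zero>\<^bsub>restr_module S \<phi> C\<^esub>"
        by (intro bexI[of _ "\<ominus>\<^bsub>S\<^esub> x"]) (auto simp: restr_module_def)
    qed (use C c in \<open>simp_all add: restr_module_def S.a_assoc S.a_comm S.a_lcomm\<close>)
  qed (use assms(1) C c in \<open>simp_all add: restr_module_def S.l_distr S.r_distr S.m_assoc\<close>)
qed

lemma module_pow_module:
  assumes "module R M"
  shows "module R (pow_module M I)"
proof -
  interpret module R M by fact
  have mem: "v i \<in> carrier M" if "v \<in> I \<rightarrow>\<^sub>E carrier M" "i \<in> I" for v i using that by auto
  show ?thesis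
  proof (rule moduleI)
    show "cring R" by (rule R.is_cring)
    show "abelian_group (pow_module M I)"
    proof (rule abelian_groupI)
      fix x y z assume *: "x \<in> carrier (pow_module M I)" "y \<in> carrier (pow_module M I)" "z \<in> carrier (pow_module M I)"
      show "x \<oplus>\<^bsub>pow_module M I\<^esub> y \<in> carrier (pow_module M I)"
        using *(1,2) mem by (auto simp: pow_module_def)
      show "x \<oplus>\<^bsub>pow_module M I\<^esub> y \<oplus>\<^bsub>pow_module M I\<^esub> z = x \<oplus>\<^bsub>pow_module M I\<^esub> (y \<oplus>\<^bsub>pow_module M I\<^esub> z)"
        using * mem by (auto simp: pow_module_def M.a_assoc intro!: restrict_ext)
      show "x \<oplus>\<^bsub>pow_module M I\<^esub> y = y \<oplus>\<^bsub>pow_module M I\<^esub> x"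
        using *(1,2) mem by (auto simp: pow_module_def M.a_comm intro!: restrict_ext)
    next
      fix x assume x: "x \<in> carrier (pow_module M I)"
      then have xc: "x \<in> I \<rightarrow>\<^sub>E carrier M" by (simp add: pow_module_def)
      show "\<zero>\<^bsub>pow_module M I\<^esub> \<oplus>\<^bsub>pow_module M I\<^esub> x = x"
      proof (rule extensionalityI)
        show "x \<in> extensional I" using xc by (simp add: PiE_def)
      qed (use xc mem in \<open>auto simp: pow_module_def\<close>)
      show "\<exists>y\<in>carrier (pow_module M I). y \<oplus>\<^bsub>pow_module M I\<^esub> x = \<zero>\<^bsub>pow_module M I\<^esub>"
        by (rule bexI[of _ "\<lambda>i\<in>I. \<ominus>\<^bsub>M\<^esub> x i"])
          (use xc mem in \<open>auto simp: pow_module_def M.l_neg intro!: restrict_ext\<close>)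
    qed (auto simp: pow_module_def)
  next
    fix a b x y assume *: "a \<in> carrier R" "b \<in> carrier R" "x \<in> carrier (pow_module M I)" "y \<in> carrier (pow_module M I)"
    show "(a \<oplus>\<^bsub>R\<^esub> b) \<odot>\<^bsub>pow_module M I\<^esub> x = a \<odot>\<^bsub>pow_module M I\<^esub> x \<oplus>\<^bsub>pow_module M I\<^esub> b \<odot>\<^bsub>pow_module M I\<^esub> x"
      using *(1-3) mem by (auto simp: pow_module_def smult_l_distr intro!: restrict_ext)
    show "a \<odot>\<^bsub>pow_module M I\<^esub> (x \<oplus>\<^bsub>pow_module M I\<^esub> y) = a \<odot>\<^bsub>pow_module M I\<^esub> x \<oplus>\<^bsub>pow_module M I\<^esub> a \<odot>\<^bsub>pow_module M I\<^esub> y"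
      using *(1,3,4) mem by (auto simp: pow_module_def smult_r_distr intro!: restrict_ext)
    show "(a \<otimes>\<^bsub>R\<^esub> b) \<odot>\<^bsub>pow_module M I\<^esub> x = a \<odot>\<^bsub>pow_module M I\<^esub> (b \<odot>\<^bsub>pow_module M I\<^esub> x)"
      using *(1-3) mem by (auto simp: pow_module_def smult_assoc1 intro!: restrict_ext)
    show "a \<odot>\<^bsub>pow_module M I\<^esub> x \<in> carrier (pow_module M I)"
      using *(1,3) mem by (auto simp: pow_module_def)
  next
    fix x assume "x \<in> carrier (pow_module M I)"
    then have xc: "x \<in> I \<rightarrow>\<^sub>E carrier M" by (simp add: pow_module_def)
    show "\<one>\<^bsub>R\<^esub> \<odot>\<^bsub>pow_module M I\<^esub> x = x"
    proof (rule extensionalityI)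
      show "x \<in> extensional I" using xc by (simp add: PiE_def)
    qed (use xc mem in \<open>auto simp: pow_module_def\<close>)
  qed
qed

lemma (in module) submodule_by_closure:
  assumes "N \<subseteq> carrier M" "\<zero>\<^bsub>M\<^esub> \<in> N" "\<And>x y. x \<in> N \<Longrightarrow> y \<in> N \<Longrightarrow> x \<oplus>\<^bsub>M\<^esub> y \<in> N"
    "\<And>a x. a \<in> carrier R \<Longrightarrow> x \<in> N \<Longrightarrow> a \<odot>\<^bsub>M\<^esub> x \<in> N"
  shows "submodule N R M"
proof (rule submoduleI)
  fix x assume x: "x \<in> N"
  then have xc: "x \<in> carrier M" using assms(1) by blast
  have "(\<ominus> \<one>) \<odot>\<^bsub>M\<^esub> x = \<ominus>\<^bsub>M\<^esub> x" using xc by (simp add: smult_l_minus)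
  then show "\<ominus>\<^bsub>M\<^esub> x \<in> N" using assms(4)[OF R.a_inv_closed[OF R.one_closed] x] by (simp only:)
qed (use assms in auto)

section \<open>The socle of a module of type one\<close>

lemma (in ring) finsum_lessThan_one:
  assumes "f (0::nat) \<in> carrier R"
  shows "(\<Oplus>i\<in>{..<1}. f i) = f 0"
proof -
  have "{..<1::nat} = {0}" by auto
  moreover have "(\<Oplus>i\<in>{0}. f i) = f 0 \<oplus> (\<Oplus>i\<in>{}. f i)"
    by (rule finsum_insert) (use assms in simp_all)
  ultimately show ?thesis using assms by simp
qed

text \<open>The supremum of the empty set is \<open>0\<close>, so a nonzero length provides a chain that ends in \<open>A\<close>.\<close>

lemma quot_length_submodule:
  fixes R :: "('a, 'x) ring_scheme" and M :: "('a, 'm) module"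
  assumes "quot_length R M A B \<noteq> 0"
  shows "submodule A R M"
proof (rule ccontr)
  assume "\<not> submodule A R M"
  then have e: "{enat n | n. \<exists>N :: nat \<Rightarrow> 'm set. N 0 = B \<and> N n = A \<and>
      (\<forall>i\<le>n. submodule (N i) R M) \<and> (\<forall>i<n. N i \<subset> N (Suc i))} = {}" by blast
  show False using assms unfolding quot_length_def e by (simp add: bot_enat_def)
qed

text \<open>This turns the definition of the type by \<open>Ext\<^sup>1\<close> of the residue field into the statement that
  \<open>(K : \<mm>)/K\<close> is generated by each of its nonzero elements.  Let the resolution of the residue field
  start with the generators \<open>x\<^sub>j\<close> of \<open>\<mm>\<close>.  Then \<open>u \<mapsto> (x\<^sub>j u)\<^sub>j\<close> embeds \<open>K : \<mm>\<close> into the cocycles of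
  degree \<open>1\<close>, because \<open>\<mm>\<close> contains an element that is invertible in \<open>Q\<close>, and it maps \<open>K\<close> onto the
  coboundaries.  The image of \<open>K + Rw\<close> is strictly larger than the coboundaries, so by
  length one it is everything.\<close>

lemma type_one_socle:
  fixes R :: "('a, 'x) ring_scheme" and Q :: "('q, 'y) ring_scheme" (structure)
  assumes loc: "noeth_local R" and Q: "cring Q" and \<iota>: "\<iota> \<in> ring_hom R Q"
    and KQ: "K \<subseteq> carrier Q" and K0: "\<zero> \<in> K" and Ka: "\<And>x y. x \<in> K \<Longrightarrow> y \<in> K \<Longrightarrow> x \<oplus> y \<in> K"
    and Ks: "\<And>r x. r \<in> carrier R \<Longrightarrow> x \<in> K \<Longrightarrow> \<iota> r \<otimes> x \<in> K"
    and type: "has_type R (restr_module Q \<iota> K) 1" and depth: "depth R (restr_module Q \<iota> K) = enat 1"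
    and s: "s \<in> max_ideal R" "\<iota> s \<in> Units Q"
    and w: "w \<in> carrier Q" "\<And>t. t \<in> max_ideal R \<Longrightarrow> \<iota> t \<otimes> w \<in> K" "w \<notin> K"
    and w': "w' \<in> carrier Q" "\<And>t. t \<in> max_ideal R \<Longrightarrow> \<iota> t \<otimes> w' \<in> K"
  shows "\<exists>t\<in>carrier R. w' \<ominus> \<iota> t \<otimes> w \<in> K"
proof -
  interpret R: noetherian_cring R using noeth_local_cring[OF loc] .
  interpret Q: cring Q by fact
  interpret h: ring_hom_cring R Q \<iota> using \<iota> by (simp add: ring_hom_cring_def ring_hom_cring_axioms_def R.is_cring Q)
  have m: "ideal (max_ideal R) R" using ideal_max_ideal[OF loc] .
  have mc: "t \<in> carrier R" if "t \<in> max_ideal R" for t using ideal_subset[OF m] that by blast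
  have Kc: "u \<in> carrier Q" if "u \<in> K" for u using KQ that by blast
  obtain e b d where res: "free_resolution R (residue_field R) e b d" and b0: "b 0 = 1"
    and gen: "\<And>t. t \<in> max_ideal R \<Longrightarrow> \<exists>y\<in>{..<b 1} \<rightarrow> carrier R. t = (\<Oplus>\<^bsub>R\<^esub>j\<in>{..<b 1}. d 0 0 j \<otimes>\<^bsub>R\<^esub> y j)"
    and xm: "\<And>j. j < b 1 \<Longrightarrow> d 0 0 j \<in> max_ideal R"
    using exists_residue_field_resolution[OF loc] by blast
  have xc: "d 0 0 j \<in> carrier R" if "j < b 1" for j using mc xm that by blast
  have acyc: "acyclic_complex R b d" using res by (simp add: free_resolution_def)
  have dc: "d 1 j i \<in> carrier R" if "j < b 1" "i < b 2" for j i
    using acyc that unfolding acyclic_complex_def by (metis One_nat_def Suc_1)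
  have d2: "(\<Oplus>\<^bsub>R\<^esub>j\<in>{..<b 1}. d 0 0 j \<otimes>\<^bsub>R\<^esub> d 1 j i) = \<zero>\<^bsub>R\<^esub>" if i: "i < b 2" for i
  proof -
    define col where "col = (\<lambda>j\<in>{..<b 1}. d 1 j i)"
    have "mat_act (self_module R) {..<b 1} {..<b 2} (d 1) (\<lambda>j\<in>{..<b 2}. if j = i then \<one>\<^bsub>R\<^esub> else \<zero>\<^bsub>R\<^esub>) = col"
      unfolding col_def by (rule R.mat_act_unit_vector) (use i dc in auto)
    moreover have "(\<lambda>j\<in>{..<b 2}. if j = i then \<one>\<^bsub>R\<^esub> else \<zero>\<^bsub>R\<^esub>) \<in> {..<b 2} \<rightarrow>\<^sub>E carrier R" by auto
    then have "mat_act (self_module R) {..<b 1} {..<b 2} (d 1) (\<lambda>j\<in>{..<b 2}. if j = i then \<one>\<^bsub>R\<^esub> else \<zero>\<^bsub>R\<^esub>)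
        \<in> mat_act (self_module R) {..<b 1} {..<b 2} (d 1) ` ({..<b 2} \<rightarrow>\<^sub>E carrier R)" by (rule imageI)
    ultimately have "col \<in> mat_act (self_module R) {..<b 1} {..<b 2} (d 1) ` ({..<b 2} \<rightarrow>\<^sub>E carrier R)"
      by (simp only:)
    moreover have "{v \<in> {..<b 1} \<rightarrow>\<^sub>E carrier R. mat_act (self_module R) {..<b 0} {..<b 1} (d 0) v = (\<lambda>k\<in>{..<b 0}. \<zero>\<^bsub>R\<^esub>)}
       = mat_act (self_module R) {..<b 1} {..<b 2} (d 1) ` ({..<b 2} \<rightarrow>\<^sub>E carrier R)"
      using acyc[unfolded acyclic_complex_def, THEN conjunct2, rule_format, of 0]
      by (simp only: numeral_2_eq_2 One_nat_def)
    ultimately have col: "col \<in> {..<b 1} \<rightarrow>\<^sub>E carrier R" "mat_act (self_module R) {..<1} {..<b 1} (d 0) col = (\<lambda>k\<in>{..<1}. \<zero>\<^bsub>R\<^esub>)"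
      using b0 by auto
    have "mat_act (self_module R) {..<1} {..<b 1} (d 0) col = (\<lambda>k\<in>{..<1}. \<Oplus>\<^bsub>R\<^esub>j\<in>{..<b 1}. d 0 k j \<otimes>\<^bsub>R\<^esub> col j)"
      by (rule R.mat_act_self_module) (use xc col(1) in auto)
    then have "(\<lambda>k\<in>{..<1}. \<Oplus>\<^bsub>R\<^esub>j\<in>{..<b 1}. d 0 k j \<otimes>\<^bsub>R\<^esub> col j) 0 = (\<lambda>k\<in>{..<1::nat}. \<zero>\<^bsub>R\<^esub>) 0" using col(2) by simp
    then have "(\<Oplus>\<^bsub>R\<^esub>j\<in>{..<b 1}. d 0 0 j \<otimes>\<^bsub>R\<^esub> col j) = \<zero>\<^bsub>R\<^esub>" by simp
    moreover have "(\<Oplus>\<^bsub>R\<^esub>j\<in>{..<b 1}. d 0 0 j \<otimes>\<^bsub>R\<^esub> col j) = (\<Oplus>\<^bsub>R\<^esub>j\<in>{..<b 1}. d 0 0 j \<otimes>\<^bsub>R\<^esub> d 1 j i)"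
      by (rule R.finsum_cong') (use xc dc i in \<open>auto simp: col_def\<close>)
    ultimately show ?thesis by simp
  qed
  define M where "M = restr_module Q \<iota> K"
  define B where "B = coboundaries M b d 1"
  define Z where "Z = cocycles M b d 1"
  define P where "P = pow_module M {..<b 1}"
  have "quot_length R P Z B = enat 1"
    using type depth res unfolding has_type_def ext_length_is_def M_def P_def Z_def B_def by auto
  have Mod: "module R M" unfolding M_def
    by (rule module_restr_module[OF R.is_cring Q \<iota> KQ K0 Ka Ks])
  interpret P: module R P unfolding P_def by (rule module_pow_module[OF Mod])
  have Pcar: "carrier P = {..<b 1} \<rightarrow>\<^sub>E K" by (simp add: P_def pow_module_def M_def restr_module_def)
  have Padd: "u \<oplus>\<^bsub>P\<^esub> v = (\<lambda>j\<in>{..<b 1}. u j \<oplus> v j)" for u v by (simp add: P_def pow_module_def M_def restr_module_def)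
  have Psm: "r \<odot>\<^bsub>P\<^esub> v = (\<lambda>j\<in>{..<b 1}. \<iota> r \<otimes> v j)" for r v by (simp add: P_def pow_module_def M_def restr_module_def)
  have P0: "\<zero>\<^bsub>P\<^esub> = (\<lambda>j\<in>{..<b 1}. \<zero>)" by (simp add: P_def pow_module_def M_def restr_module_def)

  define vec where "vec u = (\<lambda>j\<in>{..<b 1}. \<iota> (d 0 0 j) \<otimes> u)" for u
  have vec_inj: "u = v" if u: "u \<in> carrier Q" and v: "v \<in> carrier Q" and uv: "vec u = vec v" for u v
  proof -
    have "\<iota> t \<otimes> (u \<ominus> v) = \<zero>" if t: "t \<in> max_ideal R" for t
    proof -
      obtain y where y: "y \<in> {..<b 1} \<rightarrow> carrier R" "t = (\<Oplus>\<^bsub>R\<^esub>j\<in>{..<b 1}. d 0 0 j \<otimes>\<^bsub>R\<^esub> y j)" using gen[OF t] by blast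
      have yc: "y j \<in> carrier R" if "j < b 1" for j using y(1) that by auto
      have "\<iota> t = (\<Oplus>j\<in>{..<b 1}. \<iota> (d 0 0 j \<otimes>\<^bsub>R\<^esub> y j))"
        unfolding y(2) using xc yc by (subst h.hom_finsum) (auto simp: comp_def)
      then have "\<iota> t \<otimes> (u \<ominus> v) = (\<Oplus>j\<in>{..<b 1}. \<iota> (d 0 0 j \<otimes>\<^bsub>R\<^esub> y j)) \<otimes> (u \<ominus> v)" by simp
      also have "\<dots> = (\<Oplus>j\<in>{..<b 1}. \<iota> (d 0 0 j \<otimes>\<^bsub>R\<^esub> y j) \<otimes> (u \<ominus> v))"
        by (rule Q.finsum_ldistr) (use xc yc u v in auto)
      also have "\<dots> = (\<Oplus>j\<in>{..<b 1}. \<zero>)"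
      proof (rule Q.finsum_cong')
        fix j assume "j \<in> {..<b 1}"
        then have j: "j < b 1" by simp
        have "vec u j = vec v j" using uv by simp
        then have e: "\<iota> (d 0 0 j) \<otimes> u = \<iota> (d 0 0 j) \<otimes> v" using j by (simp add: vec_def)
        have xq: "\<iota> (d 0 0 j) \<in> carrier Q" and yq: "\<iota> (y j) \<in> carrier Q" using xc[OF j] yc[OF j] by auto
        have "\<iota> (d 0 0 j \<otimes>\<^bsub>R\<^esub> y j) \<otimes> (u \<ominus> v) = \<iota> (y j) \<otimes> (\<iota> (d 0 0 j) \<otimes> u \<ominus> \<iota> (d 0 0 j) \<otimes> v)"
          unfolding h.hom_mult[OF xc[OF j] yc[OF j]] using xq yq u v by algebra
        also have "\<dots> = \<zero>" unfolding e using xq yq v by algebra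
        finally show "\<iota> (d 0 0 j \<otimes>\<^bsub>R\<^esub> y j) \<otimes> (u \<ominus> v) = \<zero>" .
      qed auto
      finally show ?thesis by simp
    qed
    from this[OF s(1)] have "\<iota> s \<otimes> (u \<ominus> v) = \<iota> s \<otimes> \<zero>" using Q.Units_closed[OF s(2)] by simp
    then have uv: "u \<ominus> v = \<zero>" using Q.Units_l_cancel[OF s(2), of "u \<ominus> v" \<zero>] u v by simp
    have "u = (u \<ominus> v) \<oplus> v" using u v by algebra
    then show ?thesis using uv v by simp
  qed
  define S where "S = {u \<in> carrier Q. \<forall>t\<in>max_ideal R. \<iota> t \<otimes> u \<in> K}"
  have KS: "K \<subseteq> S" using Kc Ks mc by (auto simp: S_def)
  have vecP: "vec u \<in> {..<b 1} \<rightarrow>\<^sub>E K" if "u \<in> S" for u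
    unfolding vec_def restrict_PiE_iff using that xm by (auto simp: S_def)
  have vec_sub: "submodule (vec ` U) R P"
    if U: "U \<subseteq> S" "\<zero> \<in> U" "\<And>u v. u \<in> U \<Longrightarrow> v \<in> U \<Longrightarrow> u \<oplus> v \<in> U" "\<And>r u. r \<in> carrier R \<Longrightarrow> u \<in> U \<Longrightarrow> \<iota> r \<otimes> u \<in> U" for U
  proof (rule P.submodule_by_closure)
    have Uc: "u \<in> carrier Q" if "u \<in> U" for u using U(1) that by (auto simp: S_def)
    show "vec ` U \<subseteq> carrier P" using U(1) vecP unfolding Pcar by blast
    have "vec \<zero> = \<zero>\<^bsub>P\<^esub>" unfolding P0 vec_def by (rule restrict_ext) (use xc in auto)
    then show "\<zero>\<^bsub>P\<^esub> \<in> vec ` U" using imageI[OF U(2), of vec] by (simp only:)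
    fix a assume "a \<in> vec ` U"
    then obtain u where u: "a = vec u" "u \<in> U" by blast
    show "a \<oplus>\<^bsub>P\<^esub> c \<in> vec ` U" if "c \<in> vec ` U" for c
    proof -
      obtain v where v: "c = vec v" "v \<in> U" using \<open>c \<in> vec ` U\<close> by blast
      have "a \<oplus>\<^bsub>P\<^esub> c = vec (u \<oplus> v)" unfolding u(1) v(1) Padd vec_def
        by (rule restrict_ext) (use xc Uc[OF u(2)] Uc[OF v(2)] in \<open>auto simp: Q.r_distr\<close>)
      then show ?thesis using imageI[OF U(3)[OF u(2) v(2)], of vec] by (simp only:)
    qed
    show "r \<odot>\<^bsub>P\<^esub> a \<in> vec ` U" if r: "r \<in> carrier R" for r
    proof -
      have "r \<odot>\<^bsub>P\<^esub> a = vec (\<iota> r \<otimes> u)" unfolding u(1) Psm vec_def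
        by (rule restrict_ext) (use xc Uc[OF u(2)] r in \<open>auto simp: Q.m_lcomm\<close>)
      then show ?thesis using imageI[OF U(4)[OF r u(2)], of vec] by (simp only:)
    qed
  qed
  have B: "B = vec ` K"
  proof -
    have act: "coboundary_map M b d 0 y = vec (y 0)" if y: "y \<in> {..<1} \<rightarrow>\<^sub>E K" for y
    proof -
      have y0: "y 0 \<in> K" using y by auto
      have "coboundary_map M b d 0 y = (\<lambda>j\<in>{..<b 1}. \<Oplus>\<^bsub>M\<^esub>k\<in>{..<1}. \<iota> (d 0 k j) \<otimes> y k)"
        unfolding coboundary_map_def mat_act_def b0 M_def by (simp add: restr_module_def)
      also have "\<dots> = vec (y 0)" unfolding vec_def
      proof (rule restrict_ext)
        fix j assume "j \<in> {..<b 1}"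
        then have j: "j < b 1" by simp
        have k0: "\<iota> (d 0 k j) \<otimes> y k \<in> K" if "k \<in> {..<1}" for k using Ks[OF xc[OF j] y0] that by simp
        have "(\<Oplus>\<^bsub>M\<^esub>k\<in>{..<1}. \<iota> (d 0 k j) \<otimes> y k) = (\<Oplus>k\<in>{..<1}. \<iota> (d 0 k j) \<otimes> y k)"
          unfolding M_def by (rule Q.finsum_restr_module) (use KQ K0 Ka k0 in auto)
        also have "\<dots> = \<iota> (d 0 0 j) \<otimes> y 0"
          by (rule Q.finsum_lessThan_one) (use Kc k0 in auto)
        finally show "(\<Oplus>\<^bsub>M\<^esub>k\<in>{..<1}. \<iota> (d 0 k j) \<otimes> y k) = \<iota> (d 0 0 j) \<otimes> y 0" .
      qed
      finally show ?thesis .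
    qed
    have "B = coboundary_map M b d 0 ` ({..<1} \<rightarrow>\<^sub>E K)"
    proof -
      have "carrier M = K" by (simp add: M_def restr_module_def)
      then show ?thesis unfolding B_def coboundaries_def using b0 by simp
    qed
    also have "\<dots> = vec ` K"
    proof
      show "coboundary_map M b d 0 ` ({..<1} \<rightarrow>\<^sub>E K) \<subseteq> vec ` K" using act by auto
      show "vec ` K \<subseteq> coboundary_map M b d 0 ` ({..<1} \<rightarrow>\<^sub>E K)"
      proof
        fix v assume "v \<in> vec ` K"
        then obtain u where u: "u \<in> K" "v = vec u" by blast
        have y: "(\<lambda>i\<in>{..<1::nat}. u) \<in> {..<1} \<rightarrow>\<^sub>E K" using u by auto
        have "v = coboundary_map M b d 0 (\<lambda>i\<in>{..<1::nat}. u)" unfolding act[OF y] u(2) by simp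
        then show "v \<in> coboundary_map M b d 0 ` ({..<1} \<rightarrow>\<^sub>E K)" using y by blast
      qed
    qed
    finally show ?thesis .
  qed
  have Zmem: "y \<in> Z \<longleftrightarrow> y \<in> {..<b 1} \<rightarrow>\<^sub>E K \<and> (\<forall>i<b 2. (\<Oplus>j\<in>{..<b 1}. \<iota> (d 1 j i) \<otimes> y j) = \<zero>)" for y
  proof (cases "y \<in> {..<b 1} \<rightarrow>\<^sub>E K")
    case True
    have "coboundary_map M b d 1 y = (\<lambda>i\<in>{..<b 2}. \<Oplus>\<^bsub>M\<^esub>j\<in>{..<b 1}. \<iota> (d 1 j i) \<otimes> y j)"
      unfolding coboundary_map_def mat_act_def M_def by (simp add: restr_module_def numeral_2_eq_2)
    also have "\<dots> = (\<lambda>i\<in>{..<b 2}. \<Oplus>j\<in>{..<b 1}. \<iota> (d 1 j i) \<otimes> y j)"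
    proof (rule restrict_ext)
      fix i assume i: "i \<in> {..<b 2}"
      show "(\<Oplus>\<^bsub>M\<^esub>j\<in>{..<b 1}. \<iota> (d 1 j i) \<otimes> y j) = (\<Oplus>j\<in>{..<b 1}. \<iota> (d 1 j i) \<otimes> y j)"
        unfolding M_def
      proof (rule Q.finsum_restr_module[OF KQ K0 Ka finite_lessThan], assumption, assumption)
        show "(\<lambda>j. \<iota> (d 1 j i) \<otimes> y j) \<in> {..<b 1} \<rightarrow> K"
          by (rule Pi_I) (use i in \<open>blast intro: Ks dc PiE_mem[OF True]\<close>)
      qed
    qed
    finally have cob: "coboundary_map M b d 1 y = (\<lambda>i\<in>{..<b 2}. \<Oplus>j\<in>{..<b 1}. \<iota> (d 1 j i) \<otimes> y j)" .
    have "(\<lambda>i\<in>{..<b 2}. \<Oplus>j\<in>{..<b 1}. \<iota> (d 1 j i) \<otimes> y j) = (\<lambda>i\<in>{..<b 2}. \<zero>)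
      \<longleftrightarrow> (\<forall>i<b 2. (\<Oplus>j\<in>{..<b 1}. \<iota> (d 1 j i) \<otimes> y j) = \<zero>)"
      unfolding restrict_def fun_eq_iff by auto
    then show ?thesis using True cob
      unfolding Z_def cocycles_def by (simp add: M_def restr_module_def numeral_2_eq_2)
  next
    case False
    then show ?thesis unfolding Z_def cocycles_def by (simp add: M_def restr_module_def)
  qed
  have Z: "submodule Z R P"
    by (rule quot_length_submodule[of R P Z B]) (simp add: \<open>quot_length R P Z B = enat 1\<close> zero_enat_def)
  have vecZ: "vec u \<in> Z" if u: "u \<in> S" for u
  proof -
    have uc: "u \<in> carrier Q" using u by (simp add: S_def)
    have "(\<Oplus>j\<in>{..<b 1}. \<iota> (d 1 j i) \<otimes> vec u j) = \<zero>" if i: "i < b 2" for i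
    proof -
      have "(\<Oplus>j\<in>{..<b 1}. \<iota> (d 1 j i) \<otimes> vec u j) = (\<Oplus>j\<in>{..<b 1}. \<iota> (d 0 0 j \<otimes>\<^bsub>R\<^esub> d 1 j i) \<otimes> u)"
        by (rule Q.finsum_cong') (use xc dc i uc in \<open>auto simp: vec_def Q.m_assoc Q.m_lcomm\<close>)
      also have "\<dots> = (\<Oplus>j\<in>{..<b 1}. \<iota> (d 0 0 j \<otimes>\<^bsub>R\<^esub> d 1 j i)) \<otimes> u"
        by (rule Q.finsum_ldistr[symmetric]) (use xc dc i uc in auto)
      also have "(\<Oplus>j\<in>{..<b 1}. \<iota> (d 0 0 j \<otimes>\<^bsub>R\<^esub> d 1 j i)) = \<iota> (\<Oplus>\<^bsub>R\<^esub>j\<in>{..<b 1}. d 0 0 j \<otimes>\<^bsub>R\<^esub> d 1 j i)"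
        using xc dc i by (subst h.hom_finsum) (auto simp: comp_def)
      finally show ?thesis using d2[OF i] uc by simp
    qed
    then show ?thesis unfolding Zmem using vecP[OF u] by blast
  qed
  define N where "N = {\<iota> t \<otimes> w \<oplus> y | t y. t \<in> carrier R \<and> y \<in> K}"
  have N: "\<iota> t \<otimes> w \<oplus> y \<in> N" if "t \<in> carrier R" "y \<in> K" for t y using that by (auto simp: N_def)
  have wS: "w \<in> S" using w by (simp add: S_def)
  have w'S: "w' \<in> S" using w' by (simp add: S_def)
  have Ssm: "\<iota> r \<otimes> u \<in> S" if "r \<in> carrier R" "u \<in> S" for r u
  proof -
    have uc: "u \<in> carrier Q" using that by (simp add: S_def)
    have "\<iota> t \<otimes> (\<iota> r \<otimes> u) \<in> K" if t: "t \<in> max_ideal R" for t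
    proof -
      have "\<iota> t \<otimes> (\<iota> r \<otimes> u) = \<iota> r \<otimes> (\<iota> t \<otimes> u)"
        by (rule Q.m_lcomm) (use mc[OF t] \<open>r \<in> carrier R\<close> uc in auto)
      then show ?thesis using Ks[OF \<open>r \<in> carrier R\<close>] t \<open>u \<in> S\<close> by (simp add: S_def)
    qed
    then show ?thesis using \<open>r \<in> carrier R\<close> uc by (simp add: S_def)
  qed
  have Sadd: "u \<oplus> v \<in> S" if "u \<in> S" "v \<in> S" for u v
    using that Ka mc by (auto simp: S_def Q.r_distr)
  have NS: "N \<subseteq> S" using Sadd[OF Ssm[OF _ wS]] KS unfolding N_def by blast
  have NK: "K \<subseteq> N"
  proof
    fix y assume y: "y \<in> K"
    have "\<iota> \<zero>\<^bsub>R\<^esub> \<otimes> w \<oplus> y = y" using w(1) Kc[OF y] by simp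
    then show "y \<in> N" using N[OF R.zero_closed y] by simp
  qed
  have Nsub: "submodule (vec ` N) R P"
  proof (rule vec_sub[OF NS])
    show "\<zero> \<in> N" using NK K0 by blast
    fix u assume "u \<in> N"
    then obtain t y where u: "u = \<iota> t \<otimes> w \<oplus> y" "t \<in> carrier R" "y \<in> K" by (auto simp: N_def)
    show "u \<oplus> v \<in> N" if "v \<in> N" for v
    proof -
      obtain t' y' where v: "v = \<iota> t' \<otimes> w \<oplus> y'" "t' \<in> carrier R" "y' \<in> K" using \<open>v \<in> N\<close> by (auto simp: N_def)
      have c: "\<iota> t \<in> carrier Q" "\<iota> t' \<in> carrier Q" "y \<in> carrier Q" "y' \<in> carrier Q" using u v Kc by auto
      have "u \<oplus> v = \<iota> (t \<oplus>\<^bsub>R\<^esub> t') \<otimes> w \<oplus> (y \<oplus> y')" unfolding u v h.hom_add[OF u(2) v(2)] using c w(1) by algebra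
      then show ?thesis using N[OF R.a_closed[OF u(2) v(2)] Ka[OF u(3) v(3)]] by simp
    qed
    show "\<iota> r \<otimes> u \<in> N" if r: "r \<in> carrier R" for r
    proof -
      have c: "\<iota> t \<in> carrier Q" "\<iota> r \<in> carrier Q" "y \<in> carrier Q" using u r Kc by auto
      have "\<iota> r \<otimes> u = \<iota> (r \<otimes>\<^bsub>R\<^esub> t) \<otimes> w \<oplus> \<iota> r \<otimes> y" unfolding u h.hom_mult[OF r u(2)] using c w(1) by algebra
      then show ?thesis using N[OF R.m_closed[OF r u(2)] Ks[OF r u(3)]] by simp
    qed
  qed
  have wN: "w \<in> N"
  proof -
    have "\<iota> \<one>\<^bsub>R\<^esub> \<otimes> w \<oplus> \<zero> = w" using w(1) by simp
    then show ?thesis using N[OF R.one_closed K0] by simp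
  qed
  have "vec ` N = Z"
  proof (rule ccontr)
    assume ne: "vec ` N \<noteq> Z"
    (* A chain of length two from the coboundaries to the cocycles. *)
    define F where "F i = (if i = 0 then B else if i = 1 then vec ` N else Z)" for i :: nat
    have "vec w \<notin> B" unfolding B using vec_inj[OF w(1)] w(3) Kc by blast
    then have "B \<subset> vec ` N" using NK wN unfolding B by blast
    moreover have "vec ` N \<subset> Z" using ne vecZ NS by blast
    ultimately have step: "F i \<subset> F (Suc i)" if "i < 2" for i using that by (auto simp: F_def less_2_cases_iff)
    have "submodule (F i) R P" for i
      using vec_sub[OF KS K0 Ka Ks] Nsub Z by (simp add: F_def B)
    then have "enat 2 \<in> {enat n | n. \<exists>N :: nat \<Rightarrow> (nat \<Rightarrow> 'q) set. N 0 = B \<and> N n = Z \<and>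
        (\<forall>i\<le>n. submodule (N i) R P) \<and> (\<forall>i<n. N i \<subset> N (Suc i))}"
      using step by (intro CollectI exI[of _ 2] conjI exI[of _ F]) (auto simp: F_def)
    then have "enat 2 \<le> quot_length R P Z B" unfolding quot_length_def by (rule Sup_upper)
    then show False using \<open>quot_length R P Z B = enat 1\<close> by simp
  qed
  then have "vec w' \<in> vec ` N" using vecZ[OF w'S] by simp
  then obtain v where v: "v \<in> N" "vec w' = vec v" by blast
  have "w' = v" using vec_inj[OF w'(1) _ v(2)] v(1) NS by (auto simp: S_def)
  then obtain t y where t: "w' = \<iota> t \<otimes> w \<oplus> y" "t \<in> carrier R" "y \<in> K" using v(1) by (auto simp: N_def)
  have c: "\<iota> t \<in> carrier Q" "y \<in> carrier Q" using t Kc by auto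
  have "w' \<ominus> \<iota> t \<otimes> w = y" unfolding t(1) using c w(1) by algebra
  then show ?thesis using t by blast
qed

section \<open>Duality into a module of type one\<close>

text \<open>\<open>Q\<close> is regarded as a \<open>T\<close>-algebra through \<open>h\<close>, so that the image of \<open>h\<close> plays the role of \<open>R\<close>;
  in this way ideals and units are taken in \<open>T\<close> and no quotient has to be mentioned.\<close>

locale type_one_submodule = T: noetherian_cring T + h: ring_hom_cring T Q h
  for T :: "('t, 'x) ring_scheme" and Q :: "('q, 'y) ring_scheme" (structure) and h +
  fixes \<mm> :: "'t set" and K :: "'q set"
  assumes m_ideal: "ideal \<mm> T"
    and K_carrier: "K \<subseteq> carrier Q"
    and K_one: "\<one> \<in> K"
    and K_add: "u \<in> K \<Longrightarrow> v \<in> K \<Longrightarrow> u \<oplus> v \<in> K"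
    and K_smult: "t \<in> carrier T \<Longrightarrow> u \<in> K \<Longrightarrow> h t \<otimes> u \<in> K"
    and socle: "w \<in> carrier Q \<Longrightarrow> (\<And>t. t \<in> \<mm> \<Longrightarrow> h t \<otimes> w \<in> K) \<Longrightarrow> w \<notin> K \<Longrightarrow>
      w' \<in> carrier Q \<Longrightarrow> (\<And>t. t \<in> \<mm> \<Longrightarrow> h t \<otimes> w' \<in> K) \<Longrightarrow> \<exists>t\<in>carrier T. w' \<ominus> h t \<otimes> w \<in> K"
begin

lemma K_closed: "u \<in> K \<Longrightarrow> u \<in> carrier Q"
  using K_carrier by blast

lemma m_closed': "t \<in> \<mm> \<Longrightarrow> t \<in> carrier T"
  using ideal_subset[OF m_ideal] by blast

lemma K_zero: "\<zero> \<in> K"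
  using K_smult[OF T.zero_closed K_one] by simp

lemma K_neg: "u \<in> K \<Longrightarrow> \<ominus> u \<in> K"
  using K_smult[of "\<ominus>\<^bsub>T\<^esub> \<one>\<^bsub>T\<^esub>" u] K_closed[of u] by (simp add: h.S.l_minus)

lemma K_minus: "u \<in> K \<Longrightarrow> v \<in> K \<Longrightarrow> u \<ominus> v \<in> K"
  unfolding a_minus_def by (intro K_add K_neg)

text \<open>The fractional ideal \<open>K : I\<close>; for an ideal \<open>I\<close> that contains a regular element it is
  \<open>Hom(I, K)\<close>.\<close>

definition dual :: "'t set \<Rightarrow> 'q set" where
  "dual I = {u \<in> carrier Q. \<forall>t\<in>I. h t \<otimes> u \<in> K}"

definition reflexive :: "'t set \<Rightarrow> bool" where
  "reflexive I \<longleftrightarrow> (\<forall>z\<in>carrier Q. (\<forall>u\<in>dual I. z \<otimes> u \<in> K) \<longrightarrow> z \<in> h ` I)"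

lemma dualD: "u \<in> dual I \<Longrightarrow> u \<in> carrier Q" "u \<in> dual I \<Longrightarrow> t \<in> I \<Longrightarrow> h t \<otimes> u \<in> K"
  by (auto simp: dual_def)

lemma reflexiveD: "reflexive I \<Longrightarrow> z \<in> carrier Q \<Longrightarrow> (\<And>u. u \<in> dual I \<Longrightarrow> z \<otimes> u \<in> K) \<Longrightarrow> z \<in> h ` I"
  by (simp add: reflexive_def)

lemma dual_adjoinI:
  assumes M: "ideal M T" and y: "y \<in> carrier T" and u: "u \<in> dual M" "h y \<otimes> u \<in> K"
  shows "u \<in> dual (adjoin T M y)"
proof -
  have uc: "u \<in> carrier Q" by (rule dualD(1)[OF u(1)])
  have "h t \<otimes> u \<in> K" if "t \<in> adjoin T M y" for t
  proof -
    obtain i r where t: "t = i \<oplus>\<^bsub>T\<^esub> r \<otimes>\<^bsub>T\<^esub> y" "i \<in> M" "r \<in> carrier T" using \<open>t \<in> adjoin T M y\<close> unfolding adjoin_def by blast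
    have i: "i \<in> carrier T" using t(2) ideal_subset[OF M] by blast
    have c: "h i \<in> carrier Q" "h r \<in> carrier Q" "h y \<in> carrier Q" using i t(3) y by auto
    have "h t = h i \<oplus> h r \<otimes> h y" unfolding t(1) using i t(3) y by simp
    then have "h t \<otimes> u = h i \<otimes> u \<oplus> h r \<otimes> (h y \<otimes> u)" using c uc by (simp add: h.S.l_distr h.S.m_assoc)
    then show ?thesis using K_add[OF dualD(2)[OF u(1) t(2)] K_smult[OF t(3) u(2)]] by simp
  qed
  then show ?thesis using uc by (simp add: dual_def)
qed

lemma dual_smult:
  assumes "M \<subseteq> carrier T" "u \<in> dual M" "t \<in> carrier T"
  shows "h t \<otimes> u \<in> dual M"
proof -
  have uc: "u \<in> carrier Q" by (rule dualD(1)[OF assms(2)])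
  have "h s \<otimes> (h t \<otimes> u) \<in> K" if s: "s \<in> M" for s
  proof -
    have "h s \<otimes> (h t \<otimes> u) = h t \<otimes> (h s \<otimes> u)"
      by (rule h.S.m_lcomm) (use s assms uc in auto)
    then show ?thesis using K_smult[OF assms(3) dualD(2)[OF assms(2) s]] by simp
  qed
  then show ?thesis using uc assms(3) by (simp add: dual_def)
qed

lemma dual_add: "M \<subseteq> carrier T \<Longrightarrow> u \<in> dual M \<Longrightarrow> v \<in> dual M \<Longrightarrow> u \<oplus> v \<in> dual M"
  using K_add unfolding dual_def by (auto simp: h.S.r_distr subset_iff)

text \<open>Let \<open>L = M + Ty\<close> with \<open>\<mm>y \<subseteq> M\<close>.  By type one \<open>K : M\<close> exceeds \<open>K : L\<close> by at most one socle
  generator \<open>u\<close>.  If \<open>z\<close> multiplies \<open>K : L\<close> into \<open>K\<close>, then \<open>zu\<close> and \<open>yu\<close> are both killed by \<open>\<mm>\<close>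
  modulo \<open>K\<close>, so \<open>z - \<rho>y\<close> multiplies \<open>u\<close>, and then all of \<open>K : M\<close>, into \<open>K\<close> for a suitable \<open>\<rho>\<close>.
  Reflexivity of \<open>M\<close> gives \<open>z - \<rho>y \<in> M\<close>.\<close>

lemma reflexive_socle_step:
  assumes M: "ideal M T" "reflexive M" and y: "y \<in> carrier T" and my: "\<And>t. t \<in> \<mm> \<Longrightarrow> t \<otimes>\<^bsub>T\<^esub> y \<in> M"
  shows "reflexive (adjoin T M y)"
  unfolding reflexive_def
proof (intro ballI impI)
  define L where "L = adjoin T M y"
  note Mc = ideal_subset[OF M(1)]
  have sub: "M \<subseteq> L" unfolding L_def by (rule T.adjoin_superset[OF M(1) y])
  have hy: "h y \<in> carrier Q" using y by simp
  fix z assume z: "z \<in> carrier Q" and "\<forall>u\<in>dual (adjoin T M y). z \<otimes> u \<in> K"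
  then have zL: "z \<otimes> u \<in> K" if "u \<in> dual L" for u using that by (simp add: L_def)
  have intoL: "u \<in> dual L" if "u \<in> dual M" "h y \<otimes> u \<in> K" for u
    unfolding L_def by (rule dual_adjoinI[OF M(1) y that])
  have y_kills: "h t \<otimes> (h y \<otimes> u) \<in> K" if u: "u \<in> dual M" and t: "t \<in> \<mm>" for t u
  proof -
    have "h t \<otimes> (h y \<otimes> u) = h (t \<otimes>\<^bsub>T\<^esub> y) \<otimes> u" using m_closed'[OF t] y dualD(1)[OF u] by (simp add: h.S.m_assoc)
    then show ?thesis using dualD(2)[OF u my[OF t]] by simp
  qed
  show "z \<in> h ` adjoin T M y"
  proof (cases "\<forall>u\<in>dual M. h y \<otimes> u \<in> K")
    case True
    then have "z \<otimes> u \<in> K" if "u \<in> dual M" for u using zL[OF intoL[OF that]] that by blast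
    then have "z \<in> h ` M" by (rule reflexiveD[OF M(2) z])
    then show ?thesis using image_mono[OF sub, of h] unfolding L_def by (rule set_rev_mp)
  next
    case False
    then obtain u where u: "u \<in> dual M" "h y \<otimes> u \<notin> K" by blast
    have uc: "u \<in> carrier Q" by (rule dualD(1)[OF u(1)])
    have "h t \<otimes> (z \<otimes> u) \<in> K" if t: "t \<in> \<mm>" for t
    proof -
      have tc: "t \<in> carrier T" by (rule m_closed'[OF t])
      have "h y \<otimes> (h t \<otimes> u) = h t \<otimes> (h y \<otimes> u)" by (rule h.S.m_lcomm) (use tc hy uc in auto)
      then have "h t \<otimes> u \<in> dual L" using intoL[OF dual_smult[OF Mc u(1) tc]] y_kills[OF u(1) t] by simp
      moreover have "h t \<otimes> (z \<otimes> u) = z \<otimes> (h t \<otimes> u)" by (rule h.S.m_lcomm) (use tc z uc in auto)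
      ultimately show ?thesis using zL by simp
    qed
    then obtain \<rho> where \<rho>: "\<rho> \<in> carrier T" "z \<otimes> u \<ominus> h \<rho> \<otimes> (h y \<otimes> u) \<in> K"
      using socle[OF h.S.m_closed[OF hy uc] y_kills[OF u(1)] u(2) h.S.m_closed[OF z uc]] by blast
    have h\<rho>: "h \<rho> \<in> carrier Q" using \<rho> by simp
    define z' where "z' = z \<ominus> h \<rho> \<otimes> h y"
    have z': "z' \<in> carrier Q" using z h\<rho> hy by (simp add: z'_def)
    have z'u: "z' \<otimes> u \<in> K"
    proof -
      have "z' \<otimes> u = z \<otimes> u \<ominus> h \<rho> \<otimes> (h y \<otimes> u)" unfolding z'_def using z h\<rho> hy uc by algebra
      then show ?thesis using \<rho>(2) by simp
    qed
    have "z' \<in> h ` M"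
    proof (rule reflexiveD[OF M(2) z'])
      fix v assume v: "v \<in> dual M"
      have vc: "v \<in> carrier Q" by (rule dualD(1)[OF v])
      obtain \<sigma> where \<sigma>: "\<sigma> \<in> carrier T" "h y \<otimes> v \<ominus> h \<sigma> \<otimes> (h y \<otimes> u) \<in> K"
        using socle[OF h.S.m_closed[OF hy uc] y_kills[OF u(1)] u(2) h.S.m_closed[OF hy vc] y_kills[OF v]] by blast
      have h\<sigma>: "h \<sigma> \<in> carrier Q" using \<sigma> by simp
      define v' where "v' = v \<oplus> h (\<ominus>\<^bsub>T\<^esub> \<sigma>) \<otimes> u"
      have v'c: "v' \<in> carrier Q" using vc uc \<sigma>(1) by (simp add: v'_def)
      have hn: "h (\<ominus>\<^bsub>T\<^esub> \<sigma>) = \<ominus> h \<sigma>" using \<sigma>(1) by simp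
      have "v' \<in> dual M" unfolding v'_def
        by (rule dual_add[OF Mc v dual_smult[OF Mc u(1)]]) (use \<sigma>(1) in simp)
      moreover have "h y \<otimes> v' = h y \<otimes> v \<ominus> h \<sigma> \<otimes> (h y \<otimes> u)"
        unfolding v'_def hn using h\<sigma> hy uc vc by algebra
      then have hyv': "h y \<otimes> v' \<in> K" using \<sigma>(2) by simp
      ultimately have "z \<otimes> v' \<in> K" using zL intoL by blast
      moreover have "z' \<otimes> v' = z \<otimes> v' \<ominus> h \<rho> \<otimes> (h y \<otimes> v')" unfolding z'_def using z h\<rho> hy v'c by algebra
      ultimately have "z' \<otimes> v' \<in> K" using K_minus K_smult[OF \<rho>(1) hyv'] by simp
      moreover have "z' \<otimes> v = z' \<otimes> v' \<oplus> h \<sigma> \<otimes> (z' \<otimes> u)" unfolding v'_def hn using z' h\<sigma> vc uc by algebra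
      ultimately show "z' \<otimes> v \<in> K" using K_add K_smult[OF \<sigma>(1) z'u] by simp
    qed
    then obtain i where i: "i \<in> M" "z' = h i" by blast
    have ic: "i \<in> carrier T" using i Mc by blast
    have "z = z' \<oplus> h \<rho> \<otimes> h y" unfolding z'_def using z h\<rho> hy by algebra
    then have "z = h (i \<oplus>\<^bsub>T\<^esub> \<rho> \<otimes>\<^bsub>T\<^esub> y)" using i ic \<rho>(1) y by simp
    then show ?thesis using i(1) \<rho>(1) unfolding adjoin_def by blast
  qed
qed

text \<open>\<open>K : K = R\<close> for a canonical ideal, obtained from type one.  The ideal \<open>xK\<close> is reflexive,
  because its dual contains \<open>x\<^sup>-\<^sup>1\<close>.  A maximal reflexive ideal above it is the whole ring, since
  otherwise a socle element could be added to it; and reflexivity of the whole ring is the claim.\<close>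

theorem endomorphisms_trivial:
  assumes x: "x \<in> carrier T" "h x \<in> Units Q" and xK: "\<And>u. u \<in> K \<Longrightarrow> h x \<otimes> u \<in> h ` carrier T"
    and nil: "\<And>t. t \<in> \<mm> \<Longrightarrow> \<exists>k::nat. \<exists>u\<in>K. h (t [^]\<^bsub>T\<^esub> k) = h x \<otimes> u"
    and z: "z \<in> carrier Q" "\<And>u. u \<in> K \<Longrightarrow> z \<otimes> u \<in> K"
  shows "z \<in> h ` carrier T"
proof -
  (* The preimage of xK in T. *)
  define I where "I = {t \<in> carrier T. \<exists>u\<in>K. h t = h x \<otimes> u}"
  have hx: "h x \<in> carrier Q" using x(1) by simp
  have I: "ideal I T"
  proof (rule T.idealI_comm)
    show "I \<subseteq> carrier T" by (auto simp: I_def)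
    have "h \<zero>\<^bsub>T\<^esub> = h x \<otimes> \<zero>" using hx by simp
    then show "\<zero>\<^bsub>T\<^esub> \<in> I" using K_zero unfolding I_def by blast
    fix a assume "a \<in> I"
    then obtain u where u: "a \<in> carrier T" "u \<in> K" "h a = h x \<otimes> u" by (auto simp: I_def)
    show "a \<oplus>\<^bsub>T\<^esub> b \<in> I" if "b \<in> I" for b
    proof -
      obtain v where v: "b \<in> carrier T" "v \<in> K" "h b = h x \<otimes> v" using \<open>b \<in> I\<close> by (auto simp: I_def)
      have "h (a \<oplus>\<^bsub>T\<^esub> b) = h x \<otimes> (u \<oplus> v)" using u v hx K_closed by (simp add: h.S.r_distr)
      then show ?thesis using K_add[OF u(2) v(2)] u(1) v(1) unfolding I_def by blast
    qed
    show "r \<otimes>\<^bsub>T\<^esub> a \<in> I" if r: "r \<in> carrier T" for r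
    proof -
      have "h (r \<otimes>\<^bsub>T\<^esub> a) = h x \<otimes> (h r \<otimes> u)" using u r hx K_closed by (simp add: h.S.m_lcomm)
      then show ?thesis using K_smult[OF r u(2)] u(1) r unfolding I_def by blast
    qed
  qed
  have "reflexive I"
    unfolding reflexive_def
  proof (intro ballI impI)
    fix z assume z: "z \<in> carrier Q" "\<forall>u\<in>dual I. z \<otimes> u \<in> K"
    have ix: "inv (h x) \<in> carrier Q" "h x \<otimes> inv (h x) = \<one>" using x(2) by auto
    have "inv (h x) \<in> dual I"
    proof -
      have "h t \<otimes> inv (h x) \<in> K" if "t \<in> I" for t
      proof -
        obtain u where u: "u \<in> K" "h t = h x \<otimes> u" using \<open>t \<in> I\<close> by (auto simp: I_def)
        have uc: "u \<in> carrier Q" by (rule K_closed[OF u(1)])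
        have "h t \<otimes> inv (h x) = u \<otimes> (h x \<otimes> inv (h x))" unfolding u(2) using hx ix(1) uc by algebra
        then show ?thesis using u(1) uc ix(2) by simp
      qed
      then show ?thesis using ix(1) by (simp add: dual_def)
    qed
    then have v: "z \<otimes> inv (h x) \<in> K" using z(2) by blast
    have "h x \<otimes> (z \<otimes> inv (h x)) = z \<otimes> (h x \<otimes> inv (h x))" by (rule h.S.m_lcomm) (use hx z ix in auto)
    then have e: "h x \<otimes> (z \<otimes> inv (h x)) = z" using ix(2) z by simp
    obtain t where "t \<in> carrier T" "z = h t" using xK[OF v] e by auto
    then show "z \<in> h ` I" using v e unfolding I_def by force
  qed
  define C where "C = {L. ideal L T \<and> I \<subseteq> L \<and> reflexive L}"
  have "I \<in> C" using I \<open>reflexive I\<close> by (simp add: C_def)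
  then have "C \<noteq> {}" by blast
  then obtain M where M: "M \<in> C" and max: "\<And>L. L \<in> C \<Longrightarrow> M \<subseteq> L \<Longrightarrow> L = M"
    by (rule T.exists_maximal) (auto simp: C_def)
  have Mp: "ideal M T" "I \<subseteq> M" "reflexive M" using M by (auto simp: C_def)
  have "M = carrier T"
  proof (rule ccontr)
    assume ne: "M \<noteq> carrier T"
    have "t \<in> carrier T \<and> (\<exists>k::nat. t [^]\<^bsub>T\<^esub> k \<in> M)" if t: "t \<in> \<mm>" for t
      using nil[OF t] m_closed'[OF t] Mp(2) unfolding I_def by blast
    then obtain y where y: "y \<in> carrier T" "y \<notin> M" "\<And>t. t \<in> \<mm> \<Longrightarrow> t \<otimes>\<^bsub>T\<^esub> y \<in> M"
      using T.exists_socle_step[OF Mp(1) ne, of \<mm>] by metis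
    have "adjoin T M y \<in> C"
      using T.ideal_adjoin[OF Mp(1) y(1)] T.adjoin_superset[OF Mp(1) y(1)] Mp(2)
        reflexive_socle_step[OF Mp(1,3) y(1,3)] by (auto simp: C_def)
    then have "adjoin T M y = M" by (rule max) (rule T.adjoin_superset[OF Mp(1) y(1)])
    then show False using T.adjoin_self[OF Mp(1) y(1)] y(2) by simp
  qed
  then have refl: "reflexive (carrier T)" using Mp(3) by simp
  show ?thesis
  proof (rule reflexiveD[OF refl z(1)])
    fix u assume u: "u \<in> dual (carrier T)"
    have "h \<one>\<^bsub>T\<^esub> \<otimes> u \<in> K" by (rule dualD(2)[OF u T.one_closed])
    then show "z \<otimes> u \<in> K" using z(2) dualD(1)[OF u] by simp
  qed
qed

end

section \<open>The square of a fractional ideal with uniserial conductor\<close>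

text \<open>The conductor of \<open>R\<close> in \<open>R[K]\<close> will be the image of \<open>J = Y + (x\<^sup>n)\<close>, and \<open>T/J\<close> is uniserial, because
  \<open>\<mm> = Y + (x)\<close>.  Of the presentation of \<open>K\<close> only two consequences are kept: \<open>J K \<subseteq> J\<close>, and
  \<open>x\<^sup>n\<^sup>-\<^sup>1\<close> does not multiply \<open>K\<close> into \<open>R\<close>.\<close>

locale uniserial_conductor = type_one_submodule T Q h \<mm> K
  for T :: "('t, 'x) ring_scheme" and Q :: "('q, 'y) ring_scheme" (structure) and h \<mm> K +
  fixes Y :: "'t set" and x :: 't and n :: nat
  assumes Y_ideal: "ideal Y T" and x_closed: "x \<in> carrier T" and m_eq: "\<mm> = adjoin T Y x"
    and unit: "t \<in> carrier T \<Longrightarrow> t \<notin> \<mm> \<Longrightarrow> t \<in> Units T" and one_notin_m: "\<one>\<^bsub>T\<^esub> \<notin> \<mm>"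
    and n_pos: "0 < n"
    and J_stable: "t \<in> adjoin T Y (x [^]\<^bsub>T\<^esub> n) \<Longrightarrow> u \<in> K \<Longrightarrow> h t \<otimes> u \<in> h ` adjoin T Y (x [^]\<^bsub>T\<^esub> n)"
    and not_conductor: "\<exists>u\<in>K. h (x [^]\<^bsub>T\<^esub> (n - 1)) \<otimes> u \<notin> h ` carrier T"
    and endo: "z \<in> carrier Q \<Longrightarrow> (\<And>u. u \<in> K \<Longrightarrow> z \<otimes> u \<in> K) \<Longrightarrow> z \<in> h ` carrier T"
begin

definition J :: "nat \<Rightarrow> 't set" where
  "J i = adjoin T Y (x [^]\<^bsub>T\<^esub> i)"

lemma pow_closed: "x [^]\<^bsub>T\<^esub> (i::nat) \<in> carrier T"
  using x_closed by simp

lemma J_ideal: "ideal (J i) T"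
  unfolding J_def by (rule T.ideal_adjoin[OF Y_ideal pow_closed])

lemma J_closed: "t \<in> J i \<Longrightarrow> t \<in> carrier T"
  using ideal_subset[OF J_ideal] by blast

lemma Y_subset_J: "Y \<subseteq> J i"
  unfolding J_def by (rule T.adjoin_superset[OF Y_ideal pow_closed])

lemma pow_mem_J: "r \<in> carrier T \<Longrightarrow> r \<otimes>\<^bsub>T\<^esub> x [^]\<^bsub>T\<^esub> i \<in> J i"
  unfolding J_def by (rule T.adjoin_mult[OF Y_ideal pow_closed])

lemma Y_closed: "t \<in> Y \<Longrightarrow> t \<in> carrier T"
  using ideal_subset[OF Y_ideal] by blast

lemma J_E:
  assumes "t \<in> J i"
  obtains y r where "t = y \<oplus>\<^bsub>T\<^esub> r \<otimes>\<^bsub>T\<^esub> x [^]\<^bsub>T\<^esub> i" "y \<in> Y" "r \<in> carrier T"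
  using assms unfolding J_def adjoin_def by blast

lemma m_mult_J: "t \<in> \<mm> \<Longrightarrow> t \<otimes>\<^bsub>T\<^esub> x [^]\<^bsub>T\<^esub> i \<in> J (Suc i)"
proof -
  assume "t \<in> \<mm>"
  then obtain y r where t: "t = y \<oplus>\<^bsub>T\<^esub> r \<otimes>\<^bsub>T\<^esub> x" "y \<in> Y" "r \<in> carrier T" unfolding m_eq adjoin_def by blast
  have distr: "(y \<oplus>\<^bsub>T\<^esub> r \<otimes>\<^bsub>T\<^esub> x) \<otimes>\<^bsub>T\<^esub> p = y \<otimes>\<^bsub>T\<^esub> p \<oplus>\<^bsub>T\<^esub> r \<otimes>\<^bsub>T\<^esub> (p \<otimes>\<^bsub>T\<^esub> x)"
    if "p \<in> carrier T" for p
    using that Y_closed[OF t(2)] t(3) x_closed by algebra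
  have e: "t \<otimes>\<^bsub>T\<^esub> x [^]\<^bsub>T\<^esub> i = y \<otimes>\<^bsub>T\<^esub> x [^]\<^bsub>T\<^esub> i \<oplus>\<^bsub>T\<^esub> r \<otimes>\<^bsub>T\<^esub> x [^]\<^bsub>T\<^esub> Suc i"
    unfolding t(1) T.nat_pow_Suc by (rule distr[OF pow_closed])
  have "y \<otimes>\<^bsub>T\<^esub> x [^]\<^bsub>T\<^esub> i \<in> J (Suc i)"
    using ideal.I_r_closed[OF Y_ideal t(2) pow_closed] Y_subset_J by blast
  then show ?thesis unfolding e by (rule ideal_add[OF J_ideal _ pow_mem_J[OF t(3)]])
qed

text \<open>In \<open>T/(Y + (x\<^sup>i))\<close> every nonzero element is a unit times a power of \<open>x\<close>.\<close>

lemma unit_times_power: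
  assumes "t \<in> carrier T" "i \<le> n"
  shows "t \<in> J i \<or> (\<exists>j<i. \<exists>\<epsilon>\<in>Units T. \<exists>y\<in>Y. t = \<epsilon> \<otimes>\<^bsub>T\<^esub> x [^]\<^bsub>T\<^esub> j \<oplus>\<^bsub>T\<^esub> y)"
  using assms(2)
proof (induction i)
  case 0
  have "t \<otimes>\<^bsub>T\<^esub> x [^]\<^bsub>T\<^esub> (0::nat) \<in> J 0" by (rule pow_mem_J[OF assms(1)])
  then show ?case using assms(1) by simp
next
  case (Suc i)
  have "t \<in> J i \<Longrightarrow> ?case"
  proof -
    assume "t \<in> J i"
    then obtain y r where t: "t = y \<oplus>\<^bsub>T\<^esub> r \<otimes>\<^bsub>T\<^esub> x [^]\<^bsub>T\<^esub> i" "y \<in> Y" "r \<in> carrier T" by (rule J_E)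
    show ?case
    proof (cases "r \<in> \<mm>")
      case True
      then have "t \<in> J (Suc i)" unfolding t(1) using ideal_add[OF J_ideal _ m_mult_J] t(2) Y_subset_J by blast
      then show ?thesis by blast
    next
      case False
      then have "r \<in> Units T" using unit t(3) by blast
      moreover have "t = r \<otimes>\<^bsub>T\<^esub> x [^]\<^bsub>T\<^esub> i \<oplus>\<^bsub>T\<^esub> y"
        unfolding t(1) by (rule T.a_comm) (use t Y_closed pow_closed in auto)
      ultimately show ?thesis using t(2) by blast
    qed
  qed
  then show ?case using Suc.IH Suc.prems less_Suc_eq by (metis Suc_leD)
qed

lemma J_stable': "t \<in> J n \<Longrightarrow> u \<in> K \<Longrightarrow> \<exists>t'\<in>J n. h t \<otimes> u = h t'"
  using J_stable unfolding J_def by blast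

lemma J_mult_K: "t \<in> J n \<Longrightarrow> u \<in> K \<Longrightarrow> h t \<otimes> u \<in> K"
  using K_smult J_closed by blast

lemma J_mult_K2:
  assumes "t \<in> J n" "u \<in> K" "v \<in> K"
  shows "h t \<otimes> (u \<otimes> v) \<in> K"
proof -
  obtain t' where t': "t' \<in> J n" "h t \<otimes> u = h t'" using J_stable'[OF assms(1,2)] by blast
  have "h t \<otimes> (u \<otimes> v) = (h t \<otimes> u) \<otimes> v" using J_closed[OF assms(1)] K_closed assms by (simp add: h.S.m_assoc)
  then show ?thesis unfolding t'(2) using J_mult_K[OF t'(1) assms(3)] by simp
qed

lemma J_mult_K3:
  assumes "t \<in> J n" "u \<in> K" "v \<in> K" "w \<in> K"
  shows "h t \<otimes> (u \<otimes> v \<otimes> w) \<in> K"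
proof -
  obtain t' where t': "t' \<in> J n" "h t \<otimes> u = h t'" using J_stable'[OF assms(1,2)] by blast
  have "h t \<otimes> (u \<otimes> v \<otimes> w) = (h t \<otimes> u) \<otimes> (v \<otimes> w)" using J_closed[OF assms(1)] K_closed assms by (simp add: h.S.m_assoc)
  then show ?thesis unfolding t'(2) using J_mult_K2[OF t'(1) assms(3,4)] by simp
qed

text \<open>If \<open>x\<^sup>n\<^sup>-\<^sup>1\<close> multiplied \<open>K\<^sup>2\<close> into \<open>K\<close>, then it would multiply \<open>K\<close> into \<open>K : K = R\<close>.\<close>

lemma exists_generator: "\<exists>f\<in>K. \<exists>g\<in>K. h (x [^]\<^bsub>T\<^esub> (n - 1)) \<otimes> (f \<otimes> g) \<notin> K"
proof (rule ccontr)
  assume *: "\<not> ?thesis"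
  have p: "h (x [^]\<^bsub>T\<^esub> (n - 1)) \<in> carrier Q" using pow_closed by simp
  have "h (x [^]\<^bsub>T\<^esub> (n - 1)) \<otimes> f \<in> h ` carrier T" if f: "f \<in> K" for f
  proof (rule endo)
    show "h (x [^]\<^bsub>T\<^esub> (n - 1)) \<otimes> f \<in> carrier Q" using p K_closed[OF f] by simp
    fix g assume g: "g \<in> K"
    have "h (x [^]\<^bsub>T\<^esub> (n - 1)) \<otimes> f \<otimes> g = h (x [^]\<^bsub>T\<^esub> (n - 1)) \<otimes> (f \<otimes> g)"
      using p K_closed f g by (simp add: h.S.m_assoc)
    then show "h (x [^]\<^bsub>T\<^esub> (n - 1)) \<otimes> f \<otimes> g \<in> K" using * f g by simp
  qed
  then show False using not_conductor by blast
qed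

context
  fixes f g z assumes f: "f \<in> K" and g: "g \<in> K" and z: "z = f \<otimes> g"
    and zK: "h (x [^]\<^bsub>T\<^esub> (n - 1)) \<otimes> z \<notin> K"
begin

lemma z_closed: "z \<in> carrier Q"
  unfolding z using K_closed f g by simp

lemma J_mult_z: "t \<in> J n \<Longrightarrow> h t \<otimes> z \<in> K"
  unfolding z by (rule J_mult_K2[OF _ f g])

lemma hpow_closed: "h (x [^]\<^bsub>T\<^esub> (i::nat)) \<in> carrier Q"
  using pow_closed by simp

lemma hpow_add: "h (x [^]\<^bsub>T\<^esub> (i::nat)) \<otimes> h (x [^]\<^bsub>T\<^esub> (j::nat)) = h (x [^]\<^bsub>T\<^esub> (i + j))"
  using x_closed by (simp add: T.nat_pow_mult[symmetric])

text \<open>\<open>K : J\<^sub>i = K + Rx\<^sup>n\<^sup>-\<^sup>iz\<close>.  Multiplication by \<open>x\<^sup>i\<close> takes \<open>K : J\<^sub>i\<^sub>+\<^sub>1\<close> into \<open>K : \<mm>\<close>, because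
  \<open>\<mm>x\<^sup>i \<subseteq> J\<^sub>i\<^sub>+\<^sub>1\<close>, and \<open>K : \<mm>\<close> is generated modulo \<open>K\<close> by \<open>x\<^sup>n\<^sup>-\<^sup>1z\<close>.  Subtracting a multiple of
  \<open>x\<^sup>n\<^sup>-\<^sup>i\<^sup>-\<^sup>1z\<close> therefore leaves an element of \<open>K : J\<^sub>i\<close>.\<close>

lemma colon_generated:
  assumes "i \<le> n" "w \<in> carrier Q" "\<And>t. t \<in> J i \<Longrightarrow> h t \<otimes> w \<in> K"
  shows "\<exists>\<rho>\<in>carrier T. w \<ominus> h \<rho> \<otimes> (h (x [^]\<^bsub>T\<^esub> (n - i)) \<otimes> z) \<in> K"
  using assms
proof (induction i arbitrary: w)
  case 0
  have "\<one>\<^bsub>T\<^esub> \<otimes>\<^bsub>T\<^esub> x [^]\<^bsub>T\<^esub> (0::nat) \<in> J 0" by (rule pow_mem_J) simp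
  then have "\<one>\<^bsub>T\<^esub> \<in> J 0" by simp
  then have "h \<one>\<^bsub>T\<^esub> \<otimes> w \<in> K" by (rule 0(3))
  then have "w \<in> K" using 0(2) by simp
  moreover have "w \<ominus> h \<zero>\<^bsub>T\<^esub> \<otimes> (h (x [^]\<^bsub>T\<^esub> (n - 0)) \<otimes> z) = w"
    using 0(2) hpow_closed[of n] z_closed by (simp add: a_minus_def)
  ultimately show ?case by (intro bexI[of _ "\<zero>\<^bsub>T\<^esub>"]) auto
next
  case (Suc i)
  define a where "a = h (x [^]\<^bsub>T\<^esub> i)"
  define b where "b = h (x [^]\<^bsub>T\<^esub> (n - Suc i))"
  define hx where "hx = h x"
  have ab: "a \<in> carrier Q" "b \<in> carrier Q" "hx \<in> carrier Q" using hpow_closed x_closed by (auto simp: a_def b_def hx_def)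
  note wc = Suc.prems(2)
  have ab_n: "a \<otimes> b = h (x [^]\<^bsub>T\<^esub> (n - 1))" unfolding a_def b_def hpow_add using Suc.prems(1) by simp
  have n_i: "n - i = Suc (n - Suc i)" using Suc.prems(1) by simp
  have bx: "h (x [^]\<^bsub>T\<^esub> (n - i)) = b \<otimes> hx" unfolding n_i b_def hx_def using x_closed by simp
  have "a \<otimes> (b \<otimes> z) = h (x [^]\<^bsub>T\<^esub> (n - 1)) \<otimes> z"
    unfolding ab_n[symmetric] using ab z_closed by (simp add: h.S.m_assoc)
  then have v0: "a \<otimes> (b \<otimes> z) \<in> carrier Q" "a \<otimes> (b \<otimes> z) \<notin> K"
    using pow_closed[of "n - 1"] z_closed zK by auto
  have v0m: "h t \<otimes> (a \<otimes> (b \<otimes> z)) \<in> K" if t: "t \<in> \<mm>" for t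
  proof -
    have "t \<otimes>\<^bsub>T\<^esub> x [^]\<^bsub>T\<^esub> (n - 1) \<in> J (Suc (n - 1))" by (rule m_mult_J[OF t])
    then have "h (t \<otimes>\<^bsub>T\<^esub> x [^]\<^bsub>T\<^esub> (n - 1)) \<otimes> z \<in> K" using J_mult_z n_pos by simp
    moreover have "h (t \<otimes>\<^bsub>T\<^esub> x [^]\<^bsub>T\<^esub> (n - 1)) = h t \<otimes> (a \<otimes> b)"
      unfolding ab_n using m_closed'[OF t] pow_closed by simp
    moreover have "h t \<in> carrier Q" using m_closed'[OF t] by simp
    ultimately show ?thesis using ab z_closed by (simp add: h.S.m_assoc)
  qed
  have vm: "h t \<otimes> (a \<otimes> w) \<in> K" if t: "t \<in> \<mm>" for t
  proof -
    have "h (t \<otimes>\<^bsub>T\<^esub> x [^]\<^bsub>T\<^esub> i) \<otimes> w \<in> K" by (rule Suc.prems(3)[OF m_mult_J[OF t]])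
    then show ?thesis using m_closed'[OF t] pow_closed wc by (simp add: a_def h.S.m_assoc)
  qed
  obtain \<rho> where \<rho>: "\<rho> \<in> carrier T" "a \<otimes> w \<ominus> h \<rho> \<otimes> (a \<otimes> (b \<otimes> z)) \<in> K"
    using socle[OF v0(1) v0m v0(2) h.S.m_closed[OF ab(1) wc] vm] by blast
  have h\<rho>: "h \<rho> \<in> carrier Q" using \<rho> by simp
  define w1 where "w1 = w \<ominus> h \<rho> \<otimes> (b \<otimes> z)"
  have w1: "w1 \<in> carrier Q" using wc h\<rho> ab z_closed by (simp add: w1_def)
  have w1J: "h t \<otimes> w1 \<in> K" if "t \<in> J i" for t
  proof -
    obtain y r where t: "t = y \<oplus>\<^bsub>T\<^esub> r \<otimes>\<^bsub>T\<^esub> x [^]\<^bsub>T\<^esub> i" "y \<in> Y" "r \<in> carrier T" using \<open>t \<in> J i\<close> by (rule J_E)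
    have c: "h y \<in> carrier Q" "h r \<in> carrier Q" using Y_closed[OF t(2)] t(3) by auto
    have ht: "h t = h y \<oplus> h r \<otimes> a" unfolding t(1) a_def using Y_closed[OF t(2)] t(3) pow_closed by simp
    have e: "h t \<otimes> w1 = (h y \<otimes> w \<ominus> h \<rho> \<otimes> (b \<otimes> (h y \<otimes> z))) \<oplus> h r \<otimes> (a \<otimes> w \<ominus> h \<rho> \<otimes> (a \<otimes> (b \<otimes> z)))"
      unfolding ht w1_def using c ab h\<rho> wc z_closed by algebra
    have hyw: "h y \<otimes> w \<in> K" using Suc.prems(3) Y_subset_J t(2) by blast
    have "h \<rho> \<otimes> (b \<otimes> (h y \<otimes> z)) \<in> K"
    proof -
      have "h y \<otimes> z \<in> K" using J_mult_z Y_subset_J t(2) by blast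
      then show ?thesis unfolding b_def by (rule K_smult[OF \<rho>(1) K_smult[OF pow_closed]])
    qed
    then show ?thesis unfolding e by (intro K_add[OF K_minus[OF hyw] K_smult[OF t(3) \<rho>(2)]])
  qed
  obtain \<sigma> where \<sigma>: "\<sigma> \<in> carrier T" "w1 \<ominus> h \<sigma> \<otimes> (b \<otimes> hx \<otimes> z) \<in> K"
    using Suc.IH[OF _ w1 w1J] Suc.prems(1) unfolding bx by auto
  have h\<sigma>: "h \<sigma> \<in> carrier Q" using \<sigma> by simp
  have e: "h (\<rho> \<oplus>\<^bsub>T\<^esub> \<sigma> \<otimes>\<^bsub>T\<^esub> x) = h \<rho> \<oplus> h \<sigma> \<otimes> hx" unfolding hx_def using \<rho>(1) \<sigma>(1) x_closed by simp
  have "w \<ominus> (h \<rho> \<oplus> h \<sigma> \<otimes> hx) \<otimes> (b \<otimes> z) = w1 \<ominus> h \<sigma> \<otimes> (b \<otimes> hx \<otimes> z)"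
    unfolding w1_def using ab h\<rho> h\<sigma> wc z_closed by algebra
  then have "w \<ominus> h (\<rho> \<oplus>\<^bsub>T\<^esub> \<sigma> \<otimes>\<^bsub>T\<^esub> x) \<otimes> (b \<otimes> z) \<in> K" using \<sigma>(2) e by simp
  then show ?case unfolding b_def using \<rho>(1) \<sigma>(1) x_closed by blast
qed

text \<open>The submodules \<open>K + Rx\<^sup>n\<^sup>-\<^sup>iz\<close> increase from \<open>K\<close> for \<open>i = 0\<close> to \<open>K : J\<^sub>n = K\<^sup>2\<close> for \<open>i = n\<close>.\<close>

definition layer :: "nat \<Rightarrow> 'q set" where
  "layer i = {k \<oplus> h t \<otimes> (h (x [^]\<^bsub>T\<^esub> (n - i)) \<otimes> z) | k t. k \<in> K \<and> t \<in> carrier T}"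

lemma layerI: "k \<in> K \<Longrightarrow> t \<in> carrier T \<Longrightarrow> k \<oplus> h t \<otimes> (h (x [^]\<^bsub>T\<^esub> (n - i)) \<otimes> z) \<in> layer i"
  unfolding layer_def by blast

lemma layerE:
  assumes "w \<in> layer i"
  obtains k t where "w = k \<oplus> h t \<otimes> (h (x [^]\<^bsub>T\<^esub> (n - i)) \<otimes> z)" "k \<in> K" "t \<in> carrier T"
  using assms unfolding layer_def by blast

lemma layer_gen_closed: "h (x [^]\<^bsub>T\<^esub> (i::nat)) \<otimes> z \<in> carrier Q"
  using hpow_closed z_closed by simp

lemma layer_add: assumes "u \<in> layer i" "v \<in> layer i" shows "u \<oplus> v \<in> layer i"
proof -
  obtain k t where u: "u = k \<oplus> h t \<otimes> (h (x [^]\<^bsub>T\<^esub> (n - i)) \<otimes> z)" "k \<in> K" "t \<in> carrier T" using assms(1) by (rule layerE)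
  obtain k' t' where v: "v = k' \<oplus> h t' \<otimes> (h (x [^]\<^bsub>T\<^esub> (n - i)) \<otimes> z)" "k' \<in> K" "t' \<in> carrier T" using assms(2) by (rule layerE)
  define q where "q = h (x [^]\<^bsub>T\<^esub> (n - i)) \<otimes> z"
  have c: "q \<in> carrier Q" "k \<in> carrier Q" "k' \<in> carrier Q" "h t \<in> carrier Q" "h t' \<in> carrier Q"
    using layer_gen_closed K_closed u v by (auto simp: q_def)
  have "u \<oplus> v = (k \<oplus> k') \<oplus> (h t \<oplus> h t') \<otimes> q" unfolding u(1) v(1) q_def[symmetric] using c by algebra
  also have "h t \<oplus> h t' = h (t \<oplus>\<^bsub>T\<^esub> t')" using u(3) v(3) by simp
  finally show ?thesis unfolding q_def using layerI[OF K_add[OF u(2) v(2)] T.a_closed[OF u(3) v(3)]] by simp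
qed

lemma layer_smult: assumes "u \<in> layer i" "r \<in> carrier T" shows "h r \<otimes> u \<in> layer i"
proof -
  obtain k t where u: "u = k \<oplus> h t \<otimes> (h (x [^]\<^bsub>T\<^esub> (n - i)) \<otimes> z)" "k \<in> K" "t \<in> carrier T" using assms(1) by (rule layerE)
  define q where "q = h (x [^]\<^bsub>T\<^esub> (n - i)) \<otimes> z"
  have c: "q \<in> carrier Q" "k \<in> carrier Q" "h r \<in> carrier Q" "h t \<in> carrier Q"
    using layer_gen_closed K_closed u assms by (auto simp: q_def)
  have "h r \<otimes> u = h r \<otimes> k \<oplus> (h r \<otimes> h t) \<otimes> q" unfolding u(1) q_def[symmetric] using c by algebra
  also have "h r \<otimes> h t = h (r \<otimes>\<^bsub>T\<^esub> t)" using u(3) assms(2) by simp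
  finally show ?thesis unfolding q_def using layerI[OF K_smult[OF assms(2) u(2)] T.m_closed[OF assms(2) u(3)]] by simp
qed

lemma K_subset_layer: "K \<subseteq> layer i"
proof
  fix k assume k: "k \<in> K"
  have "k \<oplus> h \<zero>\<^bsub>T\<^esub> \<otimes> (h (x [^]\<^bsub>T\<^esub> (n - i)) \<otimes> z) = k" using K_closed[OF k] layer_gen_closed by simp
  then show "k \<in> layer i" using layerI[OF k T.zero_closed, of i] by simp
qed

lemma layer_closed: "u \<in> layer i \<Longrightarrow> u \<in> carrier Q"
  by (erule layerE) (use K_closed layer_gen_closed in simp)

lemma gen_mem_layer: "h (x [^]\<^bsub>T\<^esub> (n - i)) \<otimes> z \<in> layer i"
proof -
  have "\<zero> \<oplus> h \<one>\<^bsub>T\<^esub> \<otimes> (h (x [^]\<^bsub>T\<^esub> (n - i)) \<otimes> z) = h (x [^]\<^bsub>T\<^esub> (n - i)) \<otimes> z" using layer_gen_closed by simp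
  then show ?thesis using layerI[OF K_zero T.one_closed, of i] by simp
qed

lemma layer_least:
  assumes "K \<subseteq> N" "h (x [^]\<^bsub>T\<^esub> (n - i)) \<otimes> z \<in> N" "\<And>u v. u \<in> N \<Longrightarrow> v \<in> N \<Longrightarrow> u \<oplus> v \<in> N"
    "\<And>r u. r \<in> carrier T \<Longrightarrow> u \<in> N \<Longrightarrow> h r \<otimes> u \<in> N"
  shows "layer i \<subseteq> N"
  using assms unfolding layer_def by blast

lemma layer_0: "layer 0 = K"
proof
  show "layer 0 \<subseteq> K"
  proof (rule layer_least)
    have "\<one>\<^bsub>T\<^esub> \<otimes>\<^bsub>T\<^esub> x [^]\<^bsub>T\<^esub> n \<in> J n" by (rule pow_mem_J) simp
    then have "h (\<one>\<^bsub>T\<^esub> \<otimes>\<^bsub>T\<^esub> x [^]\<^bsub>T\<^esub> n) \<otimes> z \<in> K" by (rule J_mult_z)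
    then show "h (x [^]\<^bsub>T\<^esub> (n - 0)) \<otimes> z \<in> K" using pow_closed[of n] by simp
  qed (use K_add K_smult in auto)
qed (rule K_subset_layer)

lemma unit_cancel:
  assumes "\<epsilon> \<in> Units T" "v \<in> carrier Q"
  shows "h (inv\<^bsub>T\<^esub> \<epsilon>) \<otimes> (h \<epsilon> \<otimes> v) = v"
proof -
  have c: "\<epsilon> \<in> carrier T" "inv\<^bsub>T\<^esub> \<epsilon> \<in> carrier T" using assms(1) by auto
  have "h (inv\<^bsub>T\<^esub> \<epsilon>) \<otimes> (h \<epsilon> \<otimes> v) = h (inv\<^bsub>T\<^esub> \<epsilon> \<otimes>\<^bsub>T\<^esub> \<epsilon>) \<otimes> v"
    unfolding h.hom_mult[OF c(2,1)] by (rule h.S.m_assoc[symmetric]) (use c assms(2) in auto)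
  also have "inv\<^bsub>T\<^esub> \<epsilon> \<otimes>\<^bsub>T\<^esub> \<epsilon> = \<one>\<^bsub>T\<^esub>" using assms(1) by simp
  finally show ?thesis using assms(2) by simp
qed

text \<open>If \<open>bz \<in> K + Rxbz\<close>, then \<open>(1 - tx)bz \<in> K\<close> for some \<open>t\<close>, hence \<open>bz \<in> K\<close>, and multiplying by a
  power of \<open>x\<close> would give \<open>x\<^sup>n\<^sup>-\<^sup>1z \<in> K\<close>.\<close>

lemma layer_strict:
  assumes "i < n"
  shows "layer i \<subset> layer (Suc i)"
proof -
  define b where "b = h (x [^]\<^bsub>T\<^esub> (n - Suc i))"
  have n_i: "n - i = Suc (n - Suc i)" using assms by simp
  have bc: "b \<in> carrier Q" "h x \<in> carrier Q" using hpow_closed x_closed by (auto simp: b_def)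
  have bx: "h (x [^]\<^bsub>T\<^esub> (n - i)) \<otimes> z = h x \<otimes> (b \<otimes> z)"
    unfolding n_i b_def using x_closed pow_closed z_closed by (simp add: h.S.m_ac)
  have "layer i \<subseteq> layer (Suc i)"
  proof (rule layer_least[OF K_subset_layer])
    show "h (x [^]\<^bsub>T\<^esub> (n - i)) \<otimes> z \<in> layer (Suc i)" unfolding bx b_def by (rule layer_smult[OF gen_mem_layer x_closed])
  qed (use layer_add layer_smult in auto)
  moreover have "b \<otimes> z \<notin> layer i"
  proof
    assume "b \<otimes> z \<in> layer i"
    then obtain k t where k: "b \<otimes> z = k \<oplus> h t \<otimes> (h x \<otimes> (b \<otimes> z))" "k \<in> K" "t \<in> carrier T"
      unfolding layer_def bx by blast
    have kc: "k \<in> carrier Q" "h t \<in> carrier Q" using K_closed k by auto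
    define \<epsilon> where "\<epsilon> = \<one>\<^bsub>T\<^esub> \<ominus>\<^bsub>T\<^esub> t \<otimes>\<^bsub>T\<^esub> x"
    have \<epsilon>c: "\<epsilon> \<in> carrier T" using k(3) x_closed by (simp add: \<epsilon>_def)
    have tx: "t \<otimes>\<^bsub>T\<^esub> x \<in> \<mm>" unfolding m_eq by (rule T.adjoin_mult[OF Y_ideal x_closed k(3)])
    have "\<epsilon> \<notin> \<mm>"
    proof
      assume "\<epsilon> \<in> \<mm>"
      then have "t \<otimes>\<^bsub>T\<^esub> x \<oplus>\<^bsub>T\<^esub> \<epsilon> \<in> \<mm>" by (rule ideal_add[OF m_ideal tx])
      moreover have "t \<otimes>\<^bsub>T\<^esub> x \<oplus>\<^bsub>T\<^esub> \<epsilon> = \<one>\<^bsub>T\<^esub>" unfolding \<epsilon>_def using k(3) x_closed by algebra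
      ultimately show False using one_notin_m by simp
    qed
    then have u: "\<epsilon> \<in> Units T" using unit \<epsilon>c by blast
    have h\<epsilon>: "h \<epsilon> = \<one> \<ominus> h t \<otimes> h x" unfolding \<epsilon>_def a_minus_def using k(3) x_closed by simp
    have "h \<epsilon> \<otimes> (b \<otimes> z) = b \<otimes> z \<ominus> h t \<otimes> (h x \<otimes> (b \<otimes> z))" unfolding h\<epsilon> using bc kc z_closed by algebra
    also have "\<dots> = (k \<oplus> h t \<otimes> (h x \<otimes> (b \<otimes> z))) \<ominus> h t \<otimes> (h x \<otimes> (b \<otimes> z))" using k(1) by simp
    also have "\<dots> = k" using bc kc z_closed by algebra
    finally have "h \<epsilon> \<otimes> (b \<otimes> z) \<in> K" using k(2) by simp
    then have "h (inv\<^bsub>T\<^esub> \<epsilon>) \<otimes> (h \<epsilon> \<otimes> (b \<otimes> z)) \<in> K" by (rule K_smult[OF T.Units_inv_closed[OF u]])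
    then have "b \<otimes> z \<in> K" using unit_cancel[OF u] bc z_closed by simp
    then have "h (x [^]\<^bsub>T\<^esub> i) \<otimes> (b \<otimes> z) \<in> K" using K_smult pow_closed by blast
    moreover have "h (x [^]\<^bsub>T\<^esub> i) \<otimes> (b \<otimes> z) = h (x [^]\<^bsub>T\<^esub> (n - 1)) \<otimes> z"
    proof -
      have "h (x [^]\<^bsub>T\<^esub> i) \<otimes> b = h (x [^]\<^bsub>T\<^esub> (n - 1))" unfolding b_def hpow_add using assms by simp
      then show ?thesis using hpow_closed bc z_closed by (simp add: h.S.m_assoc[symmetric])
    qed
    ultimately show False using zK by simp
  qed
  moreover have "b \<otimes> z \<in> layer (Suc i)" unfolding b_def by (rule gen_mem_layer)
  ultimately show ?thesis by blast
qed

lemma layer_n_colon: "w \<in> layer n \<longleftrightarrow> w \<in> carrier Q \<and> (\<forall>t\<in>J n. h t \<otimes> w \<in> K)"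
proof
  assume w: "w \<in> layer n"
  then obtain k t where k: "w = k \<oplus> h t \<otimes> (h (x [^]\<^bsub>T\<^esub> (n - n)) \<otimes> z)" "k \<in> K" "t \<in> carrier T" by (rule layerE)
  have w': "w = k \<oplus> h t \<otimes> z" using k z_closed by simp
  have "h s \<otimes> w \<in> K" if s: "s \<in> J n" for s
  proof -
    have c: "h s \<in> carrier Q" "h t \<in> carrier Q" "k \<in> carrier Q" using J_closed[OF s] k K_closed by auto
    have "h s \<otimes> w = h s \<otimes> k \<oplus> h t \<otimes> (h s \<otimes> z)" unfolding w' using c z_closed by algebra
    then show ?thesis using K_add[OF J_mult_K[OF s k(2)] K_smult[OF k(3) J_mult_z[OF s]]] by simp
  qed
  then show "w \<in> carrier Q \<and> (\<forall>t\<in>J n. h t \<otimes> w \<in> K)" using layer_closed[OF w] by blast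
next
  assume w: "w \<in> carrier Q \<and> (\<forall>t\<in>J n. h t \<otimes> w \<in> K)"
  have "\<exists>\<rho>\<in>carrier T. w \<ominus> h \<rho> \<otimes> (h (x [^]\<^bsub>T\<^esub> (n - n)) \<otimes> z) \<in> K"
    by (rule colon_generated[OF order_refl]) (use w in blast)+
  then obtain \<rho> where \<rho>: "\<rho> \<in> carrier T" "w \<ominus> h \<rho> \<otimes> (h (x [^]\<^bsub>T\<^esub> (n - n)) \<otimes> z) \<in> K"
    by blast
  define q where "q = h (x [^]\<^bsub>T\<^esub> (n - n)) \<otimes> z"
  have "q \<in> carrier Q" unfolding q_def by (rule layer_gen_closed)
  moreover have "h \<rho> \<in> carrier Q" "w \<in> carrier Q" using \<rho>(1) w by auto
  ultimately have "(w \<ominus> h \<rho> \<otimes> q) \<oplus> h \<rho> \<otimes> q = w" by algebra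
  then show "w \<in> layer n" using layerI[OF \<rho>(2,1), of n] unfolding q_def by (simp only:)
qed

text \<open>\<open>J\<^sub>n K\<^sup>2 \<subseteq> J\<^sub>n K \<subseteq> K\<close> shows \<open>K\<^sup>2 \<subseteq> K : J\<^sub>n = K + Rz\<close>, and \<open>z\<close> is a product of two elements of
  \<open>K\<close>.\<close>

lemma square: "ideal_prod Q K K = layer n"
proof
  show "ideal_prod Q K K \<subseteq> layer n"
  proof
    fix w assume "w \<in> ideal_prod Q K K"
    then show "w \<in> layer n"
    proof induction
      case (prod u v)
      then show ?case unfolding layer_n_colon using K_closed J_mult_K2 by simp
    next
      case (sum u v)
      then show ?case by (intro layer_add)
    qed
  qed
  show "layer n \<subseteq> ideal_prod Q K K"
  proof
    fix w assume "w \<in> layer n"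
    then obtain k t where k: "w = k \<oplus> h t \<otimes> (h (x [^]\<^bsub>T\<^esub> (n - n)) \<otimes> z)" "k \<in> K" "t \<in> carrier T" by (rule layerE)
    have "w = k \<otimes> \<one> \<oplus> (h t \<otimes> f) \<otimes> g"
      unfolding k(1) z using k K_closed f g by (simp add: h.S.m_assoc)
    then show "w \<in> ideal_prod Q K K"
      using ideal_prod.sum[OF ideal_prod.prod[OF k(2) K_one] ideal_prod.prod[OF K_smult[OF k(3) f] g]] by simp
  qed
qed

lemma cube: "ideal_prod Q (ideal_prod Q K K) K = layer n"
proof
  show "ideal_prod Q (ideal_prod Q K K) K \<subseteq> layer n"
  proof
    fix w assume "w \<in> ideal_prod Q (ideal_prod Q K K) K"
    then show "w \<in> layer n"
    proof induction
      case (prod u v)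
      note vK = prod(2)
      have vc: "v \<in> carrier Q" by (rule K_closed[OF vK])
      from prod(1) show ?case
      proof induction
        case (prod a b)
        have "a \<otimes> b \<otimes> v \<in> carrier Q" using K_closed[OF prod(1)] K_closed[OF prod(2)] vc by simp
        moreover have "h t \<otimes> (a \<otimes> b \<otimes> v) \<in> K" if "t \<in> J n" for t
          by (rule J_mult_K3[OF that prod vK])
        ultimately show ?case unfolding layer_n_colon by blast
      next
        case (sum a b)
        have "a \<in> carrier Q" "b \<in> carrier Q" using sum(1,2) layer_closed[of _ n] unfolding square by auto
        then have "(a \<oplus> b) \<otimes> v = a \<otimes> v \<oplus> b \<otimes> v" using vc by (rule h.S.l_distr)
        then show ?case using layer_add[OF sum.IH] by (simp only:)
      qed
    next
      case (sum u v)
      then show ?case by (intro layer_add)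
    qed
  qed
  show "layer n \<subseteq> ideal_prod Q (ideal_prod Q K K) K"
  proof
    fix w assume w: "w \<in> layer n"
    then have "w \<otimes> \<one> \<in> ideal_prod Q (ideal_prod Q K K) K" unfolding square by (intro ideal_prod.prod K_one)
    then show "w \<in> ideal_prod Q (ideal_prod Q K K) K" using layer_closed[OF w] by simp
  qed
qed

text \<open>A submodule between \<open>K\<close> and \<open>K + Rz\<close> is determined by the least \<open>j\<close> for which it contains
  \<open>x\<^sup>jz\<close>: it contains \<open>tz\<close> with \<open>t\<close> a unit times \<open>x\<^sup>j\<close> modulo \<open>Y\<close> if and only if it contains \<open>x\<^sup>jz\<close>.
  Along a strict chain this exponent drops strictly, from at most \<open>n\<close>.\<close>

lemma chain_bound:
  assumes N: "N 0 = K" "N m = layer n" "\<And>i. i < m \<Longrightarrow> N i \<subset> N (Suc i)"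
    and add: "\<And>i u v. i \<le> m \<Longrightarrow> u \<in> N i \<Longrightarrow> v \<in> N i \<Longrightarrow> u \<oplus> v \<in> N i"
    and smult: "\<And>i r u. i \<le> m \<Longrightarrow> r \<in> carrier T \<Longrightarrow> u \<in> N i \<Longrightarrow> h r \<otimes> u \<in> N i"
  shows "m \<le> n"
proof -
  have mono: "N i \<subseteq> N j" if "i \<le> j" "j \<le> m" for i j
    using that
  proof (induction j)
    case 0 then show ?case by simp
  next
    case (Suc j)
    show ?case
    proof (cases "i = Suc j")
      case False
      then have "N i \<subseteq> N j" using Suc by simp
      also have "N j \<subseteq> N (Suc j)" using N(3)[of j] Suc.prems(2) by auto
      finally show ?thesis .
    qed simp
  qed
  have KN: "K \<subseteq> N i" if "i \<le> m" for i using mono[of 0 i] that N(1) by simp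
  (* The exponent that determines N i. *)
  define D where "D i = (LEAST j::nat. h (x [^]\<^bsub>T\<^esub> j) \<otimes> z \<in> N i)" for i
  have xn: "h (x [^]\<^bsub>T\<^esub> n) \<otimes> z \<in> K" using gen_mem_layer[of 0] layer_0 by simp
  have D: "h (x [^]\<^bsub>T\<^esub> D i) \<otimes> z \<in> N i" if "i \<le> m" for i
    unfolding D_def by (rule LeastI[of "\<lambda>j::nat. h (x [^]\<^bsub>T\<^esub> j) \<otimes> z \<in> N i" n, OF subsetD[OF KN[OF that] xn]])
  have Dle: "D i \<le> j" if "h (x [^]\<^bsub>T\<^esub> j) \<otimes> z \<in> N i" for i and j :: nat
    unfolding D_def by (rule Least_le[of "\<lambda>j::nat. h (x [^]\<^bsub>T\<^esub> j) \<otimes> z \<in> N i" j, OF that])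
  have less: "D (Suc i) < D i" if i: "i < m" for i
  proof (rule ccontr)
    assume "\<not> D (Suc i) < D i"
    then have le: "D i \<le> D (Suc i)" by simp
    obtain w where w: "w \<in> N (Suc i)" "w \<notin> N i" using N(3)[OF i] by blast
    have "w \<in> layer n" using w(1) mono[of "Suc i" m] i N(2) by auto
    then obtain k t where k: "w = k \<oplus> h t \<otimes> (h (x [^]\<^bsub>T\<^esub> (n - n)) \<otimes> z)" "k \<in> K" "t \<in> carrier T" by (rule layerE)
    have w': "w = k \<oplus> h t \<otimes> z" using k z_closed by simp
    have kc: "k \<in> carrier Q" "h t \<in> carrier Q" using K_closed k by auto
    have im: "i \<le> m" "Suc i \<le> m" using i by auto
    note KNi = subsetD[OF KN[OF im(1)]] and KNs = subsetD[OF KN[OF im(2)]]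
    have "t \<notin> J n"
    proof
      assume "t \<in> J n"
      then have "h t \<otimes> z \<in> N i" by (rule KNi[OF J_mult_z])
      then have "w \<in> N i" unfolding w' by (rule add[OF im(1) KNi[OF k(2)]])
      then show False using w(2) by blast
    qed
    then obtain j :: nat and \<epsilon> y where t: "\<epsilon> \<in> Units T" "y \<in> Y" "t = \<epsilon> \<otimes>\<^bsub>T\<^esub> x [^]\<^bsub>T\<^esub> j \<oplus>\<^bsub>T\<^esub> y"
      using unit_times_power[OF k(3) order_refl] by blast
    have yc: "y \<in> carrier T" "\<epsilon> \<in> carrier T" using Y_closed t by auto
    define p where "p = h (x [^]\<^bsub>T\<^esub> j) \<otimes> z"
    have pc: "p \<in> carrier Q" "h \<epsilon> \<in> carrier Q" "h y \<in> carrier Q" using layer_gen_closed yc by (auto simp: p_def)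
    have tz: "h t \<otimes> z = h \<epsilon> \<otimes> p \<oplus> h y \<otimes> z"
      unfolding t(3) p_def using yc pow_closed[of j] z_closed by (simp add: h.S.l_distr h.S.m_assoc)
    have yz: "h y \<otimes> z \<in> K" using J_mult_z Y_subset_J t(2) by blast
    have yzc: "h y \<otimes> z \<in> carrier Q" by (rule K_closed[OF yz])
    have "h \<epsilon> \<otimes> p = w \<oplus> (\<ominus> (k \<oplus> h y \<otimes> z))"
      unfolding w' tz using pc kc yzc by algebra
    then have ep: "h \<epsilon> \<otimes> p \<in> N (Suc i)"
      using add[OF im(2) w(1) KNs[OF K_neg[OF K_add[OF k(2) yz]]]] by (simp only:)
    have "h (inv\<^bsub>T\<^esub> \<epsilon>) \<otimes> (h \<epsilon> \<otimes> p) \<in> N (Suc i)" by (rule smult[OF im(2) T.Units_inv_closed[OF t(1)] ep])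
    then have "p \<in> N (Suc i)" using unit_cancel[OF t(1) pc(1)] by simp
    then have "D (Suc i) \<le> j" unfolding p_def by (rule Dle)
    then have Dj: "D i \<le> j" using le by simp
    have "h (x [^]\<^bsub>T\<^esub> (j - D i)) \<otimes> (h (x [^]\<^bsub>T\<^esub> D i) \<otimes> z) \<in> N i"
      by (rule smult[OF im(1) pow_closed D[OF im(1)]])
    moreover have "h (x [^]\<^bsub>T\<^esub> (j - D i)) \<otimes> (h (x [^]\<^bsub>T\<^esub> D i) \<otimes> z) = p"
    proof -
      have "h (x [^]\<^bsub>T\<^esub> (j - D i)) \<otimes> h (x [^]\<^bsub>T\<^esub> D i) = h (x [^]\<^bsub>T\<^esub> j)" unfolding hpow_add using Dj by simp
      then show ?thesis unfolding p_def using hpow_closed z_closed by (simp add: h.S.m_assoc[symmetric])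
    qed
    ultimately have "p \<in> N i" by simp
    then have "h \<epsilon> \<otimes> p \<in> N i" by (rule smult[OF im(1) yc(2)])
    then have "h t \<otimes> z \<in> N i" unfolding tz by (rule add[OF im(1) _ KNi[OF yz]])
    then have "w \<in> N i" unfolding w' by (rule add[OF im(1) KNi[OF k(2)]])
    then show False using w(2) by blast
  qed
  have "D i + i \<le> n" if "i \<le> m" for i
    using that
  proof (induction i)
    case 0
    show ?case using Dle[of n 0] xn N(1) by simp
  next
    case (Suc i)
    then show ?case using less[of i] by simp
  qed
  from this[of m] show ?thesis by simp
qed

end

end

section \<open>Regular elements in dimension one\<close>

text \<open>In dimension one the maximal ideal is the only prime containing a regular element \<open>x\<close>.  If no
  power of \<open>t\<close> were a multiple of \<open>x\<close>, there would be a prime \<open>P1\<close> containing \<open>x\<close> but not \<open>t\<close>; and as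
  \<open>x\<close> is regular, \<open>P1\<close> contains a prime \<open>P0\<close> that avoids \<open>x\<close>.  Then \<open>P0 \<subset> P1 \<subset> \<mm>\<close> is too long.\<close>

lemma dim_one_power_multiple:
  fixes R (structure)
  assumes loc: "noeth_local R" and dim: "krull_dim R = 1"
    and x: "x \<in> carrier R" "\<And>y. y \<in> carrier R \<Longrightarrow> x \<otimes> y = \<zero> \<Longrightarrow> y = \<zero>"
    and t: "t \<in> max_ideal R"
  shows "\<exists>(k::nat). \<exists>r\<in>carrier R. t [^] k = r \<otimes> x"
proof (rule ccontr)
  interpret noetherian_cring R using noeth_local_cring[OF loc] .
  assume neg: "\<not> ?thesis"
  have m: "ideal (max_ideal R) R" using ideal_max_ideal[OF loc] .
  have tc: "t \<in> carrier R" using t ideal_subset[OF m] by blast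
  (* The powers of t are avoided by P1. *)
  define S where "S = range (\<lambda>k::nat. t [^] k)"
  have memS: "t [^] k \<in> S" for k :: nat by (simp add: S_def)
  obtain P1 where P1: "primeideal P1 R" "PIdl x \<subseteq> P1" "P1 \<inter> S = {}"
  proof (rule exists_prime_avoiding[of "PIdl x" S])
    show "ideal (PIdl x) R" by (rule cgenideal_ideal[OF x(1)])
    show "S \<subseteq> carrier R" using tc by (auto simp: S_def)
    show "\<one> \<in> S" using memS[of 0] by simp
    show "a \<otimes> b \<in> S" if "a \<in> S" "b \<in> S" for a b
      using that tc unfolding S_def by (auto simp: nat_pow_mult)
    show "PIdl x \<inter> S = {}"
    proof (rule equals0I)
      fix y assume "y \<in> PIdl x \<inter> S"
      then obtain r and k :: nat where "r \<in> carrier R" "y = r \<otimes> x" "y = t [^] k"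
        unfolding S_def cgenideal_def by auto
      then have "t [^] k = r \<otimes> x" "r \<in> carrier R" by simp_all
      then show False using neg by blast
    qed
  qed
  have xP1: "x \<in> P1" using P1(2) cgenideal_self[OF x(1)] by blast
  have tP1: "t \<notin> P1" using P1(3) memS[of 1] tc by auto
  (* A prime avoiding all products of powers of x with elements outside P1 lies in P1 and misses x. *)
  define S2 where "S2 = {x [^] k \<otimes> s | (k::nat) s. s \<in> carrier R - P1}"
  have memS2: "x [^] k \<otimes> s \<in> S2" if "s \<in> carrier R - P1" for k :: nat and s using that S2_def by blast
  have cancel: "y = \<zero>" if "y \<in> carrier R" "x [^] k \<otimes> y = \<zero>" for k :: nat and y
    using that
  proof (induction k arbitrary: y)
    case 0 then show ?case by simp
  next
    case (Suc k)
    have "x [^] k \<otimes> (x \<otimes> y) = \<zero>" using Suc.prems x(1) by (simp add: m_assoc)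
    then have "x \<otimes> y = \<zero>" using Suc.IH[of "x \<otimes> y"] Suc.prems(1) x(1) by simp
    then show ?case by (rule x(2)[OF Suc.prems(1)])
  qed
  obtain P0 where P0: "primeideal P0 R" "P0 \<inter> S2 = {}"
  proof (rule exists_prime_avoiding[of "{\<zero>}" S2])
    show "ideal {\<zero>} R" by (rule zeroideal)
    show "S2 \<subseteq> carrier R" using x(1) by (auto simp: S2_def)
    show "\<one> \<in> S2" using memS2[OF prime_one_notin[OF P1(1)], of 0] by simp
    show "a \<otimes> b \<in> S2" if ab: "a \<in> S2" "b \<in> S2" for a b
    proof -
      obtain j k :: nat and s s' where e: "a = x [^] j \<otimes> s" "b = x [^] k \<otimes> s'" "s \<in> carrier R - P1" "s' \<in> carrier R - P1"
        using ab unfolding S2_def by blast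
      have c: "s \<in> carrier R" "s' \<in> carrier R" "x [^] j \<in> carrier R" "x [^] k \<in> carrier R" using e x(1) by auto
      have "a \<otimes> b = (x [^] j \<otimes> x [^] k) \<otimes> (s \<otimes> s')" unfolding e(1,2) using c by algebra
      also have "\<dots> = x [^] (j + k) \<otimes> (s \<otimes> s')" using x(1) by (simp add: nat_pow_mult)
      finally show ?thesis using memS2[OF prime_mult_notin[OF P1(1) e(3,4)]] by simp
    qed
    have "\<zero> \<notin> S2"
    proof
      assume "\<zero> \<in> S2"
      then obtain k :: nat and s where s: "\<zero> = x [^] k \<otimes> s" "s \<in> carrier R - P1" unfolding S2_def by blast
      then have "s = \<zero>" using cancel[of s k] by simp
      then show False using s(2) ideal_zero[OF primeideal.axioms(1)[OF P1(1)]] by simp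
    qed
    then show "{\<zero>} \<inter> S2 = {}" by simp
  qed
  have "P0 \<subseteq> P1"
  proof
    fix s assume s: "s \<in> P0"
    then have sc: "s \<in> carrier R" using ideal_subset[OF primeideal.axioms(1)[OF P0(1)]] by blast
    show "s \<in> P1"
    proof (rule ccontr)
      assume "s \<notin> P1"
      then have "x [^] (0::nat) \<otimes> s \<in> S2" using memS2 sc by blast
      then show False using P0(2) s sc by auto
    qed
  qed
  moreover have "x \<notin> P0"
    using memS2[OF prime_one_notin[OF P1(1)], of 1] x(1) P0(2) by auto
  ultimately have P01: "P0 \<subset> P1" using xP1 by blast
  have "P1 \<subseteq> max_ideal R"
    using proper_subset_max_ideal[OF loc primeideal.axioms(1)[OF P1(1)]] primeideal.I_notcarr[OF P1(1)] by blast
  then have P1m: "P1 \<subset> max_ideal R" using t tP1 by blast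
  have mp: "primeideal (max_ideal R) R" using maximalideal_prime[OF maximalideal_max_ideal[OF loc]] .
  define C where "C i = (if i = 0 then P0 else if i = 1 then P1 else max_ideal R)" for i :: nat
  have "enat 2 \<le> krull_dim R"
    unfolding krull_dim_def
  proof (rule Sup_upper, intro CollectI exI[of _ 2] exI[of _ C] conjI allI impI)
    show "primeideal (C i) R" for i using P0(1) P1(1) mp by (simp add: C_def)
    show "C i \<subset> C (Suc i)" if "i < 2" for i using that P01 P1m by (auto simp: C_def less_2_cases_iff)
  qed simp
  then show False using dim by (simp add: one_enat_def)
qed

lemma depth_one_regular_element:
  fixes R (structure)
  assumes "cring R" "depth R (self_module R) = 1"
  obtains x where "x \<in> max_ideal R" "\<And>y. y \<in> carrier R \<Longrightarrow> x \<otimes> y = \<zero> \<Longrightarrow> y = \<zero>"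
proof -
  interpret cring R by fact
  define A where "A = {enat n | n. \<exists>x. x \<in> {..<n} \<rightarrow> max_ideal R \<and> regular_seq (self_module R) x n}"
  have "\<exists>n x. n > 0 \<and> x \<in> {..<n} \<rightarrow> max_ideal R \<and> regular_seq (self_module R) x n"
  proof (rule ccontr)
    assume *: "\<not> ?thesis"
    have "Sup A \<le> 0"
    proof (rule Sup_least)
      fix a assume "a \<in> A"
      then obtain n x where n: "a = enat n" "x \<in> {..<n} \<rightarrow> max_ideal R" "regular_seq (self_module R) x n" unfolding A_def by blast
      have "\<not> n > 0"
      proof
        assume "n > 0"
        then have "\<exists>n x. n > 0 \<and> x \<in> {..<n} \<rightarrow> max_ideal R \<and> regular_seq (self_module R) x n"
          using n(2,3) by (intro exI[of _ n] exI[of _ x] conjI)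
        then show False using * by simp
      qed
      then have "n = 0" by simp
      then show "a \<le> 0" using n(1) by (simp add: zero_enat_def)
    qed
    then show False using assms(2) unfolding depth_def A_def[symmetric] by simp
  qed
  then obtain n x where n: "n > 0" "x \<in> {..<n} \<rightarrow> max_ideal R" "regular_seq (self_module R) x n" by blast
  have "(\<Oplus>\<^bsub>self_module R\<^esub>i\<in>{}. g i) = \<zero>" for g :: "nat \<Rightarrow> 'a"
    unfolding self_module_def by (subst finsum_restr_module) auto
  then have S0: "seq_mult (self_module R) x 0 = {\<zero>}" unfolding seq_mult_def by auto
  have "\<forall>y\<in>carrier (self_module R). x 0 \<odot>\<^bsub>self_module R\<^esub> y \<in> seq_mult (self_module R) x 0 \<longrightarrow> y \<in> seq_mult (self_module R) x 0"
    using n(1,3) unfolding regular_seq_def by blast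
  then have "\<And>y. y \<in> carrier R \<Longrightarrow> x 0 \<otimes> y = \<zero> \<Longrightarrow> y = \<zero>"
    unfolding S0 by (simp add: self_module_def restr_module_def)
  moreover have "x 0 \<in> max_ideal R" using n(1,2) by auto
  ultimately show thesis using that by blast
qed

section \<open>Relations read off from the presentation matrix\<close>

lemma (in cring) finsum_in_ideal:
  assumes "ideal L R" "finite A" "\<And>i. i \<in> A \<Longrightarrow> g i \<in> L"
  shows "(\<Oplus>i\<in>A. g i) \<in> L"
  using assms(2,3)
proof (induction A)
  case empty then show ?case using ideal_zero[OF assms(1)] by simp
next
  case (insert k A)
  have "g \<in> A \<rightarrow> carrier R" "g k \<in> carrier R" using insert.prems ideal_subset[OF assms(1)] by auto
  then have e: "(\<Oplus>i\<in>insert k A. g i) = g k \<oplus> (\<Oplus>i\<in>A. g i)" by (rule finsum_insert[OF insert.hyps])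
  show ?case unfolding e using ideal_add[OF assms(1)] insert by blast
qed

lemma finite_pairs: "finite (pairs n len)"
  by (simp add: pairs_def)

text \<open>\<open>K\<close> as a \<open>T\<close>-module with the presentation matrix whose columns are the relations
  \<open>X\<^sub>1\<^sup>k f\<^sub>k\<^sub>i = a\<^sub>i\<^sub>1\<close> and \<open>X\<^sub>j f\<^sub>k\<^sub>i = a\<^sub>i\<^sub>j\<close>.\<close>

locale presented_submodule = T: cring T + h: ring_hom_cring T Q h
  for T :: "('t, 'x) ring_scheme" and Q :: "('q, 'y) ring_scheme" (structure) and h +
  fixes K :: "'q set" and n l q :: nat and len :: "nat \<Rightarrow> nat" and X c :: "nat \<Rightarrow> 't"
    and a :: "nat \<Rightarrow> nat \<Rightarrow> nat \<Rightarrow> 't" and f :: "nat \<Rightarrow> nat \<Rightarrow> 'q"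
  assumes KQ: "K \<subseteq> carrier Q" and K0: "\<zero> \<in> K" and Ka: "\<And>u v. u \<in> K \<Longrightarrow> v \<in> K \<Longrightarrow> u \<oplus> v \<in> K"
    and Ks: "\<And>t u. t \<in> carrier T \<Longrightarrow> u \<in> K \<Longrightarrow> h t \<otimes> u \<in> K"
    and pres: "minimal_free_presentation T (restr_module Q h K)
           (pres_rows n len) (pres_cols n len l q) (pres_mat T X a c) (pres_row Q f)"
begin

abbreviation "rows \<equiv> pres_rows n len"
abbreviation "cols \<equiv> pres_cols n len l q"

lemma finite_rows: "finite rows" and finite_cols: "finite cols"
  and entry_closed: "r \<in> rows \<Longrightarrow> s \<in> cols \<Longrightarrow> pres_mat T X a c r s \<in> carrier T"
  and row_mem: "r \<in> rows \<Longrightarrow> pres_row Q f r \<in> K"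
  and kernel: "{v \<in> rows \<rightarrow>\<^sub>E carrier T. lin_comb (restr_module Q h K) rows (pres_row Q f) v = \<zero>}
       = mat_act (self_module T) rows cols (pres_mat T X a c) ` (cols \<rightarrow>\<^sub>E carrier T)"
  using pres unfolding minimal_free_presentation_def by (auto simp: restr_module_def)

text \<open>Both a column of the matrix and a relation \<open>t f\<^sub>k\<^sub>i \<in> R\<close> are vectors supported on the first row and
  one other row.\<close>

definition two_rows :: "nat \<times> nat \<Rightarrow> 't \<Rightarrow> 't \<Rightarrow> (nat \<times> nat) option \<Rightarrow> 't" where
  "two_rows p \<alpha> \<beta> = (\<lambda>r\<in>rows. case r of None \<Rightarrow> \<alpha> | Some p' \<Rightarrow> if p' = p then \<beta> else \<zero>\<^bsub>T\<^esub>)"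

lemma two_rows_closed:
  "\<alpha> \<in> carrier T \<Longrightarrow> \<beta> \<in> carrier T \<Longrightarrow> two_rows p \<alpha> \<beta> \<in> rows \<rightarrow>\<^sub>E carrier T"
  unfolding two_rows_def restrict_PiE_iff by (auto split: option.split)

lemma lin_comb_two_rows:
  assumes p: "(k, i) \<in> pairs n len" and \<alpha>: "\<alpha> \<in> carrier T" and \<beta>: "\<beta> \<in> carrier T"
  shows "lin_comb (restr_module Q h K) rows (pres_row Q f) (two_rows (k, i) \<alpha> \<beta>) = \<ominus> h \<alpha> \<oplus> h \<beta> \<otimes> f k i"
proof -
  define v where "v = two_rows (k, i) \<alpha> \<beta>"
  have v: "v r \<in> carrier T" if "r \<in> rows" for r
    using two_rows_closed[OF \<alpha> \<beta>] that unfolding v_def by (rule PiE_mem)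
  have termK: "h (v r) \<otimes> pres_row Q f r \<in> K" if "r \<in> rows" for r
    by (rule Ks[OF v[OF that] row_mem[OF that]])
  have termc: "h (v r) \<otimes> pres_row Q f r \<in> carrier Q" if "r \<in> rows" for r
    using termK[OF that] KQ by blast
  have S: "Some ` pairs n len \<subseteq> rows" "None \<in> rows" "Some (k, i) \<in> rows" using p by (auto simp: pres_rows_def)
  have Pi: "(\<lambda>r. h (v r) \<otimes> pres_row Q f r) \<in> Some ` pairs n len \<rightarrow> carrier Q" using termc S(1) by blast
  have "lin_comb (restr_module Q h K) rows (pres_row Q f) v
      = (\<Oplus>\<^bsub>restr_module Q h K\<^esub>r\<in>rows. h (v r) \<otimes> pres_row Q f r)"
    by (simp add: lin_comb_def restr_module_def)
  also have "\<dots> = (\<Oplus>r\<in>rows. h (v r) \<otimes> pres_row Q f r)"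
    by (rule h.S.finsum_restr_module[OF KQ K0 Ka finite_rows]) (use termK in auto)
  also have "\<dots> = h (v None) \<otimes> pres_row Q f None \<oplus> (\<Oplus>r\<in>Some ` pairs n len. h (v r) \<otimes> pres_row Q f r)"
    unfolding pres_rows_def
  proof (rule h.S.finsum_insert)
    show "finite (Some ` pairs n len)" by (simp add: finite_pairs)
    show "None \<notin> Some ` pairs n len" by auto
    show "(\<lambda>r. h (v r) \<otimes> pres_row Q f r) \<in> Some ` pairs n len \<rightarrow> carrier Q" by (rule Pi)
    show "h (v None) \<otimes> pres_row Q f None \<in> carrier Q" by (rule termc[OF S(2)])
  qed
  also have "(\<Oplus>r\<in>Some ` pairs n len. h (v r) \<otimes> pres_row Q f r)
      = (\<Oplus>r\<in>Some ` pairs n len. if Some (k, i) = r then h (v r) \<otimes> pres_row Q f r else \<zero>)"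
  proof (rule h.S.finsum_cong')
    fix r assume r: "r \<in> Some ` pairs n len"
    have "v r = \<zero>\<^bsub>T\<^esub>" if "Some (k, i) \<noteq> r" using r that S(1) by (auto simp: v_def two_rows_def split: if_splits)
    moreover have "pres_row Q f r \<in> carrier Q" by (rule subsetD[OF KQ row_mem[OF subsetD[OF S(1) r]]])
    ultimately show "h (v r) \<otimes> pres_row Q f r = (if Some (k, i) = r then h (v r) \<otimes> pres_row Q f r else \<zero>)"
      by (cases "Some (k, i) = r") simp_all
  qed (use Pi in \<open>auto simp del: pres_row.simps\<close>)
  also have "\<dots> = h (v (Some (k, i))) \<otimes> pres_row Q f (Some (k, i))"
    by (rule h.S.finsum_singleton[OF _ _ Pi]) (use p finite_pairs in auto)
  also have "v (Some (k, i)) = \<beta>" using S(3) by (simp add: v_def two_rows_def)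
  also have "v None = \<alpha>" using S(2) by (simp add: v_def two_rows_def)
  also have "h \<alpha> \<otimes> pres_row Q f None = \<ominus> h \<alpha>" using \<alpha> by (simp add: h.S.r_minus)
  finally show ?thesis by (simp add: v_def)
qed

lemma relation:
  assumes p: "(k, i) \<in> pairs n len" and j: "1 \<le> j" "j \<le> l"
  shows "h (if j = 1 then X 1 [^]\<^bsub>T\<^esub> k else X j) \<otimes> f k i = h (a k i j)"
proof -
  define s :: "(nat \<times> nat) \<times> nat + nat" where "s = Inl ((k, i), j)"
  have s: "s \<in> cols" using p j by (auto simp: s_def pres_cols_def)
  define \<alpha> where "\<alpha> = a k i j"
  define \<beta> where "\<beta> = (if j = 1 then X 1 [^]\<^bsub>T\<^esub> k else X j)"
  have S: "None \<in> rows" "Some (k, i) \<in> rows" using p by (auto simp: pres_rows_def)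
  have \<alpha>: "\<alpha> \<in> carrier T" using entry_closed[OF S(1) s] by (simp add: s_def \<alpha>_def)
  have \<beta>: "\<beta> \<in> carrier T" using entry_closed[OF S(2) s] by (simp add: s_def \<beta>_def)
  have "mat_act (self_module T) rows cols (pres_mat T X a c) (\<lambda>j\<in>cols. if j = s then \<one>\<^bsub>T\<^esub> else \<zero>\<^bsub>T\<^esub>)
      = (\<lambda>r\<in>rows. pres_mat T X a c r s)"
    by (rule T.mat_act_unit_vector[OF finite_cols s entry_closed])
  also have "\<dots> = two_rows (k, i) \<alpha> \<beta>"
    unfolding two_rows_def
    by (rule restrict_ext) (auto simp: s_def \<alpha>_def \<beta>_def split: option.split)
  finally have e: "mat_act (self_module T) rows cols (pres_mat T X a c) (\<lambda>j\<in>cols. if j = s then \<one>\<^bsub>T\<^esub> else \<zero>\<^bsub>T\<^esub>)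
      = two_rows (k, i) \<alpha> \<beta>" .
  have "(\<lambda>j\<in>cols. if j = s then \<one>\<^bsub>T\<^esub> else \<zero>\<^bsub>T\<^esub>) \<in> cols \<rightarrow>\<^sub>E carrier T"
    unfolding restrict_PiE_iff by simp
  from imageI[OF this, of "mat_act (self_module T) rows cols (pres_mat T X a c)"]
  have "two_rows (k, i) \<alpha> \<beta> \<in> {v \<in> rows \<rightarrow>\<^sub>E carrier T. lin_comb (restr_module Q h K) rows (pres_row Q f) v = \<zero>}"
    unfolding e kernel .
  then have z: "\<ominus> h \<alpha> \<oplus> h \<beta> \<otimes> f k i = \<zero>" using lin_comb_two_rows[OF p \<alpha> \<beta>] by simp
  have fK: "f k i \<in> carrier Q" using row_mem[OF S(2)] KQ by auto
  have c: "h \<alpha> \<in> carrier Q" "h \<beta> \<in> carrier Q" using \<alpha> \<beta> by auto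
  have "h \<beta> \<otimes> f k i = h \<alpha> \<oplus> (\<ominus> h \<alpha> \<oplus> h \<beta> \<otimes> f k i)" using c fK by algebra
  also have "\<dots> = h \<alpha>" unfolding z using c by simp
  finally show ?thesis by (simp only: \<alpha>_def \<beta>_def)
qed

text \<open>The relation \<open>t f\<^sub>k\<^sub>i = u\<close> is a combination of the columns, and the row \<open>(k, i)\<close> of the matrix has no
  nonzero entries other than \<open>X\<^sub>1\<^sup>k, X\<^sub>2, \<dots>, X\<^sub>l\<close>.\<close>

lemma annihilator:
  assumes p: "(k, i) \<in> pairs n len" and t: "t \<in> carrier T" "h t \<otimes> f k i \<in> h ` carrier T"
    and L: "ideal L T" "X 1 [^]\<^bsub>T\<^esub> k \<in> L" "\<And>j. 2 \<le> j \<Longrightarrow> j \<le> l \<Longrightarrow> X j \<in> L"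
  shows "t \<in> L"
proof -
  obtain u where u: "u \<in> carrier T" "h t \<otimes> f k i = h u" using t(2) by blast
  have S: "Some (k, i) \<in> rows" using p by (auto simp: pres_rows_def)
  have z: "\<ominus> h u \<oplus> h t \<otimes> f k i = \<zero>" unfolding u(2) using u(1) by (simp add: h.S.l_neg)
  have "two_rows (k, i) u t \<in> {v \<in> rows \<rightarrow>\<^sub>E carrier T. lin_comb (restr_module Q h K) rows (pres_row Q f) v = \<zero>}"
    by (intro CollectI conjI two_rows_closed[OF u(1) t(1)] trans[OF lin_comb_two_rows[OF p u(1) t(1)] z])
  then have "\<exists>w\<in>cols \<rightarrow>\<^sub>E carrier T. two_rows (k, i) u t = mat_act (self_module T) rows cols (pres_mat T X a c) w"
    unfolding kernel image_iff .
  then obtain w where w0: "w \<in> cols \<rightarrow>\<^sub>E carrier T"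
      "two_rows (k, i) u t = mat_act (self_module T) rows cols (pres_mat T X a c) w"
    by (rule bexE)
  note w = w0(2,1)
  have wc: "w s \<in> carrier T" if "s \<in> cols" for s using w(2) that by (rule PiE_mem)
  have "mat_act (self_module T) rows cols (pres_mat T X a c) w
      = (\<lambda>r\<in>rows. \<Oplus>\<^bsub>T\<^esub>s\<in>cols. pres_mat T X a c r s \<otimes>\<^bsub>T\<^esub> w s)"
    by (rule T.mat_act_self_module[OF finite_cols entry_closed]) (use wc in auto)
  then have "two_rows (k, i) u t (Some (k, i)) = (\<Oplus>\<^bsub>T\<^esub>s\<in>cols. pres_mat T X a c (Some (k, i)) s \<otimes>\<^bsub>T\<^esub> w s)"
    using w(1) S by simp
  moreover have "two_rows (k, i) u t (Some (k, i)) = t" using S by (simp add: two_rows_def)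
  moreover have "(\<Oplus>\<^bsub>T\<^esub>s\<in>cols. pres_mat T X a c (Some (k, i)) s \<otimes>\<^bsub>T\<^esub> w s) \<in> L"
  proof (rule T.finsum_in_ideal[OF L(1) finite_cols])
    fix s assume s: "s \<in> cols"
    have "pres_mat T X a c (Some (k, i)) s \<in> L"
    proof (cases s)
      case (Inr b)
      then show ?thesis using ideal_zero[OF L(1)] by simp
    next
      case (Inl b)
      obtain k' i' j where b: "b = ((k', i'), j)" by (metis prod.exhaust)
      have "1 \<le> j" "j \<le> l" using s unfolding Inl b by (auto simp: pres_cols_def)
      then have "j = 1 \<or> 2 \<le> j" by linarith
      then show ?thesis using L(2,3) \<open>j \<le> l\<close> ideal_zero[OF L(1)] unfolding Inl b by auto
    qed
    then show "pres_mat T X a c (Some (k, i)) s \<otimes>\<^bsub>T\<^esub> w s \<in> L"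
      using ideal.I_r_closed[OF L(1) _ wc[OF s]] by blast
  qed
  ultimately show ?thesis by simp
qed

end

section \<open>Length and embedding dimension\<close>

text \<open>\<open>R\<close> enters only through the surjection \<open>\<pi>\<close> from \<open>T\<close>, so the \<open>R\<close>-submodules of \<open>Q\<close> are the
  \<open>T\<close>-submodules of \<open>Q\<close>, and the \<open>n\<close> steps between the layers form a longest chain from \<open>K\<close> to \<open>K\<^sup>2\<close>.\<close>

lemma (in uniserial_conductor) quot_length_square:
  fixes R :: "('r, 'z) ring_scheme"
  assumes R: "cring R" "\<iota> \<in> ring_hom R Q" "carrier R = \<pi> ` carrier T" "\<And>t. t \<in> carrier T \<Longrightarrow> h t = \<iota> (\<pi> t)"
  shows "ideal_prod Q K K = ideal_prod Q (ideal_prod Q K K) K"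
    and "quot_length R (restr_module Q \<iota> (carrier Q)) (ideal_prod Q K K) K = enat n"
proof -
  obtain f g where fg: "f \<in> K" "g \<in> K" "h (x [^]\<^bsub>T\<^esub> (n - 1)) \<otimes> (f \<otimes> g) \<notin> K" using exists_generator by blast
  define z where "z = f \<otimes> g"
  have zK: "h (x [^]\<^bsub>T\<^esub> (n - 1)) \<otimes> z \<notin> K" using fg(3) by (simp add: z_def)
  note ctxt = fg(1,2) z_def zK
  show "ideal_prod Q K K = ideal_prod Q (ideal_prod Q K K) K"
    using square[OF ctxt] cube[OF ctxt] by simp
  define M where "M = restr_module Q \<iota> (carrier Q)"
  have mod: "module R M" unfolding M_def
    by (rule module_restr_module[OF R(1) h.S.is_cring R(2)])
      (use ring_hom_closed[OF R(2)] in auto)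
  define L where "L = layer z"
  have sub: "submodule (L i) R M" for i
  proof (rule module.submodule_by_closure[OF mod])
    show "L i \<subseteq> carrier M" unfolding L_def M_def restr_module_def using layer_closed[OF ctxt] by auto
    show "\<zero>\<^bsub>M\<^esub> \<in> L i" unfolding L_def M_def restr_module_def using K_subset_layer[OF ctxt] K_zero by auto
    show "u \<oplus>\<^bsub>M\<^esub> v \<in> L i" if "u \<in> L i" "v \<in> L i" for u v
      using layer_add[OF ctxt] that unfolding L_def M_def restr_module_def by simp
    show "r \<odot>\<^bsub>M\<^esub> u \<in> L i" if r: "r \<in> carrier R" "u \<in> L i" for r u
    proof -
      obtain t where t: "t \<in> carrier T" "r = \<pi> t" using r(1) R(3) by blast
      have "h t \<otimes> u \<in> L i" unfolding L_def by (rule layer_smult[OF ctxt]) (use r(2) t(1) L_def in auto)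
      then show ?thesis unfolding t(2) M_def restr_module_def using R(4)[OF t(1)] by simp
    qed
  qed
  show "quot_length R (restr_module Q \<iota> (carrier Q)) (ideal_prod Q K K) K = enat n"
    unfolding quot_length_def M_def[symmetric] square[OF ctxt] L_def[symmetric]
  proof (rule antisym)
    show "Sup {enat m | m. \<exists>N :: nat \<Rightarrow> 'q set. N 0 = K \<and> N m = L n \<and>
      (\<forall>i\<le>m. submodule (N i) R M) \<and> (\<forall>i<m. N i \<subset> N (Suc i))} \<le> enat n"
    proof (rule Sup_least)
      fix b assume "b \<in> {enat m | m. \<exists>N :: nat \<Rightarrow> 'q set. N 0 = K \<and> N m = L n \<and>
        (\<forall>i\<le>m. submodule (N i) R M) \<and> (\<forall>i<m. N i \<subset> N (Suc i))}"
      then obtain m and N :: "nat \<Rightarrow> 'q set" where b: "b = enat m" and N: "N 0 = K" "N m = L n"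
        "\<And>i. i \<le> m \<Longrightarrow> submodule (N i) R M" "\<And>i. i < m \<Longrightarrow> N i \<subset> N (Suc i)" by blast
      have "m \<le> n"
      proof (rule chain_bound[OF ctxt, of N])
        show "N 0 = K" by (rule N(1))
        show "N m = layer z n" using N(2) by (simp add: L_def)
        show "N i \<subset> N (Suc i)" if "i < m" for i by (rule N(4)[OF that])
        show "u \<oplus> v \<in> N i" if "i \<le> m" "u \<in> N i" "v \<in> N i" for i u v
          using subgroup.m_closed[OF submodule.axioms(1)[OF N(3)[OF that(1)]] that(2,3)]
          by (simp add: M_def restr_module_def)
        show "h r \<otimes> u \<in> N i" if "i \<le> m" "r \<in> carrier T" "u \<in> N i" for i r u
        proof -
          have "\<pi> r \<in> carrier R" using R(3) that(2) by blast
          from submodule.smult_closed[OF N(3)[OF that(1)] this that(3)]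
          show ?thesis unfolding M_def restr_module_def using R(4)[OF that(2)] by simp
        qed
      qed
      then show "b \<le> enat n" using b by simp
    qed
    show "enat n \<le> Sup {enat m | m. \<exists>N :: nat \<Rightarrow> 'q set. N 0 = K \<and> N m = L n \<and>
      (\<forall>i\<le>m. submodule (N i) R M) \<and> (\<forall>i<m. N i \<subset> N (Suc i))}"
      by (rule Sup_upper)
        (use sub layer_strict[OF ctxt] layer_0[OF ctxt] L_def in \<open>blast\<close>)
  qed
qed

lemma (in cring) genideal_insert:
  assumes "S \<subseteq> carrier R" "y \<in> carrier R"
  shows "Idl (insert y S) = adjoin R (Idl S) y"
proof
  have id: "ideal (Idl S) R" by (rule genideal_ideal[OF assms(1)])
  have S: "insert y S \<subseteq> carrier R" using assms by simp
  show "Idl (insert y S) \<subseteq> adjoin R (Idl S) y"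
    using genideal_self[OF assms(1)] adjoin_superset[OF id assms(2)] adjoin_self[OF id assms(2)]
    by (intro genideal_minimal[OF ideal_adjoin[OF id assms(2)]]) blast
  have id': "ideal (Idl (insert y S)) R" by (rule genideal_ideal[OF S])
  show "adjoin R (Idl S) y \<subseteq> Idl (insert y S)"
    using genideal_self[OF S] by (intro adjoin_least[OF id'] genideal_minimal[OF id']) auto
qed

lemma emb_dim_eq_one:
  fixes R (structure)
  assumes "cring R" "y \<in> carrier R" "y \<noteq> \<zero>" "max_ideal R = PIdl y"
  shows "emb_dim R = 1"
proof -
  interpret cring R by fact
  define A where "A = {enat (card S) | S. finite S \<and> S \<subseteq> carrier R \<and> Idl S = max_ideal R}"
  have "emb_dim R = Inf A" by (simp add: emb_dim_def num_gens_def A_def)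
  moreover have "Inf A = 1"
  proof (rule antisym)
    have "enat (card {y}) \<in> A" unfolding A_def
      using assms(2,4) cgenideal_eq_genideal[OF assms(2)] by (intro CollectI exI[of _ "{y}"]) simp
    then have "enat 1 \<in> A" by simp
    then show "Inf A \<le> 1" unfolding one_enat_def by (rule Inf_lower)
    show "1 \<le> Inf A"
    proof (rule Inf_greatest)
      fix b assume "b \<in> A"
      then obtain S where S: "b = enat (card S)" "finite S" "S \<subseteq> carrier R" "Idl S = max_ideal R" unfolding A_def by blast
      have "S \<noteq> {}"
      proof
        assume "S = {}"
        then have "max_ideal R \<subseteq> {\<zero>}" unfolding S(4)[symmetric] by (intro genideal_minimal zeroideal) simp
        then show False using cgenideal_self[OF assms(2)] assms(3,4) by blast
      qed
      then have "1 \<le> card S" using S(2) by (simp add: Suc_leI card_gt_0_iff)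
      then show "1 \<le> b" unfolding S(1) one_enat_def by simp
    qed
  qed
  ultimately show ?thesis by simp
qed

section \<open>Goto rings from a presentation of the canonical ideal\<close>

lemma ring_hom_nat_pow:
  assumes "cring A" "cring B" "f \<in> ring_hom A B" "u \<in> carrier A"
  shows "f (u [^]\<^bsub>A\<^esub> (k::nat)) = f u [^]\<^bsub>B\<^esub> k"
  by (rule ring_hom_ring.hom_nat_pow[OF ring_hom_ringI2[OF cring.axioms(1)[OF assms(1)] cring.axioms(1)[OF assms(2)] assms(3)] assms(4)])

theorem theorem8p9:
  fixes T :: "('t, 'x) ring_scheme" and R :: "'t set ring" and Q :: "('q, 'y) ring_scheme"
    and \<aa> :: "'t set" and \<iota> :: "'t set \<Rightarrow> 'q" and K :: "'q set" and \<cc> :: "'t set set"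
    and X c :: "nat \<Rightarrow> 't" and J :: "nat \<Rightarrow> 't set" and a :: "nat \<Rightarrow> nat \<Rightarrow> nat \<Rightarrow> 't"
    and len :: "nat \<Rightarrow> nat" and f :: "nat \<Rightarrow> nat \<Rightarrow> 'q" and l n r q :: nat
  assumes "regular_local T" and "krull_dim T = enat l" and "l \<ge> 3"
    and "ideal \<aa> T" and "\<aa> \<noteq> carrier T" and "\<aa> \<subseteq> ideal_prod T (max_ideal T) (max_ideal T)"
    and "n \<ge> 2"
    and "R = T Quot \<aa>"
    and "cohen_macaulay_local R" and "krull_dim R = 1" and "\<not> gorenstein_local R"
    and "total_fraction_ring R Q \<iota>"
    and "fractional_canonical_ideal R Q \<iota> K"
    and "\<cc> = {x \<in> carrier R. \<iota> x \<in> colon Q (\<iota> ` carrier R) (generate_ring Q (\<iota> ` carrier R \<union> K))}"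
    and "has_type R (self_module R) r"
    and "X \<in> {1..l} \<rightarrow> max_ideal T" and "genideal T (X ` {1..l}) = max_ideal T"
    and "\<And>i. 1 \<le> i \<Longrightarrow> i \<le> n \<Longrightarrow> J i = genideal T (insert (X 1 [^]\<^bsub>T\<^esub> i) (X ` {2..l}))"
    and "len n > 0" and "(\<Sum>k=1..n. len k) + 1 = r"
    and "\<And>k i. (k, i) \<in> pairs n len \<Longrightarrow> f k i \<in> K"
    and "K = {\<iota> x \<oplus>\<^bsub>Q\<^esub> (\<Oplus>\<^bsub>Q\<^esub>p\<in>pairs n len. \<iota> (s p) \<otimes>\<^bsub>Q\<^esub> f (fst p) (snd p)) | x s.
               x \<in> carrier R \<and> s \<in> pairs n len \<rightarrow> carrier R}"
    and "minimal_free_presentation T (restr_module Q (\<lambda>t. \<iota> (\<aa> +>\<^bsub>T\<^esub> t)) K)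
           (pres_rows n len) (pres_cols n len l q) (pres_mat T X a c) (pres_row Q f)"
    and "\<And>s. 1 \<le> s \<Longrightarrow> s \<le> q \<Longrightarrow> c s \<in> max_ideal T"
    and "\<And>i j. 1 \<le> i \<Longrightarrow> i \<le> len n \<Longrightarrow> 1 \<le> j \<Longrightarrow> j \<le> l \<Longrightarrow> a n i j \<in> J n"
    and "\<And>k i j. 1 \<le> k \<Longrightarrow> k < n \<Longrightarrow> 1 \<le> i \<Longrightarrow> i \<le> len k \<Longrightarrow> 2 \<le> j \<Longrightarrow> j \<le> l \<Longrightarrow> a k i j \<in> J n"
    and "\<And>k i. 1 \<le> k \<Longrightarrow> k < n \<Longrightarrow> 1 \<le> i \<Longrightarrow> i \<le> len k \<Longrightarrow> a k i 1 \<in> J k"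
  shows "n_goto_ring R Q \<iota> n \<and> emb_dim (R Quot \<cc>) = 1"
proof -
  note regT = assms(1) and dimT = assms(2) and l3 = assms(3) and aI = assms(4,5)
    and n2 = assms(7) and R = assms(8) and CM = assms(9) and dimR = assms(10)
    and frac = assms(12) and can = assms(13) and cdef = assms(14) and X = assms(16) and Xgen = assms(17)
    and J = assms(18) and lenn = assms(19) and fK = assms(21) and Keq = assms(22) and pres = assms(23)
    and an = assms(25) and ak = assms(26) and ak1 = assms(27)
  have locT: "noeth_local T" using regT by (simp add: regular_local_def)
  have locR: "noeth_local R" using CM by (simp add: cohen_macaulay_local_def)
  interpret T: noetherian_cring T using noeth_local_cring[OF locT] .
  interpret R: noetherian_cring R using noeth_local_cring[OF locR] .
  have Qc: "cring Q" and \<iota>: "\<iota> \<in> ring_hom R Q" using frac by (simp_all add: total_fraction_ring_def)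
  interpret Q: cring Q by (rule Qc)
  define \<pi> where "\<pi> t = \<aa> +>\<^bsub>T\<^esub> t" for t
  define h where "h t = \<iota> (\<pi> t)" for t
  have \<pi>: "\<pi> \<in> ring_hom T R"
    using ideal.rcos_ring_hom[OF aI(1)] unfolding R \<pi>_def[abs_def] .
  have carR: "carrier R = \<pi> ` carrier T" unfolding R carrier_Quot \<pi>_def[abs_def] ..
  have hhom: "h \<in> ring_hom T Q"
    using ring_hom_trans[OF \<pi> \<iota>] by (simp add: h_def[abs_def] comp_def)
  interpret h: ring_hom_cring T Q h
    using hhom by (simp add: ring_hom_cring_def ring_hom_cring_axioms_def T.is_cring Qc)
  interpret \<iota>: ring_hom_cring R Q \<iota>
    using \<iota> by (simp add: ring_hom_cring_def ring_hom_cring_axioms_def R.is_cring Qc)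
  have \<pi>_mem: "\<pi> t \<in> carrier R" if "t \<in> carrier T" for t using carR that by blast

  define \<mm> where "\<mm> = max_ideal T"
  have m: "ideal \<mm> T" unfolding \<mm>_def by (rule ideal_max_ideal[OF locT])
  have mR: "max_ideal R = \<pi> ` \<mm>" unfolding R \<pi>_def[abs_def] \<mm>_def by (rule max_ideal_Quot[OF locT aI])
  have mc: "t \<in> carrier T" if "t \<in> \<mm>" for t using ideal_subset[OF m] that by blast
  have one_m: "\<one>\<^bsub>T\<^esub> \<notin> \<mm>"
    using ideal.one_imp_carrier[OF m] maximalideal.I_notcarr[OF maximalideal_max_ideal[OF locT]] by (auto simp: \<mm>_def)
  have unitT: "t \<in> Units T" if "t \<in> carrier T" "t \<notin> \<mm>" for t
    using notin_max_ideal_unit[OF locT] that by (simp add: \<mm>_def)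

  have subK: "submodule K R (restr_module Q \<iota> (carrier Q))" and one_sub: "\<iota> ` carrier R \<subseteq> K"
    and canK: "canonical_module R (restr_module Q \<iota> K)"
    using can by (simp_all add: fractional_canonical_ideal_def)
  have sg: "subgroup K (add_monoid (restr_module Q \<iota> (carrier Q)))" using subK by (rule submodule.axioms(1))
  have KQ: "K \<subseteq> carrier Q" using subgroup.subset[OF sg] by (simp add: restr_module_def)
  have K0: "\<zero>\<^bsub>Q\<^esub> \<in> K" using subgroup.one_closed[OF sg] by (simp add: restr_module_def)
  have Ka: "u \<oplus>\<^bsub>Q\<^esub> v \<in> K" if "u \<in> K" "v \<in> K" for u v
    using subgroup.m_closed[OF sg that] by (simp add: restr_module_def)
  have KsR: "\<iota> r \<otimes>\<^bsub>Q\<^esub> u \<in> K" if "r \<in> carrier R" "u \<in> K" for r u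
    using submodule.smult_closed[OF subK that] by (simp add: restr_module_def)
  have Ks: "h t \<otimes>\<^bsub>Q\<^esub> u \<in> K" if "t \<in> carrier T" "u \<in> K" for t u
    unfolding h_def by (rule KsR[OF \<pi>_mem[OF that(1)] that(2)])
  have K1: "\<one>\<^bsub>Q\<^esub> \<in> K" using one_sub R.one_closed \<iota>.hom_one by (metis image_subset_iff)
  have typeK: "has_type R (restr_module Q \<iota> K) 1" and depthK: "depth R (restr_module Q \<iota> K) = enat 1"
    using canK dimR by (simp_all add: canonical_module_def one_enat_def)
  have hT: "\<iota> ` carrier R = h ` carrier T" unfolding carR h_def[abs_def] by (simp add: image_image)

  have "depth R (self_module R) = 1" using CM dimR by (simp add: cohen_macaulay_local_def)
  from depth_one_regular_element[OF R.is_cring this]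
  obtain s where s: "s \<in> max_ideal R" "\<And>y. y \<in> carrier R \<Longrightarrow> s \<otimes>\<^bsub>R\<^esub> y = \<zero>\<^bsub>R\<^esub> \<Longrightarrow> y = \<zero>\<^bsub>R\<^esub>" by metis
  have sc: "s \<in> carrier R" using s(1) ideal_subset[OF ideal_max_ideal[OF locR]] by blast
  have regular_unit: "\<iota> y \<in> Units Q" if "y \<in> carrier R" "\<And>z. z \<in> carrier R \<Longrightarrow> y \<otimes>\<^bsub>R\<^esub> z = \<zero>\<^bsub>R\<^esub> \<Longrightarrow> z = \<zero>\<^bsub>R\<^esub>" for y
    using frac that unfolding total_fraction_ring_def Let_def by blast

  (* Type one of K over R, read over T. *)
  interpret tos: type_one_submodule T Q h \<mm> K
  proof (intro type_one_submodule.intro type_one_submodule_axioms.intro)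
    show "noetherian_cring T" by (rule T.noetherian_cring_axioms)
    show "ring_hom_cring T Q h" by (rule h.ring_hom_cring_axioms)
    show "ideal \<mm> T" by (rule m)
    show "K \<subseteq> carrier Q" by (rule KQ)
    show "\<one>\<^bsub>Q\<^esub> \<in> K" by (rule K1)
    show "u \<oplus>\<^bsub>Q\<^esub> v \<in> K" if "u \<in> K" "v \<in> K" for u v by (rule Ka[OF that])
    show "h t \<otimes>\<^bsub>Q\<^esub> u \<in> K" if "t \<in> carrier T" "u \<in> K" for t u by (rule Ks[OF that])
    fix w w'
    assume w: "w \<in> carrier Q" "\<And>t. t \<in> \<mm> \<Longrightarrow> h t \<otimes>\<^bsub>Q\<^esub> w \<in> K" "w \<notin> K"
      and w': "w' \<in> carrier Q" "\<And>t. t \<in> \<mm> \<Longrightarrow> h t \<otimes>\<^bsub>Q\<^esub> w' \<in> K"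
    have "\<exists>r\<in>carrier R. w' \<ominus>\<^bsub>Q\<^esub> \<iota> r \<otimes>\<^bsub>Q\<^esub> w \<in> K"
    proof (rule type_one_socle[OF locR Qc \<iota> KQ K0 Ka KsR typeK depthK s(1) regular_unit[OF sc s(2)] w(1) _ w(3) w'(1)])
      show "\<iota> r \<otimes>\<^bsub>Q\<^esub> w \<in> K" if "r \<in> max_ideal R" for r using that w(2) unfolding mR h_def by blast
      show "\<iota> r \<otimes>\<^bsub>Q\<^esub> w' \<in> K" if "r \<in> max_ideal R" for r using that w'(2) unfolding mR h_def by blast
    qed
    then show "\<exists>t\<in>carrier T. w' \<ominus>\<^bsub>Q\<^esub> h t \<otimes>\<^bsub>Q\<^esub> w \<in> K" unfolding carR h_def by blast
  qed

  interpret pr: presented_submodule T Q h K n l q len X c a f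
    by (intro presented_submodule.intro presented_submodule_axioms.intro T.is_cring h.ring_hom_cring_axioms)
      (fact KQ, fact K0, erule (1) Ka, erule (1) Ks, fact pres[folded \<pi>_def h_def])

  define Y where "Y = genideal T (X ` {2..l})"
  define x where "x = X 1"
  have Xc: "X j \<in> carrier T" if "1 \<le> j" "j \<le> l" for j
    by (rule mc[unfolded \<mm>_def, OF funcset_mem[OF X]]) (use that in simp)
  have xc: "x \<in> carrier T" unfolding x_def using Xc[of 1] l3 by simp
  have XYc: "X ` {2..l} \<subseteq> carrier T" using Xc by auto
  have Y: "ideal Y T" unfolding Y_def by (rule T.genideal_ideal[OF XYc])
  have XY: "X j \<in> Y" if "2 \<le> j" "j \<le> l" for j
    using T.genideal_self[OF XYc] that unfolding Y_def by auto
  have pc: "x [^]\<^bsub>T\<^esub> (k::nat) \<in> carrier T" for k using xc by simp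
  have J_eq: "J k = adjoin T Y (x [^]\<^bsub>T\<^esub> k)" if "1 \<le> k" "k \<le> n" for k
    unfolding J[OF that] Y_def x_def[symmetric] by (rule T.genideal_insert[OF XYc pc])
  have m_eq: "\<mm> = adjoin T Y x"
  proof -
    have "X ` {1..l} = insert x (X ` {2..l})"
    proof -
      have "{1..l} = insert 1 {2..l}" using l3 by auto
      then show ?thesis by (simp add: x_def)
    qed
    then show ?thesis using Xgen T.genideal_insert[OF XYc xc] by (simp add: \<mm>_def Y_def)
  qed
  have Jid: "ideal (J k) T" if "1 \<le> k" "k \<le> n" for k
    unfolding J_eq[OF that] by (rule T.ideal_adjoin[OF Y pc])
  have YJ: "Y \<subseteq> J k" if "1 \<le> k" "k \<le> n" for k
    unfolding J_eq[OF that] by (rule T.adjoin_superset[OF Y pc])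
  have pJ: "x [^]\<^bsub>T\<^esub> k \<in> J k" if "1 \<le> k" "k \<le> n" for k
    unfolding J_eq[OF that] by (rule T.adjoin_self[OF Y pc])
  have n1: "1 \<le> n" using n2 by simp
  note Jn = Jid[OF n1 order_refl]

  have pairE: "1 \<le> k \<and> k \<le> n \<and> 1 \<le> i \<and> i \<le> len k" if "(k, i) \<in> pairs n len" for k i
    using that by (auto simp: pairs_def)
  (* X_1^k, X_2, ..., X_l lie in J k, so a multiple of f k i lies in R only for multipliers in J k. *)
  have annih: "t \<in> J k" if p: "(k, i) \<in> pairs n len" and t: "t \<in> carrier T" "h t \<otimes>\<^bsub>Q\<^esub> f k i \<in> h ` carrier T" for k i t
  proof (rule pr.annihilator[OF p t])
    have k: "1 \<le> k" "k \<le> n" using pairE[OF p] by auto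
    show "ideal (J k) T" by (rule Jid[OF k])
    show "X 1 [^]\<^bsub>T\<^esub> k \<in> J k" using pJ[OF k] by (simp add: x_def)
    show "X j \<in> J k" if "2 \<le> j" "j \<le> l" for j using YJ[OF k] XY[OF that] by blast
  qed

  have colon_ideal: "ideal {t \<in> carrier T. h t \<otimes>\<^bsub>Q\<^esub> u \<in> h ` J n} T" if u: "u \<in> carrier Q" for u
  proof (rule T.idealI_comm)
    note Jnc = ideal_subset[OF Jn]
    have "h \<zero>\<^bsub>T\<^esub> \<otimes>\<^bsub>Q\<^esub> u = h \<zero>\<^bsub>T\<^esub>" using u by simp
    then show "\<zero>\<^bsub>T\<^esub> \<in> {t \<in> carrier T. h t \<otimes>\<^bsub>Q\<^esub> u \<in> h ` J n}" using imageI[OF ideal_zero[OF Jn], of h] by simp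
    fix b assume "b \<in> {t \<in> carrier T. h t \<otimes>\<^bsub>Q\<^esub> u \<in> h ` J n}"
    then obtain b' where b: "b \<in> carrier T" "b' \<in> J n" "h b \<otimes>\<^bsub>Q\<^esub> u = h b'" by auto
    have b'c: "b' \<in> carrier T" using b(2) Jnc by blast
    show "b \<oplus>\<^bsub>T\<^esub> d \<in> {t \<in> carrier T. h t \<otimes>\<^bsub>Q\<^esub> u \<in> h ` J n}" if "d \<in> {t \<in> carrier T. h t \<otimes>\<^bsub>Q\<^esub> u \<in> h ` J n}" for d
    proof -
      obtain d' where d: "d \<in> carrier T" "d' \<in> J n" "h d \<otimes>\<^bsub>Q\<^esub> u = h d'" using \<open>d \<in> _\<close> by auto
      have d'c: "d' \<in> carrier T" using d(2) Jnc by blast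
      have "h (b \<oplus>\<^bsub>T\<^esub> d) \<otimes>\<^bsub>Q\<^esub> u = h (b' \<oplus>\<^bsub>T\<^esub> d')" using b d b'c d'c u by (simp add: Q.l_distr)
      then show ?thesis using imageI[OF ideal_add[OF Jn b(2) d(2)], of h] b(1) d(1) by simp
    qed
    show "r \<otimes>\<^bsub>T\<^esub> b \<in> {t \<in> carrier T. h t \<otimes>\<^bsub>Q\<^esub> u \<in> h ` J n}" if r: "r \<in> carrier T" for r
    proof -
      have "h (r \<otimes>\<^bsub>T\<^esub> b) \<otimes>\<^bsub>Q\<^esub> u = h (r \<otimes>\<^bsub>T\<^esub> b')" using b b'c r u by (simp add: Q.m_assoc)
      then show ?thesis using imageI[OF ideal.I_l_closed[OF Jn b(2) r], of h] b(1) r by simp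
    qed
  qed blast

  (* X_1^(n-k) J k \<subseteq> J n, which is why the entries a k i 1 only have to lie in J k. *)
  have power_mult_J: "x [^]\<^bsub>T\<^esub> (n - k) \<otimes>\<^bsub>T\<^esub> b \<in> J n" if k: "1 \<le> k" "k \<le> n" and b: "b \<in> J k" for k b
  proof -
    obtain y r where y: "b = y \<oplus>\<^bsub>T\<^esub> r \<otimes>\<^bsub>T\<^esub> x [^]\<^bsub>T\<^esub> k" "y \<in> Y" "r \<in> carrier T"
      using b unfolding J_eq[OF k] adjoin_def by blast
    have yc: "y \<in> carrier T" using y(2) ideal_subset[OF Y] by blast
    define u v where "u = x [^]\<^bsub>T\<^esub> (n - k)" and "v = x [^]\<^bsub>T\<^esub> k"
    have uv: "u \<in> carrier T" "v \<in> carrier T" unfolding u_def v_def by (rule pc)+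
    have uvn: "u \<otimes>\<^bsub>T\<^esub> v = x [^]\<^bsub>T\<^esub> n" unfolding u_def v_def using xc k(2) by (simp add: T.nat_pow_mult)
    have "u \<otimes>\<^bsub>T\<^esub> b = u \<otimes>\<^bsub>T\<^esub> y \<oplus>\<^bsub>T\<^esub> r \<otimes>\<^bsub>T\<^esub> (u \<otimes>\<^bsub>T\<^esub> v)"
      unfolding y(1) v_def[symmetric] using uv yc y(3) by algebra
    moreover have "u \<otimes>\<^bsub>T\<^esub> y \<in> J n" using ideal.I_l_closed[OF Y y(2) uv(1)] YJ[OF n1 order_refl] by blast
    moreover have "r \<otimes>\<^bsub>T\<^esub> (u \<otimes>\<^bsub>T\<^esub> v) \<in> J n" unfolding uvn by (rule ideal.I_l_closed[OF Jn pJ[OF n1 order_refl] y(3)])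
    ultimately show ?thesis unfolding u_def using ideal_add[OF Jn] by simp
  qed

  have gen_stable: "h t \<otimes>\<^bsub>Q\<^esub> f k i \<in> h ` J n" if p: "(k, i) \<in> pairs n len" and t: "t \<in> J n" for k i t
  proof -
    have k: "1 \<le> k" "k \<le> n" and i: "1 \<le> i" "i \<le> len k" using pairE[OF p] by auto
    have fc: "f k i \<in> carrier Q" using fK[OF p] KQ by blast
    let ?L = "{t \<in> carrier T. h t \<otimes>\<^bsub>Q\<^esub> f k i \<in> h ` J n}"
    note L = colon_ideal[OF fc]
    have "Y \<subseteq> ?L"
      unfolding Y_def
    proof (rule T.genideal_minimal[OF L])
      show "X ` {2..l} \<subseteq> ?L"
      proof
        fix y assume "y \<in> X ` {2..l}"
        then obtain j where j: "y = X j" "2 \<le> j" "j \<le> l" by auto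
        have "h (X j) \<otimes>\<^bsub>Q\<^esub> f k i = h (a k i j)" using pr.relation[OF p, of j] j by simp
        moreover have "a k i j \<in> J n"
        proof (cases "k = n")
          case True
          then show ?thesis using an[of i j] i j by simp
        next
          case False
          then show ?thesis using ak[of k i j] k i j by simp
        qed
        ultimately show "y \<in> ?L" using Xc[of j] j by simp
      qed
    qed
    moreover have "x [^]\<^bsub>T\<^esub> n \<in> ?L"
    proof -
      have rel: "h (x [^]\<^bsub>T\<^esub> k) \<otimes>\<^bsub>Q\<^esub> f k i = h (a k i 1)" using pr.relation[OF p order_refl] l3 by (simp add: x_def)
      have ajk: "a k i 1 \<in> J k"
      proof (cases "k = n")
        case True
        then show ?thesis using an[of i 1] i l3 by simp
      next
        case False
        then show ?thesis using ak1[of k i] k i by simp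
      qed
      then have ac: "a k i 1 \<in> carrier T" using ideal_subset[OF Jid[OF k]] by blast
      have "x [^]\<^bsub>T\<^esub> (n - k) \<otimes>\<^bsub>T\<^esub> x [^]\<^bsub>T\<^esub> k = x [^]\<^bsub>T\<^esub> n" using xc k(2) by (simp add: T.nat_pow_mult)
      then have "h (x [^]\<^bsub>T\<^esub> n) = h (x [^]\<^bsub>T\<^esub> (n - k)) \<otimes>\<^bsub>Q\<^esub> h (x [^]\<^bsub>T\<^esub> k)" using h.hom_mult[OF pc pc, of "n - k" k] by simp
      then have "h (x [^]\<^bsub>T\<^esub> n) \<otimes>\<^bsub>Q\<^esub> f k i = h (x [^]\<^bsub>T\<^esub> (n - k)) \<otimes>\<^bsub>Q\<^esub> (h (x [^]\<^bsub>T\<^esub> k) \<otimes>\<^bsub>Q\<^esub> f k i)"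
        using h.hom_closed[OF pc] fc by (simp only: Q.m_assoc)
      also have "\<dots> = h (x [^]\<^bsub>T\<^esub> (n - k) \<otimes>\<^bsub>T\<^esub> a k i 1)" unfolding rel h.hom_mult[OF pc ac] ..
      finally show ?thesis using power_mult_J[OF k ajk] pc by simp
    qed
    ultimately have "adjoin T Y (x [^]\<^bsub>T\<^esub> n) \<subseteq> ?L" by (rule T.adjoin_least[OF L])
    then show ?thesis using t[unfolded J_eq[OF n1 order_refl]] by blast
  qed

  (* J n K \<subseteq> J n, by linearity in the generators of K. *)
  have stable: "h t \<otimes>\<^bsub>Q\<^esub> u \<in> h ` J n" if t: "t \<in> J n" and u: "u \<in> K" for t u
  proof -
    have tc: "t \<in> carrier T" using t ideal_subset[OF Jn] by blast
    obtain r b where r: "u = \<iota> r \<oplus>\<^bsub>Q\<^esub> (\<Oplus>\<^bsub>Q\<^esub>p\<in>pairs n len. \<iota> (b p) \<otimes>\<^bsub>Q\<^esub> f (fst p) (snd p))"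
        "r \<in> carrier R" "b \<in> pairs n len \<rightarrow> carrier R"
      using u unfolding Keq by blast
    have rt: "\<exists>t'\<in>J n. \<iota> r' \<otimes>\<^bsub>Q\<^esub> h t = h t'" if t: "t \<in> J n" and r': "r' \<in> carrier R" for r' t
    proof -
      obtain r0 where r0: "r0 \<in> carrier T" "r' = \<pi> r0" using r' carR by blast
      have "\<iota> r' \<otimes>\<^bsub>Q\<^esub> h t = h (r0 \<otimes>\<^bsub>T\<^esub> t)" using r0 t ideal_subset[OF Jn] by (auto simp: h_def[symmetric])
      then show ?thesis using ideal.I_l_closed[OF Jn t r0(1)] by blast
    qed
    have fc: "f (fst p) (snd p) \<in> carrier Q" if "p \<in> pairs n len" for p
      using fK[of "fst p" "snd p"] that KQ by auto
    have bc: "\<iota> (b p) \<in> carrier Q" if "p \<in> pairs n len" for p using r(3) that by auto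
    have key: "\<exists>t'\<in>J n. h t \<otimes>\<^bsub>Q\<^esub> (\<Oplus>\<^bsub>Q\<^esub>p\<in>A. \<iota> (b p) \<otimes>\<^bsub>Q\<^esub> f (fst p) (snd p)) = h t'"
      if "finite A" "A \<subseteq> pairs n len" for A
      using that
    proof (induction A)
      case empty
      have "h t \<otimes>\<^bsub>Q\<^esub> \<zero>\<^bsub>Q\<^esub> = h \<zero>\<^bsub>T\<^esub>" using tc by simp
      then show ?case unfolding Q.finsum_empty by (rule bexI[OF _ ideal_zero[OF Jn]])
    next
      case (insert p A)
      have p: "p \<in> pairs n len" using insert.prems by simp
      define S where "S = (\<Oplus>\<^bsub>Q\<^esub>p\<in>A. \<iota> (b p) \<otimes>\<^bsub>Q\<^esub> f (fst p) (snd p))"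
      obtain t1 where t1: "t1 \<in> J n" "h t \<otimes>\<^bsub>Q\<^esub> S = h t1" using insert unfolding S_def by blast
      have "(fst p, snd p) \<in> pairs n len" using p by simp
      from gen_stable[OF this t] obtain t2 where t2: "t2 \<in> J n" "h t \<otimes>\<^bsub>Q\<^esub> f (fst p) (snd p) = h t2" by blast
      obtain t3 where t3: "t3 \<in> J n" "\<iota> (b p) \<otimes>\<^bsub>Q\<^esub> h t2 = h t3" using rt[OF t2(1), of "b p"] r(3) p by blast
      have Sc: "S \<in> carrier Q" unfolding S_def
        by (rule Q.finsum_closed) (use insert.prems fc bc in blast)
      have e: "(\<Oplus>\<^bsub>Q\<^esub>p\<in>insert p A. \<iota> (b p) \<otimes>\<^bsub>Q\<^esub> f (fst p) (snd p)) = \<iota> (b p) \<otimes>\<^bsub>Q\<^esub> f (fst p) (snd p) \<oplus>\<^bsub>Q\<^esub> S"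
        unfolding S_def by (rule Q.finsum_insert[OF insert.hyps]) (use insert.prems fc bc in blast)+
      have htc: "h t \<in> carrier Q" using tc by simp
      have "h t \<otimes>\<^bsub>Q\<^esub> (\<iota> (b p) \<otimes>\<^bsub>Q\<^esub> f (fst p) (snd p) \<oplus>\<^bsub>Q\<^esub> S)
        = \<iota> (b p) \<otimes>\<^bsub>Q\<^esub> (h t \<otimes>\<^bsub>Q\<^esub> f (fst p) (snd p)) \<oplus>\<^bsub>Q\<^esub> h t \<otimes>\<^bsub>Q\<^esub> S"
        using htc bc[OF p] fc[OF p] Sc by algebra
      also have "\<dots> = h (t3 \<oplus>\<^bsub>T\<^esub> t1)"
        unfolding t2(2) t3(2) t1(2) using t3(1) t1(1) ideal_subset[OF Jn] by (intro h.hom_add[symmetric]) auto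
      finally show ?case unfolding e using ideal_add[OF Jn t3(1) t1(1)] by blast
    qed
    define S where "S = (\<Oplus>\<^bsub>Q\<^esub>p\<in>pairs n len. \<iota> (b p) \<otimes>\<^bsub>Q\<^esub> f (fst p) (snd p))"
    have Sc: "S \<in> carrier Q" unfolding S_def by (rule Q.finsum_closed) (use fc bc in blast)
    obtain t1 where t1: "t1 \<in> J n" "h t \<otimes>\<^bsub>Q\<^esub> S = h t1" using key[OF finite_pairs subset_refl] unfolding S_def by blast
    obtain t2 where t2: "t2 \<in> J n" "\<iota> r \<otimes>\<^bsub>Q\<^esub> h t = h t2" using rt[OF t r(2)] by blast
    have c: "h t \<in> carrier Q" "\<iota> r \<in> carrier Q" using tc r(2) by auto
    have "h t \<otimes>\<^bsub>Q\<^esub> u = \<iota> r \<otimes>\<^bsub>Q\<^esub> h t \<oplus>\<^bsub>Q\<^esub> h t \<otimes>\<^bsub>Q\<^esub> S"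
      unfolding r(1) S_def[symmetric] using c Sc by algebra
    also have "\<dots> = h (t2 \<oplus>\<^bsub>T\<^esub> t1)"
      unfolding t2(2) t1(2) using t2(1) t1(1) ideal_subset[OF Jn] by (intro h.hom_add[symmetric]) auto
    finally show ?thesis using imageI[OF ideal_add[OF Jn t2(1) t1(1)], of h] by (simp only:)
  qed

  (* From X_1^(n-1) = y + r X_1^n with y in Y the unit 1 - r X_1 would put X_1^(n-1) into Y,
     which the height theorem forbids. *)
  have xpow: "x [^]\<^bsub>T\<^esub> (n - 1) \<notin> J n"
  proof
    assume "x [^]\<^bsub>T\<^esub> (n - 1) \<in> J n"
    then obtain y r where y: "x [^]\<^bsub>T\<^esub> (n - 1) = y \<oplus>\<^bsub>T\<^esub> r \<otimes>\<^bsub>T\<^esub> x [^]\<^bsub>T\<^esub> n" "y \<in> Y" "r \<in> carrier T"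
      unfolding J_eq[OF n1 order_refl] adjoin_def by blast
    have yc: "y \<in> carrier T" using y(2) ideal_subset[OF Y] by blast
    define u where "u = x [^]\<^bsub>T\<^esub> (n - 1)"
    have u: "u \<in> carrier T" unfolding u_def by (rule pc)
    have n_Suc: "n = Suc (n - 1)" using n2 by simp
    have xn: "x [^]\<^bsub>T\<^esub> n = u \<otimes>\<^bsub>T\<^esub> x" unfolding u_def by (subst n_Suc) simp
    define \<epsilon> where "\<epsilon> = \<one>\<^bsub>T\<^esub> \<ominus>\<^bsub>T\<^esub> r \<otimes>\<^bsub>T\<^esub> x"
    have \<epsilon>c: "\<epsilon> \<in> carrier T" unfolding \<epsilon>_def using y(3) xc by simp
    have rx: "r \<otimes>\<^bsub>T\<^esub> x \<in> \<mm>" unfolding m_eq by (rule T.adjoin_mult[OF Y xc y(3)])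
    have "\<epsilon> \<notin> \<mm>"
    proof
      assume "\<epsilon> \<in> \<mm>"
      then have "r \<otimes>\<^bsub>T\<^esub> x \<oplus>\<^bsub>T\<^esub> \<epsilon> \<in> \<mm>" by (rule ideal_add[OF m rx])
      moreover have "r \<otimes>\<^bsub>T\<^esub> x \<oplus>\<^bsub>T\<^esub> \<epsilon> = \<one>\<^bsub>T\<^esub>" unfolding \<epsilon>_def using y(3) xc by algebra
      ultimately show False using one_m by simp
    qed
    then have \<epsilon>: "\<epsilon> \<in> Units T" using unitT \<epsilon>c by blast
    have "\<epsilon> \<otimes>\<^bsub>T\<^esub> u = u \<ominus>\<^bsub>T\<^esub> r \<otimes>\<^bsub>T\<^esub> (u \<otimes>\<^bsub>T\<^esub> x)" unfolding \<epsilon>_def using y(3) xc u by algebra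
    also have "\<dots> = (y \<oplus>\<^bsub>T\<^esub> r \<otimes>\<^bsub>T\<^esub> (u \<otimes>\<^bsub>T\<^esub> x)) \<ominus>\<^bsub>T\<^esub> r \<otimes>\<^bsub>T\<^esub> (u \<otimes>\<^bsub>T\<^esub> x)"
      using y(1)[folded u_def] unfolding xn by (simp only:)
    also have "\<dots> = y" using y(3) yc xc u by algebra
    finally have "\<epsilon> \<otimes>\<^bsub>T\<^esub> u \<in> Y" using y(2) by simp
    then have "inv\<^bsub>T\<^esub> \<epsilon> \<otimes>\<^bsub>T\<^esub> (\<epsilon> \<otimes>\<^bsub>T\<^esub> u) \<in> Y" by (rule ideal.I_l_closed[OF Y]) (use \<epsilon> in simp)
    moreover have "inv\<^bsub>T\<^esub> \<epsilon> \<otimes>\<^bsub>T\<^esub> (\<epsilon> \<otimes>\<^bsub>T\<^esub> u) = u" using \<epsilon> \<epsilon>c u by (simp add: T.m_assoc[symmetric])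
    ultimately have "x [^]\<^bsub>T\<^esub> (n - 1) \<in> Y" by (simp add: u_def)
    then show False
      using power_notin_rest_of_parameters[OF locT dimT _ X Xgen, of "n - 1"] l3 by (simp add: Y_def x_def)
  qed

  have p1: "(n, 1) \<in> pairs n len" using lenn n1 by (simp add: pairs_def)

  (* A power of the regular element s lies in J n and multiplies K into R; every element of the
     maximal ideal has a power divisible by it, because R has dimension one. *)
  have endo: "z \<in> h ` carrier T" if z: "z \<in> carrier Q" "\<And>u. u \<in> K \<Longrightarrow> z \<otimes>\<^bsub>Q\<^esub> u \<in> K" for z
  proof -
    obtain s0 where s0: "s0 \<in> \<mm>" "s = \<pi> s0" using s(1) unfolding mR by blast
    have s0c: "s0 \<in> carrier T" by (rule mc[OF s0(1)])
    define g where "g = s0 [^]\<^bsub>T\<^esub> n"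
    have gc: "g \<in> carrier T" unfolding g_def using s0c by simp
    have gJ: "g \<in> J n" unfolding g_def J_eq[OF n1 order_refl]
      by (rule T.adjoin_pow[OF Y xc]) (use s0(1) m_eq in simp)
    have \<pi>g: "\<pi> g = s [^]\<^bsub>R\<^esub> n"
      unfolding g_def s0(2) by (rule ring_hom_nat_pow[OF T.is_cring R.is_cring \<pi> s0c])
    have reg: "y = \<zero>\<^bsub>R\<^esub>" if "y \<in> carrier R" "s [^]\<^bsub>R\<^esub> (k::nat) \<otimes>\<^bsub>R\<^esub> y = \<zero>\<^bsub>R\<^esub>" for k y
      using that
    proof (induction k arbitrary: y)
      case 0
      then have "\<one>\<^bsub>R\<^esub> \<otimes>\<^bsub>R\<^esub> y = \<zero>\<^bsub>R\<^esub>" by (simp only: R.nat_pow_0)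
      then show ?case unfolding R.l_one[OF 0(1)] .
    next
      case (Suc k)
      have "s [^]\<^bsub>R\<^esub> k \<otimes>\<^bsub>R\<^esub> (s \<otimes>\<^bsub>R\<^esub> y) = \<zero>\<^bsub>R\<^esub>"
        using Suc.prems(2) unfolding R.nat_pow_Suc R.m_assoc[OF R.nat_pow_closed[OF sc] sc Suc.prems(1)] .
      then have "s \<otimes>\<^bsub>R\<^esub> y = \<zero>\<^bsub>R\<^esub>" by (rule Suc.IH[OF R.m_closed[OF sc Suc.prems(1)]])
      then show ?case by (rule s(2)[OF Suc.prems(1)])
    qed
    have snc: "s [^]\<^bsub>R\<^esub> n \<in> carrier R" using sc by simp
    show ?thesis
    proof (rule tos.endomorphisms_trivial[OF gc _ _ _ z])
      show "h g \<in> Units Q" unfolding h_def \<pi>g by (rule regular_unit[OF snc reg])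
      show "h g \<otimes>\<^bsub>Q\<^esub> u \<in> h ` carrier T" if "u \<in> K" for u
        using stable[OF gJ that] ideal_subset[OF Jn] by blast
      fix t assume t: "t \<in> \<mm>"
      have tR: "\<pi> t \<in> max_ideal R" using t mR by blast
      have "\<exists>(k::nat). \<exists>r\<in>carrier R. \<pi> t [^]\<^bsub>R\<^esub> k = r \<otimes>\<^bsub>R\<^esub> s [^]\<^bsub>R\<^esub> n"
        by (rule dim_one_power_multiple[OF locR dimR snc reg tR])
      then obtain k :: nat and r where r: "r \<in> carrier R" "\<pi> t [^]\<^bsub>R\<^esub> k = r \<otimes>\<^bsub>R\<^esub> s [^]\<^bsub>R\<^esub> n"
        by (elim exE bexE)
      have "h (t [^]\<^bsub>T\<^esub> k) = h g \<otimes>\<^bsub>Q\<^esub> \<iota> r"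
      proof -
        have "h (t [^]\<^bsub>T\<^esub> k) = h t [^]\<^bsub>Q\<^esub> k" by (rule ring_hom_nat_pow[OF T.is_cring Qc hhom mc[OF t]])
        also have "\<dots> = \<iota> (\<pi> t [^]\<^bsub>R\<^esub> k)" 
          unfolding h_def by (rule ring_hom_nat_pow[OF R.is_cring Qc \<iota> \<pi>_mem[OF mc[OF t]], symmetric])
        also have "\<dots> = \<iota> r \<otimes>\<^bsub>Q\<^esub> \<iota> (s [^]\<^bsub>R\<^esub> n)" unfolding r(2) by (rule \<iota>.hom_mult[OF r(1) snc])
        also have "\<dots> = h g \<otimes>\<^bsub>Q\<^esub> \<iota> r" unfolding h_def \<pi>g using r(1) snc by (intro Q.m_comm) auto
        finally show ?thesis .
      qed
      moreover have "\<iota> r \<in> K" using one_sub r(1) by blast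
      ultimately show "\<exists>k::nat. \<exists>u\<in>K. h (t [^]\<^bsub>T\<^esub> k) = h g \<otimes>\<^bsub>Q\<^esub> u" by blast
    qed
  qed

  interpret uc: uniserial_conductor T Q h \<mm> K Y x n
  proof (intro uniserial_conductor.intro uniserial_conductor_axioms.intro)
    show "type_one_submodule T Q h \<mm> K" by (rule tos.type_one_submodule_axioms)
    show "ideal Y T" by (rule Y)
    show "x \<in> carrier T" by (rule xc)
    show "\<mm> = adjoin T Y x" by (rule m_eq)
    show "\<one>\<^bsub>T\<^esub> \<notin> \<mm>" by (rule one_m)
    show "0 < n" using n2 by simp
    show "\<exists>u\<in>K. h (x [^]\<^bsub>T\<^esub> (n - 1)) \<otimes>\<^bsub>Q\<^esub> u \<notin> h ` carrier T"
    proof (rule bexI[OF _ fK[OF p1]], rule notI)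
      assume "h (x [^]\<^bsub>T\<^esub> (n - 1)) \<otimes>\<^bsub>Q\<^esub> f n 1 \<in> h ` carrier T"
      with xpow show False by (rule notE[OF _ annih[OF p1 pc]])
    qed
    show "h t \<otimes>\<^bsub>Q\<^esub> u \<in> h ` adjoin T Y (x [^]\<^bsub>T\<^esub> n)" if "t \<in> adjoin T Y (x [^]\<^bsub>T\<^esub> n)" "u \<in> K" for t u
      by (rule stable[unfolded J_eq[OF n1 order_refl], OF that])
    show "z \<in> h ` carrier T" if "z \<in> carrier Q" "\<And>u. u \<in> K \<Longrightarrow> z \<otimes>\<^bsub>Q\<^esub> u \<in> K" for z by (rule endo[OF that])
    show "t \<in> Units T" if "t \<in> carrier T" "t \<notin> \<mm>" for t by (rule unitT[OF that])
  qed

  have goto: "n_goto_ring R Q \<iota> n"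
    unfolding n_goto_ring_def
    by (intro conjI exI[of _ K] CM dimR frac can uc.quot_length_square[OF R.is_cring \<iota> carR h_def])

  (* Already f n 1 forces the elements of the conductor into J n; conversely J n K \<subseteq> J n gives
     J n R[K] \<subseteq> J n. *)
  have c_eq: "\<cc> = \<pi> ` J n"
  proof
    show "\<cc> \<subseteq> \<pi> ` J n"
    proof
      fix b assume b: "b \<in> \<cc>"
      then have bR: "b \<in> carrier R" and col: "\<iota> b \<in> colon Q (\<iota> ` carrier R) (generate_ring Q (\<iota> ` carrier R \<union> K))"
        unfolding cdef by auto
      obtain t where t: "t \<in> carrier T" "b = \<pi> t" using bR carR by blast
      have "f n 1 \<in> generate_ring Q (\<iota> ` carrier R \<union> K)" using fK[OF p1] by (intro generate_ring.incl) simp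
      then have "\<iota> b \<otimes>\<^bsub>Q\<^esub> f n 1 \<in> \<iota> ` carrier R" using col unfolding colon_def by blast
      then have "h t \<otimes>\<^bsub>Q\<^esub> f n 1 \<in> h ` carrier T" unfolding hT t(2) h_def .
      then show "b \<in> \<pi> ` J n" unfolding t(2) by (intro imageI annih[OF p1 t(1)])
    qed
    show "\<pi> ` J n \<subseteq> \<cc>"
    proof
      fix b assume "b \<in> \<pi> ` J n"
      then obtain t where t: "t \<in> J n" "b = \<pi> t" by blast
      have tc: "t \<in> carrier T" using t(1) ideal_subset[OF Jn] by blast
      have HK: "\<iota> ` carrier R \<union> K = K" using one_sub by blast
      have "y \<in> carrier Q \<and> (\<forall>t\<in>J n. h t \<otimes>\<^bsub>Q\<^esub> y \<in> h ` J n)" if "y \<in> generate_ring Q (\<iota> ` carrier R \<union> K)" for y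
        using that unfolding HK
      proof induction
        case one
        then show ?case using stable K1 by blast
      next
        case (incl y)
        then show ?case using stable KQ by blast
      next
        case (a_inv y)
        have "h t \<otimes>\<^bsub>Q\<^esub> (\<ominus>\<^bsub>Q\<^esub> y) \<in> h ` J n" if t: "t \<in> J n" for t
        proof -
          obtain t' where t': "t' \<in> J n" "h t \<otimes>\<^bsub>Q\<^esub> y = h t'" using a_inv t by blast
          have c: "t \<in> carrier T" "t' \<in> carrier T" using t t'(1) ideal_subset[OF Jn] by auto
          have "h t \<otimes>\<^bsub>Q\<^esub> (\<ominus>\<^bsub>Q\<^esub> y) = h (\<ominus>\<^bsub>T\<^esub> t')" using a_inv c t'(2) by (simp add: Q.r_minus)
          moreover have "\<ominus>\<^bsub>T\<^esub> t' \<in> J n"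
            using ideal_minus[OF Jn ideal_zero[OF Jn] t'(1)] c by (simp add: a_minus_def)
          ultimately show ?thesis by blast
        qed
        then show ?case using a_inv by simp
      next
        case (eng_add y z)
        have "h t \<otimes>\<^bsub>Q\<^esub> (y \<oplus>\<^bsub>Q\<^esub> z) \<in> h ` J n" if t: "t \<in> J n" for t
        proof -
          obtain t' where t': "t' \<in> J n" "h t \<otimes>\<^bsub>Q\<^esub> y = h t'" using eng_add t by blast
          obtain t'' where t'': "t'' \<in> J n" "h t \<otimes>\<^bsub>Q\<^esub> z = h t''" using eng_add t by blast
          have c: "t \<in> carrier T" "t' \<in> carrier T" "t'' \<in> carrier T" using t t'(1) t''(1) ideal_subset[OF Jn] by auto
          have "h t \<otimes>\<^bsub>Q\<^esub> (y \<oplus>\<^bsub>Q\<^esub> z) = h (t' \<oplus>\<^bsub>T\<^esub> t'')" using eng_add c t'(2) t''(2) by (simp add: Q.r_distr)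
          then show ?thesis using ideal_add[OF Jn t'(1) t''(1)] by blast
        qed
        then show ?case using eng_add by simp
      next
        case (eng_mult y z)
        have "h t \<otimes>\<^bsub>Q\<^esub> (y \<otimes>\<^bsub>Q\<^esub> z) \<in> h ` J n" if t: "t \<in> J n" for t
        proof -
          obtain t' where t': "t' \<in> J n" "h t \<otimes>\<^bsub>Q\<^esub> y = h t'" using eng_mult t by blast
          have c: "t \<in> carrier T" using t ideal_subset[OF Jn] by auto
          have "h t \<otimes>\<^bsub>Q\<^esub> (y \<otimes>\<^bsub>Q\<^esub> z) = (h t \<otimes>\<^bsub>Q\<^esub> y) \<otimes>\<^bsub>Q\<^esub> z" using eng_mult c by (simp add: Q.m_assoc)
          then show ?thesis unfolding t'(2) using eng_mult t'(1) by simp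
        qed
        then show ?case using eng_mult by simp
      qed
      then have "\<iota> b \<otimes>\<^bsub>Q\<^esub> y \<in> \<iota> ` carrier R" if "y \<in> generate_ring Q (\<iota> ` carrier R \<union> K)" for y
        using that t ideal_subset[OF Jn] unfolding hT t(2) h_def[symmetric] by blast
      moreover have "\<iota> b \<in> carrier Q" "b \<in> carrier R" using t(2) \<pi>_mem[OF tc] by auto
      ultimately show "b \<in> \<cc>" unfolding cdef colon_def by blast
    qed
  qed
  have aJ: "\<aa> \<subseteq> J n"
  proof
    fix t assume t: "t \<in> \<aa>"
    then have tc: "t \<in> carrier T" using ideal_subset[OF aI(1)] by blast
    have "\<pi> t = \<zero>\<^bsub>R\<^esub>" unfolding \<pi>_def R FactRing_def using T.a_rcos_zero[OF aI(1) t] by simp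
    then have "h t = \<zero>\<^bsub>Q\<^esub>" by (simp add: h_def)
    then have "h t \<otimes>\<^bsub>Q\<^esub> f n 1 = h \<zero>\<^bsub>T\<^esub>" using fK[OF p1] KQ by auto
    then show "t \<in> J n" using annih[OF p1 tc] imageI[OF T.zero_closed, of h] by simp
  qed
  have cI: "ideal \<cc> R"
    unfolding c_eq R \<pi>_def[abs_def] by (rule T.ring_ideal_imp_quot_ideal[OF aI(1) Jn])
  have mem_c: "\<pi> t \<in> \<cc> \<longleftrightarrow> t \<in> J n" if "t \<in> carrier T" for t
    unfolding c_eq \<pi>_def[abs_def] by (rule T.rcos_mem_image_iff[OF aI(1) Jn aJ that])
  (* Here n \<ge> 2 is used: the class of X_1 in T/J n is a nonzero generator of the maximal ideal. *)
  have xJ: "x \<notin> J n"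
  proof
    assume "x \<in> J n"
    then have "x [^]\<^bsub>T\<^esub> (n - 2) \<otimes>\<^bsub>T\<^esub> x \<in> J n" by (rule ideal.I_l_closed[OF Jn _ pc])
    moreover have "n - 1 = Suc (n - 2)" using n2 by simp
    ultimately show False using xpow by simp
  qed
  have \<pi>x: "\<pi> x \<in> carrier R" by (rule \<pi>_mem[OF xc])
  have c_ne: "\<cc> \<noteq> carrier R" using mem_c[OF xc] xJ \<pi>x by blast
  interpret C: ideal \<cc> R by (rule cI)
  have Cc: "cring (R Quot \<cc>)" by (rule C.quotient_is_cring[OF R.is_cring])
  interpret B: cring "R Quot \<cc>" by (rule Cc)
  define y where "y = \<cc> +>\<^bsub>R\<^esub> \<pi> x"
  have quo: "(+>\<^bsub>R\<^esub>) \<cc> \<in> ring_hom R (R Quot \<cc>)" by (rule C.rcos_ring_hom)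
  have yc: "y \<in> carrier (R Quot \<cc>)" unfolding y_def by (rule ring_hom_closed[OF quo \<pi>x])
  have zero_iff: "\<cc> +>\<^bsub>R\<^esub> b = \<zero>\<^bsub>R Quot \<cc>\<^esub> \<longleftrightarrow> b \<in> \<cc>" if b: "b \<in> carrier R" for b
  proof -
    have "\<zero>\<^bsub>R Quot \<cc>\<^esub> = \<cc> +>\<^bsub>R\<^esub> \<zero>\<^bsub>R\<^esub>"
      unfolding FactRing_def using R.a_rcos_zero[OF cI ideal_zero[OF cI]] by simp
    then show ?thesis using C.rcos_eq_iff[OF b R.zero_closed] b by (simp add: a_minus_def)
  qed
  have y0: "y \<noteq> \<zero>\<^bsub>R Quot \<cc>\<^esub>" unfolding y_def using zero_iff[OF \<pi>x] mem_c[OF xc] xJ by blast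
  have "max_ideal (R Quot \<cc>) = (+>\<^bsub>R\<^esub>) \<cc> ` \<pi> ` \<mm>" unfolding max_ideal_Quot[OF locR cI c_ne] mR ..
  also have "\<dots> = cgenideal (R Quot \<cc>) y"
  proof
    show "(+>\<^bsub>R\<^esub>) \<cc> ` \<pi> ` \<mm> \<subseteq> cgenideal (R Quot \<cc>) y"
    proof
      fix b assume "b \<in> (+>\<^bsub>R\<^esub>) \<cc> ` \<pi> ` \<mm>"
      then obtain t where t: "t \<in> \<mm>" "b = \<cc> +>\<^bsub>R\<^esub> \<pi> t" by blast
      obtain v r where v: "t = v \<oplus>\<^bsub>T\<^esub> r \<otimes>\<^bsub>T\<^esub> x" "v \<in> Y" "r \<in> carrier T" using t(1) unfolding m_eq adjoin_def by blast
      have vc: "v \<in> carrier T" using v(2) ideal_subset[OF Y] by blast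
      have rx: "r \<otimes>\<^bsub>T\<^esub> x \<in> carrier T" using v(3) xc by simp
      have "\<pi> v \<in> \<cc>" using mem_c[OF vc] YJ[OF n1 order_refl] v(2) by blast
      then have v0: "\<cc> +>\<^bsub>R\<^esub> \<pi> v = \<zero>\<^bsub>R Quot \<cc>\<^esub>" using zero_iff[OF \<pi>_mem[OF vc]] by simp
      have "\<pi> t = \<pi> v \<oplus>\<^bsub>R\<^esub> \<pi> r \<otimes>\<^bsub>R\<^esub> \<pi> x"
        unfolding v(1) ring_hom_add[OF \<pi> vc rx] ring_hom_mult[OF \<pi> v(3) xc] ..
      then have "b = (\<cc> +>\<^bsub>R\<^esub> \<pi> v) \<oplus>\<^bsub>R Quot \<cc>\<^esub> (\<cc> +>\<^bsub>R\<^esub> \<pi> r) \<otimes>\<^bsub>R Quot \<cc>\<^esub> y"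
        unfolding t(2) y_def
        using ring_hom_add[OF quo \<pi>_mem[OF vc] R.m_closed[OF \<pi>_mem[OF v(3)] \<pi>x]] ring_hom_mult[OF quo \<pi>_mem[OF v(3)] \<pi>x] by simp
      then have "b = (\<cc> +>\<^bsub>R\<^esub> \<pi> r) \<otimes>\<^bsub>R Quot \<cc>\<^esub> y"
        unfolding v0 using ring_hom_closed[OF quo \<pi>_mem[OF v(3)]] yc by simp
      then show "b \<in> cgenideal (R Quot \<cc>) y"
        unfolding cgenideal_def using ring_hom_closed[OF quo \<pi>_mem[OF v(3)]] by blast
    qed
    have "x \<in> \<mm>" unfolding m_eq by (rule T.adjoin_self[OF Y xc])
    then have "y \<in> (+>\<^bsub>R\<^esub>) \<cc> ` \<pi> ` \<mm>" unfolding y_def by blast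
    moreover have "ideal ((+>\<^bsub>R\<^esub>) \<cc> ` \<pi> ` \<mm>) (R Quot \<cc>)"
      unfolding mR[symmetric] by (rule R.ring_ideal_imp_quot_ideal[OF cI ideal_max_ideal[OF locR]])
    ultimately show "cgenideal (R Quot \<cc>) y \<subseteq> (+>\<^bsub>R\<^esub>) \<cc> ` \<pi> ` \<mm>" by (intro B.cgenideal_minimal)
  qed
  finally have "emb_dim (R Quot \<cc>) = 1" by (rule emb_dim_eq_one[OF Cc yc y0])
  then show ?thesis using goto by blast
qed

end
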